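(* Let $\Omega\subseteq\mathbb{R}^d$ be a bounded Lipschitz domain, let $G$ be a closed subgroup of the orthogonal group $O(d)$ such that $g(\Omega)\subseteq\Omega$ for all $g\in G$. Let $A\colon\Omega\to\mathbb{R}^{d\times d}$ have bounded measurable real coefficients and satisfy $\operatorname{Re}(\overline{\xi}^\top A(x)\xi)\ge\alpha|\xi|^2$ for all $\xi\in\mathbb{C}^d$, $x\in\Omega$, for some $\alpha>0$; assume moreover that for every $x\in\Omega$ the matrix $A(x)$ is symmetric and commutes with every $g\in G$, and that $A(gx)=A(x)$ for all $x\in\Omega$, $g\in G$. Let $B\in\mathcal{L}(L^2(\partial\Omega))$ be self-adjoint and $G$-equivariant. Let $L^2_0(\partial\Omega)$ be the subspace of $f\in L^2(\partial\Omega)$ with $\int_{\partial\Omega}f\,d\sigma=0$. Assume $\langle B\mathbf{1}_{\partial\Omega},\mathbf{1}_{\partial\Omega}\rangle_{L^2(\partial\Omega)}<0$. Then $\mathrm{s}(-L_B)>0$, and there exists a constant $\beta>0$, depending only on $\Omega$ and $\alpha$, such that if $\|B|_{L^2_0(\partial\Omega)}\|_{L^2_0(\partial\Omega)\to L^2(\partial\Omega)}\le\beta$, then every eigenfunction of $-L_B$ associated to the eigenvalue $\mathrm{s}(-L_B)$ is $G$-invariant.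
   Context: A bounded Lipschitz domain is a bounded, non-empty, connected open set whose boundary is locally the graph of a Lipschitz function. Functions are complex-valued; $\partial\Omega$ carries the $(d-1)$-dimensional Hausdorff measure $\sigma$; $\gamma\colon H^1(\Omega)\to L^2(\partial\Omega)$ is the trace; $\mathbf{1}_{\partial\Omega}$ is the constant function $1$ on $\partial\Omega$. The form $\mathfrak{a}_B[u,v]=\int_\Omega A\nabla u\cdot\overline{\nabla v}\,dx+\langle B\gamma(u),\gamma(v)\rangle_{L^2(\partial\Omega)}$ with domain $H^1(\Omega)$ has associated operator $L_B$: $u\in\operatorname{dom}(L_B)$ iff $u\in H^1(\Omega)$ and some $f\in L^2(\Omega)$ satisfies $\mathfrak{a}_B[u,v]=\langle f,v\rangle_{L^2(\Omega)}$ for all $v\in H^1(\Omega)$; then $L_Bu=f$. $\mathrm{s}(C)=\sup\{\operatorname{Re}\lambda:\lambda\in\sigma(C)\}$ is the spectral bound. For $g\in G$, $T_g u:=u(g^{-1}\cdot)$ on $L^2(\Omega)$ and $S_g f:=f(g^{-1}\cdot)$ on $L^2(\partial\Omega)$. A function $u\in L^2(\Omega)$ is $G$-invariant if $T_gu=u$ for all $g\in G$. $B$ is $G$-equivariant if $BS_g=S_gB$ for all $g\in G$. *)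

theory Defs
  imports "HOL-Analysis.Analysis"
begin

text \<open>Normalisation constant omega_s = pi^(s/2) / Gamma(s/2+1) (volume of the unit s-ball).\<close>
definition haus_const :: "nat \<Rightarrow> real" where
  "haus_const s = pi powr (real s / 2) / Gamma (real s / 2 + 1)"

definition hausdorff_pre :: "nat \<Rightarrow> real \<Rightarrow> ('a::metric_space) set \<Rightarrow> ennreal" where
  "hausdorff_pre s \<delta> A =
     (INF C \<in> {C :: nat \<Rightarrow> 'a set. A \<subseteq> (\<Union>i. C i) \<and> (\<forall>i. bounded (C i) \<and> diameter (C i) \<le> \<delta>)}.
        (\<Sum>i. ennreal (if C i = {} then 0 else haus_const s * (diameter (C i) / 2) ^ s)))"

definition hausdorff_outer :: "nat \<Rightarrow> ('a::metric_space) set \<Rightarrow> ennreal" where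
  "hausdorff_outer s A = (SUP \<delta> \<in> {0<..}. hausdorff_pre s \<delta> A)"

definition bdry_measure :: "(real^'n) set \<Rightarrow> (real^'n) measure" where
  "bdry_measure \<Omega> = measure_of (frontier \<Omega>) (sets (restrict_space borel (frontier \<Omega>)))
                         (hausdorff_outer (CARD('n) - 1))"

definition lipschitz_domain :: "(real^'n) set \<Rightarrow> bool" where
  "lipschitz_domain \<Omega> \<longleftrightarrow> bounded \<Omega> \<and> \<Omega> \<noteq> {} \<and> open \<Omega> \<and> connected \<Omega> \<and>
    (\<forall>p \<in> frontier \<Omega>. \<exists>e r h L (\<phi> :: real^'n \<Rightarrow> real).
        norm e = 1 \<and> r > 0 \<and> h > 0 \<and> L-lipschitz_on {y. y \<bullet> e = 0} \<phi> \<and>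
        (let U = {x. norm ((x - p) - ((x - p) \<bullet> e) *\<^sub>R e) < r \<and> \<bar>(x - p) \<bullet> e\<bar> < h}
         in \<Omega> \<inter> U = {x \<in> U. (x - p) \<bullet> e < \<phi> ((x - p) - ((x - p) \<bullet> e) *\<^sub>R e)}))"

section \<open>L^2 spaces (functions, equality understood almost everywhere)\<close>

definition L2 :: "'a measure \<Rightarrow> ('a \<Rightarrow> complex) set" where
  "L2 M = {f. f \<in> borel_measurable M \<and> integrable M (\<lambda>x. (cmod (f x))\<^sup>2)}"

definition l2inner :: "'a measure \<Rightarrow> ('a \<Rightarrow> complex) \<Rightarrow> ('a \<Rightarrow> complex) \<Rightarrow> complex" where
  "l2inner M f g = (LINT x|M. f x * cnj (g x))"

definition l2norm :: "'a measure \<Rightarrow> ('a \<Rightarrow> complex) \<Rightarrow> real" where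
  "l2norm M f = sqrt (LINT x|M. (cmod (f x))\<^sup>2)"

definition C1c_on :: "(real^'n) set \<Rightarrow> (real^'n \<Rightarrow> complex) \<Rightarrow> (real^'n \<Rightarrow> complex^'n) \<Rightarrow> bool" where
  "C1c_on S \<phi> D \<longleftrightarrow>
     (\<forall>x. (\<phi> has_derivative (\<lambda>h. \<Sum>i\<in>UNIV. complex_of_real (h $ i) * D x $ i)) (at x)) \<and>
     continuous_on UNIV D \<and>
     compact (closure {x. \<phi> x \<noteq> 0}) \<and> closure {x. \<phi> x \<noteq> 0} \<subseteq> S"

definition weak_grad :: "(real^'n) set \<Rightarrow> (real^'n \<Rightarrow> complex) \<Rightarrow> (real^'n \<Rightarrow> complex^'n) \<Rightarrow> bool" where
  "weak_grad \<Omega> u w \<longleftrightarrow> u \<in> L2 (lebesgue_on \<Omega>) \<and> (\<forall>i. (\<lambda>x. w x $ i) \<in> L2 (lebesgue_on \<Omega>)) \<and>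
     (\<forall>\<phi> D. C1c_on \<Omega> \<phi> D \<longrightarrow> (\<forall>i.
        (LINT x|lebesgue_on \<Omega>. u x * D x $ i) = - (LINT x|lebesgue_on \<Omega>. w x $ i * \<phi> x)))"

definition H1 :: "(real^'n) set \<Rightarrow> (real^'n \<Rightarrow> complex) set" where
  "H1 \<Omega> = {u. \<exists>w. weak_grad \<Omega> u w}"

text \<open>g is (a representative of) the trace of u: the trace is the continuous extension
  of the restriction map from C^1_c(R^d) to H^1(Omega), i.e. g is the L^2(boundary) limit of
  the boundary values of C^1_c functions converging to u in H^1(Omega).\<close>
definition trace_rel :: "(real^'n) set \<Rightarrow> (real^'n \<Rightarrow> complex) \<Rightarrow> (real^'n \<Rightarrow> complex) \<Rightarrow> bool" where
  "trace_rel \<Omega> u g \<longleftrightarrow> u \<in> H1 \<Omega> \<and> g \<in> L2 (bdry_measure \<Omega>) \<and>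
     (\<exists>\<phi>s Ds w. (\<forall>k. C1c_on UNIV (\<phi>s k) (Ds k)) \<and> weak_grad \<Omega> u w \<and>
        (\<lambda>k. l2norm (lebesgue_on \<Omega>) (\<lambda>x. \<phi>s k x - u x) +
              (\<Sum>i\<in>UNIV. l2norm (lebesgue_on \<Omega>) (\<lambda>x. Ds k x $ i - w x $ i))) \<longlonglongrightarrow> 0 \<and>
        (\<lambda>k. l2norm (bdry_measure \<Omega>) (\<lambda>x. \<phi>s k x - g x)) \<longlonglongrightarrow> 0)"

section \<open>The operator L_B (as a relation: LB_rel u f means u in dom(L_B) and L_B u = f)\<close>

definition LB_rel :: "(real^'n) set \<Rightarrow> (real^'n \<Rightarrow> real^'n^'n) \<Rightarrow>
    ((real^'n \<Rightarrow> complex) \<Rightarrow> (real^'n \<Rightarrow> complex)) \<Rightarrow>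
    (real^'n \<Rightarrow> complex) \<Rightarrow> (real^'n \<Rightarrow> complex) \<Rightarrow> bool" where
  "LB_rel \<Omega> A B u f \<longleftrightarrow> u \<in> H1 \<Omega> \<and> f \<in> L2 (lebesgue_on \<Omega>) \<and>
     (\<forall>v wu wv gu gv. weak_grad \<Omega> u wu \<longrightarrow> weak_grad \<Omega> v wv \<longrightarrow>
        trace_rel \<Omega> u gu \<longrightarrow> trace_rel \<Omega> v gv \<longrightarrow>
        (LINT x|lebesgue_on \<Omega>. (\<Sum>i\<in>UNIV. \<Sum>j\<in>UNIV.
             complex_of_real (A x $ i $ j) * wu x $ j * cnj (wv x $ i)))
        + l2inner (bdry_measure \<Omega>) (B gu) gv
        = l2inner (lebesgue_on \<Omega>) f v)"

definition negLB_rel where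
  "negLB_rel \<Omega> A B u f \<longleftrightarrow> LB_rel \<Omega> A B u (\<lambda>x. - f x)"

text \<open>lambda is in the resolvent set of C (graph R) iff C - lambda is a bijection from
  dom(C) onto L^2 (modulo a.e. equality) with bounded inverse.\<close>
definition in_resolvent :: "'a measure \<Rightarrow> (('a \<Rightarrow> complex) \<Rightarrow> ('a \<Rightarrow> complex) \<Rightarrow> bool) \<Rightarrow> complex \<Rightarrow> bool" where
  "in_resolvent M R z \<longleftrightarrow>
     (\<forall>f \<in> L2 M. \<exists>u \<in> L2 M. R u (\<lambda>x. f x + z * u x)) \<and>
     (\<forall>f u1 u2. f \<in> L2 M \<longrightarrow> u1 \<in> L2 M \<longrightarrow> u2 \<in> L2 M \<longrightarrow>
        R u1 (\<lambda>x. f x + z * u1 x) \<longrightarrow> R u2 (\<lambda>x. f x + z * u2 x) \<longrightarrow> (AE x in M. u1 x = u2 x)) \<and>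
     (\<exists>K. \<forall>f u. f \<in> L2 M \<longrightarrow> u \<in> L2 M \<longrightarrow> R u (\<lambda>x. f x + z * u x) \<longrightarrow> l2norm M u \<le> K * l2norm M f)"

definition op_spectrum :: "'a measure \<Rightarrow> (('a \<Rightarrow> complex) \<Rightarrow> ('a \<Rightarrow> complex) \<Rightarrow> bool) \<Rightarrow> complex set" where
  "op_spectrum M R = {z. \<not> in_resolvent M R z}"

definition spectral_bound :: "'a measure \<Rightarrow> (('a \<Rightarrow> complex) \<Rightarrow> ('a \<Rightarrow> complex) \<Rightarrow> bool) \<Rightarrow> ereal" where
  "spectral_bound M R = (SUP z \<in> op_spectrum M R. ereal (Re z))"

definition is_eigenfunction :: "'a measure \<Rightarrow> (('a \<Rightarrow> complex) \<Rightarrow> ('a \<Rightarrow> complex) \<Rightarrow> bool) \<Rightarrow> complex \<Rightarrow> ('a \<Rightarrow> complex) \<Rightarrow> bool" where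
  "is_eigenfunction M R z u \<longleftrightarrow> u \<in> L2 M \<and> l2norm M u \<noteq> 0 \<and> R u (\<lambda>x. z * u x)"

definition closed_orth_subgroup :: "(real^'n^'n) set \<Rightarrow> bool" where
  "closed_orth_subgroup G \<longleftrightarrow> closed G \<and> (\<forall>g\<in>G. orthogonal_matrix g) \<and> mat 1 \<in> G \<and>
     (\<forall>g\<in>G. \<forall>h\<in>G. g ** h \<in> G) \<and> (\<forall>g\<in>G. matrix_inv g \<in> G)"

definition T_act :: "real^'n^'n \<Rightarrow> (real^'n \<Rightarrow> complex) \<Rightarrow> (real^'n \<Rightarrow> complex)" where
  "T_act g u = (\<lambda>x. u (matrix_inv g *v x))"

definition G_invariant :: "(real^'n) set \<Rightarrow> (real^'n^'n) set \<Rightarrow> (real^'n \<Rightarrow> complex) \<Rightarrow> bool" where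
  "G_invariant \<Omega> G u \<longleftrightarrow> (\<forall>g\<in>G. AE x in lebesgue_on \<Omega>. T_act g u x = u x)"

definition coeff_ok :: "(real^'n) set \<Rightarrow> real \<Rightarrow> (real^'n^'n) set \<Rightarrow> (real^'n \<Rightarrow> real^'n^'n) \<Rightarrow> bool" where
  "coeff_ok \<Omega> \<alpha> G A \<longleftrightarrow>
     (\<forall>i j. (\<lambda>x. A x $ i $ j) \<in> borel_measurable (lebesgue_on \<Omega>)) \<and>
     (\<exists>M. \<forall>x\<in>\<Omega>. \<forall>i j. \<bar>A x $ i $ j\<bar> \<le> M) \<and>
     (\<forall>x\<in>\<Omega>. \<forall>\<xi> :: complex^'n.
        Re (\<Sum>i\<in>UNIV. \<Sum>j\<in>UNIV. cnj (\<xi> $ i) * complex_of_real (A x $ i $ j) * \<xi> $ j) \<ge> \<alpha> * (norm \<xi>)\<^sup>2) \<and>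
     (\<forall>x\<in>\<Omega>. transpose (A x) = A x) \<and>
     (\<forall>x\<in>\<Omega>. \<forall>g\<in>G. g ** A x = A x ** g) \<and>
     (\<forall>x\<in>\<Omega>. \<forall>g\<in>G. A (g *v x) = A x)"

definition bounded_L2_op :: "'a measure \<Rightarrow> (('a \<Rightarrow> complex) \<Rightarrow> ('a \<Rightarrow> complex)) \<Rightarrow> bool" where
  "bounded_L2_op M B \<longleftrightarrow>
     (\<forall>f \<in> L2 M. B f \<in> L2 M) \<and>
     (\<forall>f\<in>L2 M. \<forall>g\<in>L2 M. (AE x in M. f x = g x) \<longrightarrow> (AE x in M. B f x = B g x)) \<and>
     (\<forall>f\<in>L2 M. \<forall>g\<in>L2 M. \<forall>c. AE x in M. B (\<lambda>y. c * f y + g y) x = c * B f x + B g x) \<and>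
     (\<exists>K. \<forall>f\<in>L2 M. l2norm M (B f) \<le> K * l2norm M f)"

definition self_adjoint_L2 :: "'a measure \<Rightarrow> (('a \<Rightarrow> complex) \<Rightarrow> ('a \<Rightarrow> complex)) \<Rightarrow> bool" where
  "self_adjoint_L2 M B \<longleftrightarrow> (\<forall>f\<in>L2 M. \<forall>g\<in>L2 M. l2inner M (B f) g = l2inner M f (B g))"

definition G_equivariant :: "(real^'n) set \<Rightarrow> (real^'n^'n) set \<Rightarrow> ((real^'n \<Rightarrow> complex) \<Rightarrow> (real^'n \<Rightarrow> complex)) \<Rightarrow> bool" where
  "G_equivariant \<Omega> G B \<longleftrightarrow> (\<forall>g\<in>G. \<forall>f\<in>L2 (bdry_measure \<Omega>).
      AE x in bdry_measure \<Omega>. B (T_act g f) x = T_act g (B f) x)"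

definition restr_norm_le :: "'a measure \<Rightarrow> (('a \<Rightarrow> complex) \<Rightarrow> ('a \<Rightarrow> complex)) \<Rightarrow> real \<Rightarrow> bool" where
  "restr_norm_le M B b \<longleftrightarrow>
     (\<forall>f\<in>L2 M. (LINT x|M. f x) = 0 \<longrightarrow> l2norm M (B f) \<le> b * l2norm M f)"

definition thm_hyps where
  "thm_hyps \<Omega> \<alpha> G A B \<longleftrightarrow>
     closed_orth_subgroup G \<and> (\<forall>g\<in>G. (\<lambda>x. g *v x) ` \<Omega> \<subseteq> \<Omega>) \<and>
     coeff_ok \<Omega> \<alpha> G A \<and>
     bounded_L2_op (bdry_measure \<Omega>) B \<and> self_adjoint_L2 (bdry_measure \<Omega>) B \<and>
     G_equivariant \<Omega> G B \<and>
     Re (l2inner (bdry_measure \<Omega>) (B (\<lambda>_. 1)) (\<lambda>_. 1)) < 0"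

end

theory Submission
  imports Defs
begin

text \<open>
  Smooth functions satisfy, with small \<open>\<epsilon>\<close>, the trace inequality
  \<open>|\<phi>|\<^sup>2 \<le> \<epsilon> |D \<phi>|\<^sup>2 + K |\<phi>|\<^sup>2\<close> (boundary norm on the left) and a Poincare inequality
  \<open>|\<phi> - c|\<^sup>2 \<le> C |D \<phi>|\<^sup>2\<close> on the boundary. Both are obtained by moving a piece of the boundary
  along its chart direction into a slab inside the domain: the Hausdorff measure of the piece is
  at most a constant times the volume of the slab divided by its thickness, and compact subsets of
  a connected open set are joined by chains of balls.

  The trace inequality bounds the form of the operator from below, and since the form is negative
  on constants the least shift that makes it nonnegative is positive; it must belong to the
  spectrum. For an eigenfunction \<open>u\<close> the difference \<open>v = T\<^sub>g u - u\<close> has a trace of mean zero,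
  so if \<open>B\<close> is small on mean-zero functions then \<open>- s |v|\<^sup>2 = a[v, v] \<ge> 0\<close>, whence \<open>v = 0\<close>.
\<close>

section \<open>Increments of smooth functions along segments\<close>

text \<open>The obstacle lies in how the notions are encoded. \<open>trace_rel\<close> is a
  relation, and for \<open>u\<close> in \<open>H1\<close> without a trace the identity in
  \<open>LB_rel\<close> says nothing; yet one point of the resolvent set excludes such
  \<open>u\<close>, since \<open>u\<close> and \<open>2 u\<close> would both solve an equation with
  a unique solution. The work is therefore done on triples of function, gradient and trace that are
  limits of one sequence of smooth functions, and the inequalities pass from smooth functions to the
  limit. Likewise a value of \<open>bdry_measure\<close> is that of \<open>hausdorff_outer\<close>
  if this is countably additive on the Borel subsets of the boundary, and 0 otherwise; the geometric
  estimates bound it from above, which is correct in both cases.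

  The small constant in the trace inequality is the thickness \<open>d\<close> of the slab: the
  gradient term carries the factor \<open>d\<close>, the other term \<open>1 / d\<close>. The
  threshold for \<open>B\<close> is \<alpha> divided by one plus the boundary Poincare constant
  \<open>C\<close>: on traces of mean zero the boundary term is at most \<beta> times
  \<open>C\<close> times the gradient energy, which ellipticity absorbs.\<close>

definition grad_apply :: "complex^'n \<Rightarrow> real^'n \<Rightarrow> complex" where
  "grad_apply d h = (\<Sum>i\<in>UNIV. complex_of_real (h $ i) * d $ i)"

definition C1_with :: "(real^'n \<Rightarrow> complex) \<Rightarrow> (real^'n \<Rightarrow> complex^'n) \<Rightarrow> bool" where
  "C1_with \<phi> D \<longleftrightarrow> (\<forall>x. (\<phi> has_derivative grad_apply (D x)) (at x)) \<and> continuous_on UNIV D"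

text \<open>Valued in \<open>ennreal\<close>, so that the exchanges of integrals below carry no
  integrability condition. On a Lipschitz domain it is finite for smooth functions and equals
  \<open>grad_sq\<close>.\<close>

definition energy :: "(real^'n) set \<Rightarrow> (real^'n \<Rightarrow> complex^'n) \<Rightarrow> ennreal" where
  "energy \<Omega> D = (\<integral>\<^sup>+x\<in>\<Omega>. ennreal ((norm (D x))\<^sup>2) \<partial>lborel)"

lemma C1c_on_imp_C1_with: "C1c_on S \<phi> D \<Longrightarrow> C1_with \<phi> D"
  unfolding C1c_on_def C1_with_def grad_apply_def by auto

lemma norm_grad_apply_le: "norm (grad_apply d h) \<le> norm h * norm d"
proof -
  have "norm (grad_apply d h) \<le> (\<Sum>i\<in>UNIV. \<bar>h $ i\<bar> * \<bar>norm (d $ i)\<bar>)"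
    unfolding grad_apply_def by (rule order_trans[OF norm_sum]) (simp add: norm_mult)
  also have "\<dots> \<le> L2_set (\<lambda>i. h $ i) UNIV * L2_set (\<lambda>i. norm (d $ i)) UNIV"
    by (rule L2_set_mult_ineq)
  finally show ?thesis by (simp add: norm_vec_def L2_set_def)
qed

lemma grad_apply_axis: "grad_apply d (axis i 1) = d $ i"
proof -
  have "complex_of_real (axis i 1 $ j) * d $ j = (if j = i then d $ j else 0)" for j
    by (simp add: axis_def)
  then show ?thesis by (simp add: grad_apply_def)
qed

lemma continuous_on_grad_apply [continuous_intros]:
  fixes f :: "'a::topological_space \<Rightarrow> complex^'n"
  assumes "continuous_on S f" shows "continuous_on S (\<lambda>x. grad_apply (f x) h)"
  unfolding grad_apply_def using assms by (intro continuous_intros)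

lemma C1_with_continuous: "C1_with \<phi> D \<Longrightarrow> continuous_on UNIV \<phi>"
  by (meson C1_with_def continuous_at_imp_continuous_on has_derivative_continuous)

lemma C1_with_has_vector_derivative:
  assumes "C1_with \<phi> D"
  shows "((\<lambda>s. \<phi> (y + s *\<^sub>R e)) has_vector_derivative grad_apply (D (y + s *\<^sub>R e)) e) (at s within T)"
proof -
  have 1: "((\<lambda>s. y + s *\<^sub>R e) has_derivative (\<lambda>h. h *\<^sub>R e)) (at s within T)"
    by (auto intro!: derivative_eq_intros)
  have "((\<lambda>s. \<phi> (y + s *\<^sub>R e)) has_derivative (\<lambda>h. grad_apply (D (y + s *\<^sub>R e)) (h *\<^sub>R e))) (at s within T)"
    using assms unfolding C1_with_def by (intro has_derivative_compose[OF 1]) auto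
  moreover have "grad_apply d (h *\<^sub>R e) = h *\<^sub>R grad_apply d e" for d :: "complex^'a" and h
    by (simp add: grad_apply_def scaleR_sum_right) (simp add: scaleR_conv_of_real mult.assoc)
  ultimately show ?thesis
    by (simp add: has_vector_derivative_def)
qed

lemma C1_with_FTC:
  assumes "C1_with \<phi> D" "0 \<le> t"
  shows "((\<lambda>s. grad_apply (D (y + s *\<^sub>R e)) e) has_integral (\<phi> (y + t *\<^sub>R e) - \<phi> y)) {0..t}"
  using fundamental_theorem_of_calculus[OF assms(2), of "\<lambda>s. \<phi> (y + s *\<^sub>R e)"]
    C1_with_has_vector_derivative[OF assms(1), of y e] by simp

text \<open>Cauchy-Schwarz against the constant 1. With \<open>I\<close> and \<open>F\<close> the
  integrals of \<open>f\<close> and of its square, integrating the square of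
  \<open>t * f s - I\<close> gives \<open>t * (t * F - I\<^sup>2)\<close>, which is thus
  nonnegative.\<close>

lemma integral_square_le:
  fixes f :: "real \<Rightarrow> real"
  assumes "continuous_on {0..t} f" "0 \<le> t"
  shows "(integral {0..t} f)\<^sup>2 \<le> t * integral {0..t} (\<lambda>s. (f s)\<^sup>2)"
proof (cases "t = 0")
  case False
  then have t: "t > 0" using assms by simp
  define I where "I = integral {0..t} f"
  define F where "F = integral {0..t} (\<lambda>s. (f s)\<^sup>2)"
  have f: "(f has_integral I) {0..t}" and F: "((\<lambda>s. (f s)\<^sup>2) has_integral F) {0..t}"
    unfolding I_def F_def
    by (intro integrable_integral integrable_continuous_real assms continuous_intros)+
  have "((\<lambda>s. t\<^sup>2 * (f s)\<^sup>2 - 2 * t * I * f s + I\<^sup>2) has_integral (t\<^sup>2 * F - 2 * t * I * I + t * I\<^sup>2)) {0..t}"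
    using has_integral_add[OF has_integral_diff[OF has_integral_mult_right[OF F, of "t\<^sup>2"]
      has_integral_mult_right[OF f, of "2 * t * I"]] has_integral_const_real[of "I\<^sup>2" 0 t]] t by simp
  then have "0 \<le> t\<^sup>2 * F - 2 * t * I * I + t * I\<^sup>2"
  proof (rule has_integral_nonneg)
    fix s show "0 \<le> t\<^sup>2 * (f s)\<^sup>2 - 2 * t * I * f s + I\<^sup>2"
      using zero_le_power2[of "t * f s - I"] by (simp add: power2_eq_square algebra_simps)
  qed
  then have "0 \<le> t * (t * F - I\<^sup>2)" by (simp add: power2_eq_square algebra_simps)
  then show ?thesis using t by (simp add: I_def F_def zero_le_mult_iff)
qed simp

text \<open>The fundamental theorem along the segment, followed by Cauchy-Schwarz in the parameter
  \<open>s\<close>. The direction \<open>e\<close> is not normalised, because it is also used as the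
  difference of two points of a ball.\<close>

lemma C1_with_increment_le:
  assumes "C1_with \<phi> D" "0 \<le> t"
  shows "ennreal ((cmod (\<phi> (y + t *\<^sub>R e) - \<phi> y))\<^sup>2)
    \<le> ennreal (t * (norm e)\<^sup>2) * (\<integral>\<^sup>+s\<in>{0..t}. ennreal ((norm (D (y + s *\<^sub>R e)))\<^sup>2) \<partial>lborel)"
proof -
  let ?f = "\<lambda>s. norm (D (y + s *\<^sub>R e))"
  have D: "continuous_on UNIV D" using assms by (simp add: C1_with_def)
  have cf: "continuous_on {0..t} (\<lambda>s. D (y + s *\<^sub>R e))"
    by (rule continuous_on_compose2[OF D]) (auto intro!: continuous_intros)
  have "cmod (\<phi> (y + t *\<^sub>R e) - \<phi> y) = cmod (integral {0..t} (\<lambda>s. grad_apply (D (y + s *\<^sub>R e)) e))"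
    using C1_with_FTC[OF assms, of y e] by (simp add: integral_unique)
  also have "\<dots> \<le> integral {0..t} (\<lambda>s. norm e * ?f s)"
    by (rule integral_norm_bound_integral)
       (auto intro!: integrable_continuous_real continuous_intros cf norm_grad_apply_le)
  also have "\<dots> = norm e * integral {0..t} ?f" by simp
  finally have "(cmod (\<phi> (y + t *\<^sub>R e) - \<phi> y))\<^sup>2 \<le> (norm e * integral {0..t} ?f)\<^sup>2"
    by (intro power_mono) auto
  also have "\<dots> \<le> (norm e)\<^sup>2 * (t * integral {0..t} (\<lambda>s. (?f s)\<^sup>2))"
    unfolding power_mult_distrib
    by (intro mult_left_mono integral_square_le continuous_intros cf assms) auto
  finally have le: "(cmod (\<phi> (y + t *\<^sub>R e) - \<phi> y))\<^sup>2 \<le> (t * (norm e)\<^sup>2) * integral {0..t} (\<lambda>s. (?f s)\<^sup>2)"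
    by (simp add: mult_ac)
  have "(\<integral>\<^sup>+s\<in>{0..t}. ennreal ((?f s)\<^sup>2) \<partial>lborel) = ennreal (integral {0..t} (\<lambda>s. (?f s)\<^sup>2))"
    by (intro nn_integral_has_integral_lebesgue' integrable_integral integrable_continuous_real
        continuous_intros cf) auto
  then show ?thesis using le assms
    by (simp add: ennreal_mult'[symmetric] ennreal_leI)
qed

lemma nn_integral_lborel_translate:
  fixes f :: "'a::euclidean_space \<Rightarrow> ennreal"
  assumes [measurable]: "f \<in> borel_measurable borel"
  shows "(\<integral>\<^sup>+x. f (x + a) \<partial>lborel) = (\<integral>\<^sup>+x. f x \<partial>lborel)"
proof -
  have "(\<integral>\<^sup>+x. f x \<partial>lborel) = (\<integral>\<^sup>+x. f x \<partial>(distr lborel borel ((+) a)))"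
    by (simp add: lborel_distr_plus)
  also have "\<dots> = (\<integral>\<^sup>+x. f (x + a) \<partial>lborel)"
    by (subst nn_integral_distr) (auto simp: add.commute)
  finally show ?thesis by simp
qed

lemma borel_measurable_norm_D:
  assumes "C1_with \<phi> D" shows "(\<lambda>x. ennreal ((norm (D x))\<^sup>2)) \<in> borel_measurable borel"
proof -
  have [measurable]: "D \<in> borel_measurable borel"
    using assms by (auto simp: C1_with_def intro: borel_measurable_continuous_onI)
  show ?thesis by measurable
qed

text \<open>For each fixed \<open>s\<close> the map \<open>y + s *\<^sub>R e\<close> is a
  translation, so after exchanging the integrals the inner one is the energy. One factor
  \<open>d\<close> comes from Cauchy-Schwarz on the segment, the other from integrating over
  \<open>s\<close>. The travelled length may vary with the point, and the endpoint may lie outside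
  \<Omega>: this is what allows interior points to be pushed onto the boundary.\<close>

lemma translation_estimate:
  assumes C1: "C1_with \<phi> D" and [measurable]: "\<Omega> \<in> sets borel" "E \<in> sets borel"
    and t: "\<And>y. y \<in> E \<Longrightarrow> 0 \<le> t y \<and> t y \<le> d"
    and seg: "\<And>y s. y \<in> E \<Longrightarrow> 0 \<le> s \<Longrightarrow> s < t y \<Longrightarrow> y + s *\<^sub>R e \<in> \<Omega>"
    and d: "0 \<le> d"
  shows "(\<integral>\<^sup>+y\<in>E. ennreal ((cmod (\<phi> (y + t y *\<^sub>R e) - \<phi> y))\<^sup>2) \<partial>lborel)
    \<le> ennreal (d\<^sup>2 * (norm e)\<^sup>2) * energy \<Omega> D"
proof -
  define F where "F = (\<lambda>x. ennreal ((norm (D x))\<^sup>2) * indicator \<Omega> x)"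
  have [measurable]: "(\<lambda>x. ennreal ((norm (D x))\<^sup>2)) \<in> borel_measurable borel"
    by (rule borel_measurable_norm_D[OF C1])
  have [measurable]: "F \<in> borel_measurable borel" unfolding F_def by measurable
  have "(\<integral>\<^sup>+y\<in>E. ennreal ((cmod (\<phi> (y + t y *\<^sub>R e) - \<phi> y))\<^sup>2) \<partial>lborel)
     \<le> (\<integral>\<^sup>+y. (\<integral>\<^sup>+s. ennreal (d * (norm e)\<^sup>2) * (F (y + s *\<^sub>R e) * indicator {0..d} s) \<partial>lborel) \<partial>lborel)"
  proof (rule nn_integral_mono)
    fix y
    show "ennreal ((cmod (\<phi> (y + t y *\<^sub>R e) - \<phi> y))\<^sup>2) * indicator E y
       \<le> (\<integral>\<^sup>+s. ennreal (d * (norm e)\<^sup>2) * (F (y + s *\<^sub>R e) * indicator {0..d} s) \<partial>lborel)"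
    proof (cases "y \<in> E")
      case True
      note ty = t[OF True]
      have "ennreal ((cmod (\<phi> (y + t y *\<^sub>R e) - \<phi> y))\<^sup>2)
        \<le> ennreal (t y * (norm e)\<^sup>2) * (\<integral>\<^sup>+s\<in>{0..t y}. ennreal ((norm (D (y + s *\<^sub>R e)))\<^sup>2) \<partial>lborel)"
        using C1_with_increment_le[OF C1] ty by blast
      also have "\<dots> \<le> ennreal (d * (norm e)\<^sup>2) * (\<integral>\<^sup>+s. F (y + s *\<^sub>R e) * indicator {0..d} s \<partial>lborel)"
      proof (rule mult_mono)
        show "(\<integral>\<^sup>+s\<in>{0..t y}. ennreal ((norm (D (y + s *\<^sub>R e)))\<^sup>2) \<partial>lborel)
          \<le> (\<integral>\<^sup>+s. F (y + s *\<^sub>R e) * indicator {0..d} s \<partial>lborel)"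
        proof (rule nn_integral_mono_AE)
          \<comment> \<open>\<open>seg\<close> says nothing about the endpoint
            \<open>s = t y\<close>; this single value is a null set.\<close>
          show "AE s in lborel. ennreal ((norm (D (y + s *\<^sub>R e)))\<^sup>2) * indicator {0..t y} s
            \<le> F (y + s *\<^sub>R e) * indicator {0..d} s"
            using AE_lborel_singleton[of "t y"]
            by eventually_elim (use seg[OF True] ty in \<open>auto simp: F_def split: split_indicator\<close>)
        qed
      qed (use ty d in \<open>auto intro!: ennreal_leI mult_right_mono\<close>)
      finally show ?thesis using True by (simp add: nn_integral_cmult)
    qed simp
  qed
  also have "\<dots> = (\<integral>\<^sup>+s. (\<integral>\<^sup>+y. ennreal (d * (norm e)\<^sup>2) * (F (y + s *\<^sub>R e) * indicator {0..d} s) \<partial>lborel) \<partial>lborel)"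
    by (rule lborel_pair.Fubini'[symmetric]) measurable
  also have "\<dots> = (\<integral>\<^sup>+s. ennreal (d * (norm e)\<^sup>2) * (energy \<Omega> D * indicator {0..d} s) \<partial>lborel)"
    by (intro nn_integral_cong)
       (simp add: nn_integral_cmult nn_integral_multc nn_integral_lborel_translate, simp add: energy_def F_def)
  also have "\<dots> = ennreal (d * (norm e)\<^sup>2) * (energy \<Omega> D * ennreal d)"
    using d by (simp add: nn_integral_cmult)
  also have "\<dots> = ennreal (d\<^sup>2 * (norm e)\<^sup>2) * energy \<Omega> D"
  proof -
    have "ennreal (d * (norm e)\<^sup>2) * ennreal d = ennreal (d\<^sup>2 * (norm e)\<^sup>2)"
      using d by (simp add: ennreal_mult'[symmetric] power2_eq_square mult_ac)
    then show ?thesis by (metis mult.assoc mult.commute)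
  qed
  finally show ?thesis .
qed

section \<open>Oscillation on compact subsets of a domain\<close>

lemma cmod_diff_square_le:
  "ennreal ((cmod (a - c))\<^sup>2) \<le> 2 * ennreal ((cmod (a - b))\<^sup>2) + 2 * ennreal ((cmod (b - c))\<^sup>2)"
proof -
  have "cmod (a - c) \<le> cmod (a - b) + cmod (b - c)"
    by (metis add_diff_cancel_left' add_diff_eq diff_add_cancel norm_triangle_ineq)
  then have "(cmod (a - c))\<^sup>2 \<le> (cmod (a - b) + cmod (b - c))\<^sup>2" by (intro power_mono) auto
  also have "\<dots> \<le> 2 * (cmod (a - b))\<^sup>2 + 2 * (cmod (b - c))\<^sup>2"
    using zero_le_power2[of "cmod (a - b) - cmod (b - c)"] by (simp add: power2_eq_square algebra_simps)
  finally have "ennreal ((cmod (a - c))\<^sup>2) \<le> ennreal (2 * (cmod (a - b))\<^sup>2 + 2 * (cmod (b - c))\<^sup>2)"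
    by (rule ennreal_leI)
  then show ?thesis by (simp add: ennreal_mult' ennreal_plus)
qed

lemma C1_with_borel_measurable: "C1_with \<phi> D \<Longrightarrow> \<phi> \<in> borel_measurable borel"
  by (intro borel_measurable_continuous_onI C1_with_continuous)

lemma emeasure_lborel_ball_eq: "emeasure lborel (ball a R) = ennreal (measure lborel (ball (a::'a::euclidean_space) R))"
  by (metis emeasure_eq_ennreal_measure emeasure_lborel_ball_finite infinity_ennreal_def less_irrefl)

text \<open>Substitute \<open>y = z + x\<close>. For fixed \<open>z\<close> the increment is a
  translation of length parameter 1 in direction \<open>z\<close>, whose segment stays in the ball
  by convexity; this costs at most \<open>(2 * R)\<^sup>2\<close> times the energy. Only
  \<open>z\<close> of norm below \<open>2 * R\<close> occur, hence the volume of the doubled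
  ball.\<close>

lemma ball_double_integral_le:
  assumes C1: "C1_with \<phi> D" and sub: "ball a R \<subseteq> \<Omega>" and [measurable]: "\<Omega> \<in> sets borel" and R: "R > 0"
  shows "(\<integral>\<^sup>+x\<in>ball a R. (\<integral>\<^sup>+y\<in>ball a R. ennreal ((cmod (\<phi> x - \<phi> y))\<^sup>2) \<partial>lborel) \<partial>lborel)
    \<le> ennreal ((2 * R)\<^sup>2 * measure lborel (ball (0::real^'n) (2 * R))) * energy \<Omega> (D :: real^'n \<Rightarrow> complex^'n)"
proof -
  have [measurable]: "\<phi> \<in> borel_measurable borel" by (rule C1_with_borel_measurable[OF C1])
  let ?B = "ball a R" and ?m = "measure lborel (ball (0::real^'n) (2 * R))"
  have [measurable]: "?B \<in> sets borel" by simp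
  define F where "F = (\<lambda>x y. ennreal ((cmod (\<phi> y - \<phi> x))\<^sup>2) * indicator ?B y * indicator ?B x)"
  have [measurable]: "(\<lambda>(x,y). F x y) \<in> borel_measurable (borel \<Otimes>\<^sub>M borel)"
    unfolding F_def by measurable
  have Fm [measurable]: "(\<lambda>y. F x y) \<in> borel_measurable borel" for x
    unfolding F_def by measurable
  have "(\<integral>\<^sup>+x\<in>?B. (\<integral>\<^sup>+y\<in>?B. ennreal ((cmod (\<phi> x - \<phi> y))\<^sup>2) \<partial>lborel) \<partial>lborel)
     = (\<integral>\<^sup>+x. (\<integral>\<^sup>+y. F x y \<partial>lborel) \<partial>lborel)"
    unfolding F_def by (intro nn_integral_cong) (simp add: nn_integral_multc norm_minus_commute)
  also have "\<dots> = (\<integral>\<^sup>+x. (\<integral>\<^sup>+z. F x (z + x) \<partial>lborel) \<partial>lborel)"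
    by (simp add: nn_integral_lborel_translate)
  also have "\<dots> = (\<integral>\<^sup>+z. (\<integral>\<^sup>+x. F x (z + x) \<partial>lborel) \<partial>lborel)"
    by (rule lborel_pair.Fubini'[symmetric]) measurable
  also have "\<dots> \<le> (\<integral>\<^sup>+z. ennreal ((2 * R)\<^sup>2) * energy \<Omega> D * indicator (ball (0::real^'n) (2 * R)) z \<partial>lborel)"
  proof (rule nn_integral_mono)
    fix z :: "real^'n"
    let ?E = "{x \<in> ?B. x + z \<in> ?B}"
    have "?E = ?B \<inter> (\<lambda>x. x + z) -` ?B" by auto
    moreover have "open (?B \<inter> (\<lambda>x. x + z) -` ?B)"
      by (intro open_Int open_vimage continuous_intros open_ball)
    ultimately have [measurable]: "?E \<in> sets borel" by simp
    have *: "(\<integral>\<^sup>+x. F x (z + x) \<partial>lborel) = (\<integral>\<^sup>+x\<in>?E. ennreal ((cmod (\<phi> (x + 1 *\<^sub>R z) - \<phi> x))\<^sup>2) \<partial>lborel)"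
      unfolding F_def by (intro nn_integral_cong) (auto simp: add.commute split: split_indicator)
    show "(\<integral>\<^sup>+x. F x (z + x) \<partial>lborel) \<le> ennreal ((2 * R)\<^sup>2) * energy \<Omega> D * indicator (ball 0 (2 * R)) z"
    proof (cases "z \<in> ball 0 (2 * R)")
      case True
      have "(\<integral>\<^sup>+x\<in>?E. ennreal ((cmod (\<phi> (x + 1 *\<^sub>R z) - \<phi> x))\<^sup>2) \<partial>lborel) \<le> ennreal (1\<^sup>2 * (norm z)\<^sup>2) * energy \<Omega> D"
      proof (rule translation_estimate[OF C1])
        fix y s assume y: "y \<in> ?E" and s: "0 \<le> s" "s < (1::real)"
        have "y + s *\<^sub>R z = (1 - s) *\<^sub>R y + s *\<^sub>R (y + z)" by (simp add: algebra_simps)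
        also have "\<dots> \<in> ?B" using y s by (intro convexD[OF convex_ball]) auto
        finally show "y + s *\<^sub>R z \<in> \<Omega>" using sub by blast
      qed auto
      also have "\<dots> \<le> ennreal ((2 * R)\<^sup>2) * energy \<Omega> D"
        using True by (intro mult_right_mono ennreal_leI) (use power_mono[of "norm z" "2 * R" 2] in auto)
      finally show ?thesis using * True by simp
    next
      case False
      have "?E = {}"
      proof -
        { fix x assume "x \<in> ?E"
          then have "dist a x < R" "dist a (x + z) < R" by auto
          moreover have "norm z = dist x (x + z)" by (simp add: dist_norm)
          moreover have "dist x (x + z) \<le> dist a x + dist a (x + z)" by (rule dist_triangle3)
          ultimately have "norm z < 2 * R" by linarith
          then have False using False by simp }
        then show ?thesis by blast
      qed
      then show ?thesis unfolding * by simp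
    qed
  qed
  also have "\<dots> = ennreal ((2 * R)\<^sup>2) * energy \<Omega> D * ennreal ?m"
    by (subst nn_integral_cmult_indicator) (simp_all add: emeasure_lborel_ball_eq)
  also have "\<dots> = ennreal ((2 * R)\<^sup>2 * ?m) * energy \<Omega> D"
    by (simp add: ennreal_mult mult_ac)
  finally show ?thesis .
qed

text \<open>The reference value \<open>c \<phi> D\<close> depends on the function but not on the set
  \<open>A\<close>, whereas the constant \<open>C\<close> may depend on \<open>A\<close>. This is
  what lets bounds on overlapping or finitely many sets be combined. \<open>c\<close> takes
  \<open>D\<close> as an argument because it is later picked by a choice from an inequality that
  mentions the energy of \<open>D\<close>.\<close>

definition osc_bound :: "(real^'n) set \<Rightarrow> ((real^'n \<Rightarrow> complex) \<Rightarrow> (real^'n \<Rightarrow> complex^'n) \<Rightarrow> complex) \<Rightarrow> (real^'n) measure \<Rightarrow> (real^'n) set \<Rightarrow> bool" where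
  "osc_bound \<Omega> c \<mu> A \<longleftrightarrow> (\<exists>C\<ge>0. \<forall>\<phi> D. C1_with \<phi> D \<longrightarrow>
     (\<integral>\<^sup>+x\<in>A. ennreal ((cmod (\<phi> x - c \<phi> D))\<^sup>2) \<partial>\<mu>) \<le> ennreal C * energy \<Omega> D)"

lemma osc_bound_mono: "osc_bound \<Omega> c \<mu> A \<Longrightarrow> A' \<subseteq> A \<Longrightarrow> osc_bound \<Omega> c \<mu> A'"
proof -
  assume "osc_bound \<Omega> c \<mu> A" and sub: "A' \<subseteq> A"
  then obtain C where C: "C \<ge> 0" "\<And>\<phi> D. C1_with \<phi> D \<Longrightarrow>
      (\<integral>\<^sup>+x\<in>A. ennreal ((cmod (\<phi> x - c \<phi> D))\<^sup>2) \<partial>\<mu>) \<le> ennreal C * energy \<Omega> D"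
    unfolding osc_bound_def by auto
  then show "osc_bound \<Omega> c \<mu> A'"
    unfolding osc_bound_def using order_trans[OF nn_set_integral_set_mono[OF sub] C(2)] by blast
qed

lemma osc_bound_finite_Union:
  assumes "finite F" "\<And>A. A \<in> F \<Longrightarrow> A \<in> sets lborel \<and> osc_bound \<Omega> c lborel A"
  shows "osc_bound \<Omega> c lborel (\<Union>F)"
  using assms
proof (induction F)
  case empty
  show ?case unfolding osc_bound_def by (intro exI[of _ 0]) auto
next
  case (insert A F)
  obtain C1 where C1: "C1 \<ge> 0" "\<And>\<phi> D. C1_with \<phi> D \<Longrightarrow>
      (\<integral>\<^sup>+x\<in>A. ennreal ((cmod (\<phi> x - c \<phi> D))\<^sup>2) \<partial>lborel) \<le> ennreal C1 * energy \<Omega> D"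
    using insert.prems[of A] unfolding osc_bound_def by auto
  have "osc_bound \<Omega> c lborel (\<Union>F)" using insert by simp
  then obtain C2 where C2: "C2 \<ge> 0" "\<And>\<phi> D. C1_with \<phi> D \<Longrightarrow>
      (\<integral>\<^sup>+x\<in>\<Union>F. ennreal ((cmod (\<phi> x - c \<phi> D))\<^sup>2) \<partial>lborel) \<le> ennreal C2 * energy \<Omega> D"
    unfolding osc_bound_def by auto
  have [measurable]: "A \<in> sets borel" using insert.prems[of A] by simp
  have [measurable]: "\<Union>F \<in> sets borel" using insert by (intro sets.finite_Union) auto
  show ?case unfolding osc_bound_def
  proof (intro exI[of _ "C1 + C2"] conjI allI impI)
    fix \<phi> and D :: "real^'a \<Rightarrow> complex^'a" assume phi: "C1_with \<phi> D"
    have [measurable]: "\<phi> \<in> borel_measurable borel" by (rule C1_with_borel_measurable[OF phi])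
    have "(\<integral>\<^sup>+x\<in>\<Union>(insert A F). ennreal ((cmod (\<phi> x - c \<phi> D))\<^sup>2) \<partial>lborel)
      \<le> (\<integral>\<^sup>+x. ennreal ((cmod (\<phi> x - c \<phi> D))\<^sup>2) * indicator A x
           + ennreal ((cmod (\<phi> x - c \<phi> D))\<^sup>2) * indicator (\<Union>F) x \<partial>lborel)"
      by (intro nn_integral_mono) (auto split: split_indicator)
    also have "\<dots> = (\<integral>\<^sup>+x\<in>A. ennreal ((cmod (\<phi> x - c \<phi> D))\<^sup>2) \<partial>lborel)
        + (\<integral>\<^sup>+x\<in>\<Union>F. ennreal ((cmod (\<phi> x - c \<phi> D))\<^sup>2) \<partial>lborel)"
      by (intro nn_integral_add) measurable
    also have "\<dots> \<le> ennreal C1 * energy \<Omega> D + ennreal C2 * energy \<Omega> D"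
      by (intro add_mono C1 C2 phi)
    finally show "(\<integral>\<^sup>+x\<in>\<Union>(insert A F). ennreal ((cmod (\<phi> x - c \<phi> D))\<^sup>2) \<partial>lborel) \<le> ennreal (C1 + C2) * energy \<Omega> D"
      using C1 C2 by (simp add: distrib_right)
  qed (use C1 C2 in auto)
qed

lemma osc_bound_start:
  fixes \<Omega> :: "(real^'n) set"
  assumes sub: "ball a R \<subseteq> \<Omega>" and [measurable]: "\<Omega> \<in> sets borel" and R: "R > 0"
  obtains c where "osc_bound \<Omega> c lborel (ball a R)"
proof -
  let ?B = "ball a R"
  define C where "C = (2 * R)\<^sup>2 * measure lborel (ball (0::real^'n) (2 * R))"
  define m where "m = measure lborel ?B"
  have C: "C \<ge> 0" unfolding C_def by simp
  have em: "emeasure lborel ?B = ennreal m" unfolding m_def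
    by (rule emeasure_lborel_ball_eq)
  have m: "m > 0" unfolding m_def using R by (simp add: content_ball)
  define f where "f = (\<lambda>\<phi> y. \<integral>\<^sup>+x\<in>?B. ennreal ((cmod (\<phi> x - \<phi> y))\<^sup>2) \<partial>lborel)"
  \<comment> \<open>Some value of \<open>\<phi>\<close> on the ball is at most as far from \<open>\<phi>\<close> as the values are on average.\<close>
  have ex: "\<exists>y. f \<phi> y \<le> ennreal (C / m) * energy \<Omega> D" if phi: "C1_with \<phi> D" for \<phi> D
  proof (rule ccontr)
    assume "\<not> ?thesis"
    then have gt: "ennreal (C / m) * energy \<Omega> D < f \<phi> y" for y by (simp add: not_le)
    have [measurable]: "\<phi> \<in> borel_measurable borel" by (rule C1_with_borel_measurable[OF phi])
    have [measurable]: "?B \<in> sets borel" by simp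
    have [measurable]: "f \<phi> \<in> borel_measurable borel" unfolding f_def by measurable
    let ?K = "ennreal (C / m) * energy \<Omega> D"
    \<comment> \<open>The negated claim is a strict inequality, so it already rules out infinite
      energy.\<close>
    have fin: "?K < \<infinity>" using gt[of a] top_greatest[of "f \<phi> a"] by (auto intro: order.strict_trans2)
    have Km: "?K * ennreal m = ennreal C * energy \<Omega> D"
    proof -
      have "ennreal (C / m) * ennreal m = ennreal C" using m C by (simp add: ennreal_mult'[symmetric])
      then show ?thesis by (metis mult.assoc mult.commute)
    qed
    have "(\<integral>\<^sup>+y. ?K * indicator ?B y \<partial>lborel) < (\<integral>\<^sup>+y. f \<phi> y * indicator ?B y \<partial>lborel)"
    proof (rule nn_integral_less)
      have "(\<integral>\<^sup>+y. ?K * indicator ?B y \<partial>lborel) = ?K * ennreal m"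
        by (simp add: nn_integral_cmult em)
      then show "(\<integral>\<^sup>+y. ?K * indicator ?B y \<partial>lborel) \<noteq> \<infinity>"
        using fin ennreal_mult_eq_top_iff[of ?K "ennreal m"] by auto
      show "AE y in lborel. ?K * indicator ?B y \<le> f \<phi> y * indicator ?B y"
        by (intro AE_I2 mult_right_mono less_imp_le[OF gt]) simp
      show "\<not> (AE y in lborel. f \<phi> y * indicator ?B y \<le> ?K * indicator ?B y)"
      proof
        assume "AE y in lborel. f \<phi> y * indicator ?B y \<le> ?K * indicator ?B y"
        then have "AE y in lborel. y \<notin> ?B"
          by eventually_elim (metis gt indicator_simps(1) mult.right_neutral not_le)
        then have "emeasure lborel ?B = 0"
          by (subst (asm) AE_iff_measurable[of ?B]) auto
        then show False using em m by simp
      qed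
    qed measurable
    also have "(\<integral>\<^sup>+y. f \<phi> y * indicator ?B y \<partial>lborel) \<le> ennreal C * energy \<Omega> D"
      using ball_double_integral_le[OF phi sub _ R] unfolding f_def C_def
      by (simp add: norm_minus_commute)
    finally show False using Km by (simp add: nn_integral_cmult em)
  qed
  define c where "c = (\<lambda>\<phi> D. \<phi> (SOME y. f \<phi> y \<le> ennreal (C / m) * energy \<Omega> D))"
  have "f \<phi> (SOME y. f \<phi> y \<le> ennreal (C / m) * energy \<Omega> D) \<le> ennreal (C / m) * energy \<Omega> D"
    if "C1_with \<phi> D" for \<phi> D using someI_ex[OF ex[OF that]] .
  then have "osc_bound \<Omega> c lborel ?B"
    unfolding osc_bound_def c_def f_def using C m by (intro exI[of _ "C / m"]) auto
  then show ?thesis using that by blast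
qed

text \<open>For \<open>x\<close> in the ball and \<open>y\<close> in the overlap \<open>V\<close>,
  the square of \<open>\<phi> x - c\<close> is at most twice that of
  \<open>\<phi> x - \<phi> y\<close> plus twice that of \<open>\<phi> y - c\<close>. Integrate over
  both variables: the first part is the double integral over the ball, the second the known bound
  times the volume \<open>b\<close>. Dividing by the volume \<open>m\<close> of the overlap gives
  the constant.\<close>

lemma osc_bound_extend:
  fixes \<Omega> :: "(real^'n) set"
  assumes sub: "ball a R \<subseteq> \<Omega>" and [measurable]: "\<Omega> \<in> sets borel" and R: "R > 0"
    and A: "osc_bound \<Omega> c lborel A" and Ao: "open A" "A \<inter> ball a R \<noteq> {}"
  shows "osc_bound \<Omega> c lborel (ball a R)"
proof -
  let ?B = "ball a R" and ?V = "A \<inter> ball a R"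
  have [measurable]: "?B \<in> sets borel" "?V \<in> sets borel" using Ao by auto
  define C where "C = (2 * R)\<^sup>2 * measure lborel (ball (0::real^'n) (2 * R))"
  define b where "b = measure lborel ?B"
  define m where "m = measure lborel ?V"
  have C: "C \<ge> 0" unfolding C_def by simp
  have eb: "emeasure lborel ?B = ennreal b" unfolding b_def
    by (rule emeasure_lborel_ball_eq)
  have fV: "emeasure lborel ?V < \<infinity>"
    by (rule order.strict_trans1[OF emeasure_mono[of ?V ?B]]) (use emeasure_lborel_ball_finite[of a R] in auto)
  then have em: "emeasure lborel ?V = ennreal m" unfolding m_def
    by (simp add: emeasure_eq_ennreal_measure less_top)
  \<comment> \<open>The overlap is open and nonempty, hence not negligible; this makes the division
    by \<open>m\<close> legitimate.\<close>
  have "emeasure lborel ?V \<noteq> 0"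
    using open_not_negligible[of ?V] Ao by (auto simp: negligible_iff_emeasure0)
  then have m: "m > 0" using em by (metis ennreal_eq_0_iff not_le)
  obtain K where K: "K \<ge> 0" "\<And>\<phi> D. C1_with \<phi> D \<Longrightarrow>
      (\<integral>\<^sup>+x\<in>A. ennreal ((cmod (\<phi> x - c \<phi> D))\<^sup>2) \<partial>lborel) \<le> ennreal K * energy \<Omega> D"
    using A unfolding osc_bound_def by auto
  show ?thesis unfolding osc_bound_def
  proof (intro exI[of _ "2 * (C + b * K) / m"] conjI allI impI)
    fix \<phi> and D :: "real^'n \<Rightarrow> complex^'n" assume phi: "C1_with \<phi> D"
    have [measurable]: "\<phi> \<in> borel_measurable borel" by (rule C1_with_borel_measurable[OF phi])
    let ?g = "\<lambda>x. ennreal ((cmod (\<phi> x - c \<phi> D))\<^sup>2)"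
    let ?d = "\<lambda>x y. ennreal ((cmod (\<phi> x - \<phi> y))\<^sup>2)"
    have "(\<integral>\<^sup>+x\<in>?B. ?g x \<partial>lborel) * ennreal m = (\<integral>\<^sup>+x. (\<integral>\<^sup>+y. ?g x * indicator ?B x * indicator ?V y \<partial>lborel) \<partial>lborel)"
      using em by (simp add: nn_integral_cmult nn_integral_multc)
    also have "\<dots> \<le> (\<integral>\<^sup>+x. (\<integral>\<^sup>+y. 2 * (?d x y * indicator ?B y * indicator ?B x)
         + 2 * (?g y * indicator A y * indicator ?B x) \<partial>lborel) \<partial>lborel)"
    proof (intro nn_integral_mono)
      fix x y
      show "?g x * indicator ?B x * indicator ?V y
        \<le> 2 * (?d x y * indicator ?B y * indicator ?B x) + 2 * (?g y * indicator A y * indicator ?B x)"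
        using cmod_diff_square_le[of "\<phi> x" "c \<phi> D" "\<phi> y"]
        by (cases "x \<in> ?B"; cases "y \<in> ?V") simp_all
    qed
    also have "\<dots> = 2 * (\<integral>\<^sup>+x\<in>?B. (\<integral>\<^sup>+y\<in>?B. ?d x y \<partial>lborel) \<partial>lborel)
         + 2 * ((\<integral>\<^sup>+y\<in>A. ?g y \<partial>lborel) * ennreal b)"
      using Ao eb by (simp add: nn_integral_add nn_integral_cmult nn_integral_multc)
    also have "\<dots> \<le> 2 * (ennreal C * energy \<Omega> D) + 2 * ((ennreal K * energy \<Omega> D) * ennreal b)"
      using ball_double_integral_le[OF phi sub _ R] K(2)[OF phi] unfolding C_def
      by (intro add_mono mult_mono) auto
    also have "\<dots> = ennreal (2 * (C + b * K)) * energy \<Omega> D"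
      using C K by (simp add: b_def ennreal_mult distrib_left distrib_right mult_ac)
    finally have le: "(\<integral>\<^sup>+x\<in>?B. ?g x \<partial>lborel) * ennreal m \<le> ennreal (2 * (C + b * K)) * energy \<Omega> D" .
    have "(\<integral>\<^sup>+x\<in>?B. ?g x \<partial>lborel) = (\<integral>\<^sup>+x\<in>?B. ?g x \<partial>lborel) * ennreal m * ennreal (1 / m)"
      using m by (simp add: mult.assoc ennreal_mult'[symmetric])
    also have "\<dots> \<le> ennreal (2 * (C + b * K)) * energy \<Omega> D * ennreal (1 / m)"
      by (intro mult_right_mono le) simp
    also have "\<dots> = ennreal (2 * (C + b * K) / m) * energy \<Omega> D"
    proof -
      have "ennreal (2 * (C + b * K)) * ennreal (1 / m) = ennreal (2 * (C + b * K) / m)"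
        using m by (simp add: ennreal_mult''[symmetric])
      then show ?thesis by (metis mult.assoc mult.commute)
    qed
    finally show "(\<integral>\<^sup>+x\<in>?B. ?g x \<partial>lborel) \<le> ennreal (2 * (C + b * K) / m) * energy \<Omega> D" .
  qed (use C K m in \<open>auto simp: b_def\<close>)
qed

text \<open>The reference value is fixed once, by the starting ball. \<open>P x\<close> says that
  some ball around \<open>x\<close> in \<Omega> has a bound with this value; within a small ball
  around any \<open>q\<close> it passes from one point to every other, and connectedness spreads it
  over \<Omega>. A compact set is then covered by finitely many such balls.\<close>

lemma osc_bound_compact_subsets:
  fixes \<Omega> :: "(real^'n) set"
  assumes \<Omega>: "open \<Omega>" "connected \<Omega>" "\<Omega> \<noteq> {}"
  obtains c where "\<And>K. compact K \<Longrightarrow> K \<subseteq> \<Omega> \<Longrightarrow> osc_bound \<Omega> c lborel K"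
proof -
  have [measurable]: "\<Omega> \<in> sets borel" using \<Omega> by auto
  obtain a R where aR: "a \<in> \<Omega>" "R > 0" "ball a R \<subseteq> \<Omega>"
    using \<Omega> by (meson equals0I open_contains_ball)
  obtain c where c: "osc_bound \<Omega> c lborel (ball a R)"
    using osc_bound_start[OF aR(3) _ aR(2)] by auto
  define P where "P = (\<lambda>x. \<exists>r>0. ball x r \<subseteq> \<Omega> \<and> osc_bound \<Omega> c lborel (ball x r))"
  have P: "P b" if "b \<in> \<Omega>" for b
  proof (rule connected_induction_simple[OF \<Omega>(2) aR(1) that])
    show "P a" unfolding P_def using aR c by blast
    fix q assume "q \<in> \<Omega>"
    then obtain r where r: "r > 0" "ball q r \<subseteq> \<Omega>" using \<Omega> open_contains_ball by blast
    have step: "P y" if xy: "x \<in> ball q r" "y \<in> ball q r" "P x" for x y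
    proof -
      obtain s where s: "s > 0" "osc_bound \<Omega> c lborel (ball x s)" using xy unfolding P_def by blast
      have "x \<in> ball x s \<inter> ball q r" using s xy by simp
      then have good: "osc_bound \<Omega> c lborel (ball q r)"
        using osc_bound_extend[OF r(2) _ r(1) s(2)] \<open>\<Omega> \<in> sets borel\<close> by blast
      obtain t where "t > 0" "ball y t \<subseteq> ball q r" using xy(2) open_contains_ball by blast
      then show ?thesis unfolding P_def using r osc_bound_mono[OF good] by blast
    qed
    show "\<exists>T. openin (top_of_set \<Omega>) T \<and> q \<in> T \<and> (\<forall>x\<in>T. \<forall>y\<in>T. P x \<longrightarrow> P y)"
    proof (intro exI[of _ "ball q r"] conjI ballI impI)
      show "openin (top_of_set \<Omega>) (ball q r)" using r by (intro open_subset) auto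
      show "q \<in> ball q r" using r by simp
    qed (rule step)
  qed
  have "osc_bound \<Omega> c lborel K" if K: "compact K" "K \<subseteq> \<Omega>" for K
  proof -
    obtain r where r: "\<And>x. x \<in> K \<Longrightarrow> r x > 0 \<and> osc_bound \<Omega> c lborel (ball x (r x))"
      using P K unfolding P_def by (metis subsetD)
    obtain F where F: "F \<subseteq> K" "finite F" "K \<subseteq> (\<Union>x\<in>F. ball x (r x))"
    proof (rule compactE_image[OF K(1), of K "\<lambda>x. ball x (r x)"])
      show "K \<subseteq> (\<Union>x\<in>K. ball x (r x))" using r by force
    qed auto
    have "osc_bound \<Omega> c lborel (\<Union>((\<lambda>x. ball x (r x)) ` F))"
      using F r by (intro osc_bound_finite_Union) auto
    then show ?thesis using F(3) osc_bound_mono by blast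
  qed
  then show ?thesis using that by blast
qed

section \<open>Hausdorff measure of Lipschitz graphs\<close>

lemma haus_const_pos: "haus_const s > 0"
  unfolding haus_const_def by (auto intro!: divide_pos_pos Gamma_real_pos)

lemma hausdorff_pre_le_card:
  fixes K :: "(real^'n) set"
  assumes F: "finite F" "K \<subseteq> (\<Union>x\<in>F. cball x \<epsilon>)" and \<epsilon>: "\<epsilon> > 0" "2 * \<epsilon> \<le> \<delta>"
  shows "hausdorff_pre s \<delta> K \<le> ennreal (real (card F) * (haus_const s * \<epsilon> ^ s))"
proof -
  obtain h where h: "bij_betw h {0..<card F} F" using ex_bij_betw_nat_finite[OF F(1)] by blast
  \<comment> \<open>The finite cover is padded to a sequence with empty sets. These weigh 0 by the
    case distinction in \<open>hausdorff_pre\<close>, also for \<open>s = 0\<close>, where the power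
    alone would be 1.\<close>
  define C where "C = (\<lambda>i. if i < card F then cball (h i) \<epsilon> else {})"
  have "K \<subseteq> (\<Union>i. C i)"
  proof
    fix x assume "x \<in> K"
    then obtain y where y: "y \<in> F" "x \<in> cball y \<epsilon>" using F by blast
    then obtain i where "i < card F" "y = h i" using h unfolding bij_betw_def by (metis atLeastLessThan_iff imageE)
    then show "x \<in> (\<Union>i. C i)" using y by (auto simp: C_def)
  qed
  moreover have "bounded (C i) \<and> diameter (C i) \<le> \<delta>" for i
    using \<epsilon> by (auto simp: C_def diameter_cball)
  ultimately have "hausdorff_pre s \<delta> K \<le> (\<Sum>i. ennreal (if C i = {} then 0 else haus_const s * (diameter (C i) / 2) ^ s))"
    unfolding hausdorff_pre_def by (intro INF_lower) auto
  also have "\<dots> = (\<Sum>i<card F. ennreal (if C i = {} then 0 else haus_const s * (diameter (C i) / 2) ^ s))"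
    by (rule suminf_finite) (auto simp: C_def)
  also have "\<dots> = (\<Sum>i<card F. ennreal (haus_const s * \<epsilon> ^ s))"
    using \<epsilon> by (intro sum.cong) (auto simp: C_def diameter_cball)
  also have "\<dots> = ennreal (real (card F) * (haus_const s * \<epsilon> ^ s))"
    using haus_const_pos[of s] \<epsilon> by (simp add: ennreal_mult' ennreal_of_nat_eq_real_of_nat)
  finally show ?thesis .
qed

text \<open>Below each point of \<open>F\<close> hangs a column of balls of radius \<rho> at depths
  between \<open>d\<close> and \<open>2 * d\<close>, with centres \<open>2 * \<rho>\<close> apart.
  Different columns are disjoint because the projections of the points along \<open>e\<close> are at
  least \<open>2 * \<rho>\<close> apart. A column holds at least \<open>d / (2 * \<rho>)\<close>
  balls, and all of them lie in \<open>W\<close>.\<close>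

lemma stacked_balls_volume:
  fixes F :: "(real^'n) set"
  assumes F: "finite F" and e: "norm e = 1" and \<rho>: "\<rho> > 0" and d: "d > 0"
    and sep: "\<And>x y. x \<in> F \<Longrightarrow> y \<in> F \<Longrightarrow> x \<noteq> y \<Longrightarrow> 2 * \<rho> \<le> norm ((x - y) - ((x - y) \<bullet> e) *\<^sub>R e)"
    and W: "W \<in> lmeasurable" "\<And>x t. x \<in> F \<Longrightarrow> d \<le> t \<Longrightarrow> t \<le> 2 * d \<Longrightarrow> ball (x - t *\<^sub>R e) \<rho> \<subseteq> W"
  shows "real (card F) * (d / (2 * \<rho>) * (unit_ball_vol (real CARD('n)) * \<rho> ^ CARD('n))) \<le> measure lebesgue W"
proof -
  \<comment> \<open>The column consists of \<open>m + 1\<close> balls, numbered from 0: rounding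
    down keeps the deepest centre at depth at most \<open>2 * d\<close>, and the extra ball makes
    the count at least \<open>d / (2 * \<rho>)\<close>.\<close>
  define m where "m = nat \<lfloor>d / (2 * \<rho>)\<rfloor>"
  have m: "real m \<le> d / (2 * \<rho>)" "d / (2 * \<rho>) \<le> real (Suc m)"
    unfolding m_def using \<rho> d by (auto simp: real_nat_ceiling_ge) linarith
  let ?I = "F \<times> {..m}"
  define b where "b = (\<lambda>(x, k::nat). ball (x - (d + 2 * real k * \<rho>) *\<^sub>R e) \<rho>)"
  define v where "v = unit_ball_vol (real CARD('n)) * \<rho> ^ CARD('n)"
  have v: "v \<ge> 0" unfolding v_def using \<rho> by simp
  have disj: "disjoint_family_on b ?I"
    unfolding disjoint_family_on_def
  proof (intro ballI impI)
    fix p q assume pq: "p \<in> ?I" "q \<in> ?I" "p \<noteq> q"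
    obtain x k y l where p: "p = (x, k)" and q: "q = (y, l)" by (cases p, cases q) auto
    define c where "c = (x - (d + 2 * real k * \<rho>) *\<^sub>R e) - (y - (d + 2 * real l * \<rho>) *\<^sub>R e)"
    have c: "c = (x - y) + (2 * \<rho> * (real l - real k)) *\<^sub>R e" unfolding c_def by (simp add: algebra_simps)
    have ee: "e \<bullet> e = 1" using e by (simp add: dot_square_norm)
    have "2 * \<rho> \<le> norm c"
    proof (cases "x = y")
      case True
      then have "\<bar>real l - real k\<bar> \<ge> 1" using pq p q by auto
      then show ?thesis using True c e \<rho> by (simp add: abs_mult)
    next
      case False
      \<comment> \<open>The projection orthogonal to \<open>e\<close> does not change when centres
        are moved along \<open>e\<close>, and it does not increase norms.\<close>
      let ?w = "(x - y) - ((x - y) \<bullet> e) *\<^sub>R e"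
      have "2 * \<rho> \<le> norm ?w" using sep pq p q False by auto
      moreover have "norm ?w \<le> norm c"
      proof -
        have "?w = c - (c \<bullet> e) *\<^sub>R e" unfolding c using ee by (simp add: algebra_simps inner_add_left inner_diff_left)
        moreover have "(norm (c - (c \<bullet> e) *\<^sub>R e))\<^sup>2 \<le> (norm c)\<^sup>2"
          unfolding power2_norm_eq_inner using ee
          by (simp add: inner_diff_left inner_diff_right inner_commute power2_eq_square)
        ultimately show ?thesis by (simp add: abs_le_square_iff[symmetric])
      qed
      ultimately show ?thesis by simp
    qed
    then have "2 * \<rho> \<le> dist (x - (d + 2 * real k * \<rho>) *\<^sub>R e) (y - (d + 2 * real l * \<rho>) *\<^sub>R e)"
      by (simp add: dist_norm c_def)
    then show "b p \<inter> b q = {}" unfolding b_def p q by (auto simp: disjoint_ballI)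
  qed
  have meas: "measure lebesgue (b p) = v" for p
    unfolding b_def v_def using \<rho> by (cases p) (simp add: content_ball)
  have "real (card F) * (d / (2 * \<rho>) * v) \<le> real (card F) * (real (Suc m) * v)"
    using m v by (intro mult_left_mono mult_right_mono) auto
  also have "\<dots> = (\<Sum>p\<in>?I. measure lebesgue (b p))"
    by (simp add: meas card_cartesian_product distrib_left)
  also have "\<dots> = measure lebesgue (\<Union>p\<in>?I. b p)"
    using F disj by (intro measure_UNION'[symmetric])
      (auto simp: b_def disjoint_family_on_def pairwise_def disjnt_def split: prod.splits)
  also have "\<dots> \<le> measure lebesgue W"
  proof (rule measure_mono_fmeasurable[OF _ _ W(1)])
    show "(\<Union>p\<in>?I. b p) \<subseteq> W"
    proof (rule UN_least)
      fix p assume "p \<in> ?I"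
      then obtain x k where p: "p = (x, k)" "x \<in> F" "k \<le> m" by auto
      then have "2 * real k * \<rho> \<le> 2 * real m * \<rho>" using \<rho> by simp
      also have "\<dots> \<le> d" using m(1) \<rho> by (simp add: field_simps)
      finally show "b p \<subseteq> W" unfolding b_def p using W(2)[OF p(2), of "d + 2 * real k * \<rho>"] \<rho> by auto
    qed
    show "(\<Union>p\<in>?I. b p) \<in> sets lebesgue" using F by (intro sets.finite_UN) (auto simp: b_def)
  qed
  finally show ?thesis unfolding v_def .
qed

lemma compact_slab:
  fixes K :: "(real^'n) set"
  assumes "compact K" shows "compact ((\<lambda>(x, t). x - t *\<^sub>R e) ` (K \<times> {d..d'}))"
  by (intro compact_continuous_image compact_Times assms compact_Icc)
     (auto simp: case_prod_unfold intro!: continuous_intros)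

text \<open>A maximal \<epsilon>-separated subset of \<open>K\<close> gives a cover by balls of
  radius \<epsilon>, so the Hausdorff sum is its cardinality times a multiple of
  \<open>\<epsilon> ^ s\<close>. By \<open>inj\<close> the projections of its points are still
  \<epsilon>\<open>/ M\<close> apart, so columns of balls of radius
  \<epsilon>\<open>/ (2 * M)\<close> are disjoint and their total volume bounds the cardinality. The
  condition \<open>inj\<close> expresses that \<open>K\<close> is a Lipschitz graph in direction
  \<open>e\<close>.\<close>

lemma hausdorff_outer_le_slab:
  fixes K :: "(real^'n) set"
  assumes K: "compact K" and e: "norm e = 1" and M: "M \<ge> 1" and d: "d > 0"
    and inj: "\<And>x y. x \<in> K \<Longrightarrow> y \<in> K \<Longrightarrow> norm (x - y) \<le> M * norm ((x - y) - ((x - y) \<bullet> e) *\<^sub>R e)"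
  shows "hausdorff_outer (CARD('n) - 1) K
    \<le> ennreal (2 * haus_const (CARD('n) - 1) * (2 * M) ^ (CARD('n) - 1) / (unit_ball_vol (real CARD('n)) * d))
      * emeasure lborel ((\<lambda>(x, t). x - t *\<^sub>R e) ` (K \<times> {d..2*d}))"
proof -
  define s where "s = CARD('n) - 1"
  have n: "CARD('n) = Suc s" unfolding s_def by (simp add: Suc_pred)
  define v where "v = unit_ball_vol (real CARD('n))"
  have v: "v > 0" unfolding v_def by simp
  define C where "C = 2 * haus_const s * (2 * M) ^ s / (v * d)"
  have C: "C > 0" unfolding C_def using haus_const_pos[of s] M v d by simp
  define S where "S = (\<lambda>(x, t). x - t *\<^sub>R e) ` (K \<times> {d..2*d})"
  have S: "compact S" unfolding S_def by (rule compact_slab[OF K])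
  have main: "hausdorff_pre s \<delta> K \<le> ennreal (C * measure lebesgue W)"
    if W: "open W" "S \<subseteq> W" "W \<in> lmeasurable" and \<delta>: "\<delta> > 0" for W \<delta>
  proof -
    \<comment> \<open>Balls of radius at most \<rho>\<open>0\<close> centred in the compact slab
      stay in the open set \<open>W\<close>; the columns need this room.\<close>
    obtain \<rho>0 where \<rho>0: "\<rho>0 > 0" "(\<Union>x\<in>S. ball x \<rho>0) \<subseteq> W"
      using compact_subset_open_imp_ball_epsilon_subset[OF S W(1,2)] by blast
    define \<epsilon> where "\<epsilon> = min (\<delta> / 2) \<rho>0"
    define \<rho> where "\<rho> = \<epsilon> / (2 * M)"
    have \<epsilon>: "\<epsilon> > 0" "2 * \<epsilon> \<le> \<delta>" "\<epsilon> \<le> \<rho>0" unfolding \<epsilon>_def using \<delta> \<rho>0 by auto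
    have \<rho>: "\<rho> > 0" unfolding \<rho>_def using \<epsilon> M by simp
    have "\<rho> \<le> \<epsilon>" unfolding \<rho>_def using \<epsilon> M by (simp add: field_simps)
    then have \<rho>1: "\<rho> \<le> \<rho>0" using \<epsilon> by simp
    define sep where "sep = (\<lambda>F. finite F \<and> F \<subseteq> K \<and> (\<forall>x\<in>F. \<forall>y\<in>F. x \<noteq> y \<longrightarrow> \<epsilon> < dist x y))"
    have vol: "real (card F) * (d / (2 * \<rho>) * (v * \<rho> ^ CARD('n))) \<le> measure lebesgue W" if F: "sep F" for F
      unfolding v_def
    proof (rule stacked_balls_volume[OF _ e \<rho> d _ W(3)])
      show "finite F" using F sep_def by simp
      fix x y assume xy: "x \<in> F" "y \<in> F" "x \<noteq> y"
      then have "\<epsilon> \<le> M * norm ((x - y) - ((x - y) \<bullet> e) *\<^sub>R e)"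
        using F inj[of x y] unfolding sep_def dist_norm by (meson less_imp_le order_trans subsetD)
      then show "2 * \<rho> \<le> norm ((x - y) - ((x - y) \<bullet> e) *\<^sub>R e)"
        unfolding \<rho>_def using M by (simp add: field_simps)
    next
      fix x t assume "x \<in> F" "d \<le> t" "t \<le> 2 * d"
      then have "x - t *\<^sub>R e \<in> S" using F unfolding S_def sep_def by (auto intro!: image_eqI[of _ _ "(x, t)"])
      then show "ball (x - t *\<^sub>R e) \<rho> \<subseteq> W" using \<rho>0(2) \<rho>1 subset_ball[of \<rho> \<rho>0] by blast
    qed
    define c0 where "c0 = d / (2 * \<rho>) * (v * \<rho> ^ CARD('n))"
    have c0: "c0 > 0" unfolding c0_def using d \<rho> v by simp
    have "sep {}" unfolding sep_def by simp
    moreover have "card F < nat \<lceil>measure lebesgue W / c0\<rceil> + 1" if "sep F" for F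
    proof -
      have "real (card F) \<le> measure lebesgue W / c0" using vol[OF that] c0 unfolding c0_def[symmetric]
        by (simp add: field_simps)
      then show ?thesis by linarith
    qed
    \<comment> \<open>The volume of \<open>W\<close> bounds the size of every separated set, so one
      of maximal cardinality exists; a point of \<open>K\<close> outside its balls could be added to
      it.\<close>
    ultimately obtain F where F: "sep F" "\<And>F'. sep F' \<Longrightarrow> card F' \<le> card F"
      using ex_has_greatest_nat[of sep "{}" card "nat \<lceil>measure lebesgue W / c0\<rceil> + 1"] by (metis less_imp_le)
    have cover: "K \<subseteq> (\<Union>x\<in>F. cball x \<epsilon>)"
    proof (rule ccontr)
      assume "\<not> ?thesis"
      then obtain y where y: "y \<in> K" "\<And>x. x \<in> F \<Longrightarrow> \<epsilon> < dist x y" by (fastforce simp: not_le)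
      then have "y \<notin> F" using \<epsilon> by force
      moreover have "sep (insert y F)" using F(1) y unfolding sep_def by (auto simp: dist_commute)
      ultimately show False using F(2)[of "insert y F"] F(1) unfolding sep_def by auto
    qed
    \<comment> \<open>A column has volume at least \<open>c0\<close>, of order
      \<open>\<rho> ^ s\<close>: one power less than a single ball, since it holds about
      \<open>d / (2 * \<rho>)\<close> of them. With \<epsilon>\<open>= 2 * M *\<close>\<rho> this
      matches \<open>\<epsilon> ^ s\<close>, and \<open>C\<close> is the resulting ratio.\<close>
    have "real (card F) * (haus_const s * \<epsilon> ^ s) = C * (real (card F) * c0)"
    proof -
      have "\<epsilon> = 2 * M * \<rho>" unfolding \<rho>_def using M by simp
      then have "\<epsilon> ^ s = (2 * M) ^ s * \<rho> ^ s" by (simp add: power_mult_distrib)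
      moreover have "C * c0 = haus_const s * ((2 * M) ^ s * \<rho> ^ s)"
        unfolding C_def c0_def n using v d \<rho> by (simp add: field_simps)
      ultimately show ?thesis by (simp add: algebra_simps)
    qed
    also have "\<dots> \<le> C * measure lebesgue W"
      using vol[OF F(1)] C unfolding c0_def[symmetric] by (intro mult_left_mono) auto
    finally have "ennreal (real (card F) * (haus_const s * \<epsilon> ^ s)) \<le> ennreal (C * measure lebesgue W)"
      by (rule ennreal_leI)
    then show ?thesis
      using hausdorff_pre_le_card[OF _ cover \<epsilon>(1,2), of s] F(1) order_trans unfolding sep_def by blast
  qed
  have Sm: "S \<in> lmeasurable" using S lmeasurable_compact by blast
  \<comment> \<open>The bound \<open>main\<close> is uniform in \<delta>, and by outer regularity
    \<open>W\<close> can be shrunk to the slab up to an arbitrarily small volume.\<close>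
  have "hausdorff_outer s K \<le> ennreal (C * measure lebesgue S)"
  proof (rule ennreal_le_epsilon)
    fix \<eta> :: real assume \<eta>: "\<eta> > 0"
    obtain W where W: "open W" "S \<subseteq> W" "W - S \<in> lmeasurable" "emeasure lebesgue (W - S) < ennreal (\<eta> / C)"
      using sets_lebesgue_outer_open[of S "\<eta> / C"] Sm \<eta> C by (auto simp: fmeasurableD)
    have WS: "measure lebesgue (W - S) < \<eta> / C"
      using W(3,4) by (metis emeasure_eq_measure2 ennreal_leI not_less)
    have Wm: "W \<in> lmeasurable" and "measure lebesgue W < measure lebesgue S + \<eta> / C"
      using W(2,3) WS Sm by (auto simp: measurable_measure_Diff dest!: fmeasurable_Diff_D)
    note W = W(1,2) this
    have "hausdorff_outer s K \<le> ennreal (C * measure lebesgue W)"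
      unfolding hausdorff_outer_def by (intro SUP_least main W) auto
    also have "\<dots> \<le> ennreal (C * measure lebesgue S + \<eta>)"
      using W(4) C by (intro ennreal_leI) (simp add: field_simps)
    also have "\<dots> = ennreal (C * measure lebesgue S) + ennreal \<eta>"
      using C \<eta> by (intro ennreal_plus) auto
    finally show "hausdorff_outer s K \<le> ennreal (C * measure lebesgue S) + ennreal \<eta>" .
  qed
  also have "\<dots> = ennreal C * emeasure lborel S"
  proof -
    have "emeasure lborel S = ennreal (measure lebesgue S)"
      using S emeasure_compact_finite[OF S] by (simp add: emeasure_eq_ennreal_measure less_top borel_compact)
    then show ?thesis using C by (simp add: ennreal_mult)
  qed
  finally show ?thesis unfolding S_def C_def v_def s_def .
qed

section \<open>Trace and Poincare inequalities on the boundary\<close>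

lemma space_bdry_measure [simp]: "space (bdry_measure \<Omega>) = frontier \<Omega>"
  unfolding bdry_measure_def by (simp add: space_measure_of_conv)

lemma sets_bdry_measure: "sets (bdry_measure \<Omega>) = sets (restrict_space borel (frontier \<Omega>))"
proof -
  have "sets (restrict_space borel (frontier \<Omega>)) \<subseteq> Pow (frontier \<Omega>)"
    using sets.space_closed[of "restrict_space borel (frontier \<Omega>)"] by (simp add: space_restrict_space)
  then show ?thesis unfolding bdry_measure_def
    using sets.sigma_sets_eq[of "restrict_space borel (frontier \<Omega>)"] by (simp add: space_restrict_space)
qed

lemma borel_imp_bdry_measurable:
  "f \<in> borel_measurable borel \<Longrightarrow> f \<in> borel_measurable (bdry_measure \<Omega>)"
  by (simp add: measurable_cong_sets[OF sets_bdry_measure refl] measurable_restrict_space1)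

lemma borel_Int_frontier_in_bdry: "A \<in> sets borel \<Longrightarrow> frontier \<Omega> \<inter> A \<in> sets (bdry_measure \<Omega>)"
  by (auto simp: sets_bdry_measure sets_restrict_space)

text \<open>\<open>measure_of\<close> assigns \<open>hausdorff_outer\<close> to measurable sets if
  this function is a measure on them, and 0 in all other cases; the inequality covers every
  case.\<close>

lemma emeasure_bdry_le_hausdorff_outer: "emeasure (bdry_measure \<Omega>) E \<le> hausdorff_outer (CARD('n) - 1) (E :: (real^'n) set)"
proof -
  have "sets (restrict_space borel (frontier \<Omega>)) \<subseteq> Pow (frontier \<Omega>)"
    using sets.space_closed[of "restrict_space borel (frontier \<Omega>)"] by (simp add: space_restrict_space)
  then show ?thesis unfolding bdry_measure_def by (simp add: emeasure_measure_of_conv)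
qed

text \<open>\<open>P\<close> is the part of \<open>x - p\<close> orthogonal to \<open>e\<close>, and
  \<open>G\<close> is the height of the graph above \<open>x\<close>, measured along
  \<open>e\<close>. Inside the cylinder \<open>U\<close> the domain is where \<open>G\<close> is
  positive, and moving by \<open>t\<close> against \<open>e\<close> raises \<open>G\<close> by
  exactly \<open>t\<close>. So \<open>G\<close> recovers the distance by which a boundary point has
  been moved inwards.\<close>

lemma graph_chart:
  fixes \<Omega> :: "(real^'n) set"
  assumes \<Omega>: "lipschitz_domain \<Omega>" and p: "p \<in> frontier \<Omega>"
  obtains e r d M G where "norm e = 1" "r > 0" "d > 0" "M \<ge> 1" "continuous_on UNIV G"
    "\<And>x t. G (x - t *\<^sub>R e) = G x + t"
    "\<And>x. x \<in> frontier \<Omega> \<inter> cball p r \<Longrightarrow> G x = (0::real)"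
    "\<And>x y. x \<in> frontier \<Omega> \<inter> cball p r \<Longrightarrow> y \<in> frontier \<Omega> \<inter> cball p r \<Longrightarrow>
        norm (x - y) \<le> M * norm ((x - y) - ((x - y) \<bullet> e) *\<^sub>R e)"
    "\<And>x t. x \<in> frontier \<Omega> \<inter> cball p r \<Longrightarrow> 0 < t \<Longrightarrow> t \<le> 2 * d \<Longrightarrow> x - t *\<^sub>R e \<in> \<Omega>"
proof -
  obtain e r h L \<psi> where e: "norm e = 1" and r: "r > 0" and h: "h > 0"
    and L: "L-lipschitz_on {y. y \<bullet> e = 0} \<psi>"
    and eq0: "let U = {x. norm ((x - p) - ((x - p) \<bullet> e) *\<^sub>R e) < r \<and> \<bar>(x - p) \<bullet> e\<bar> < h}
         in \<Omega> \<inter> U = {x \<in> U. (x - p) \<bullet> e < \<psi> ((x - p) - ((x - p) \<bullet> e) *\<^sub>R e)}"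
    using \<Omega> p unfolding lipschitz_domain_def by blast
  have op: "open \<Omega>" using \<Omega> by (simp add: lipschitz_domain_def)
  have ee: "e \<bullet> e = 1" using e by (simp add: dot_square_norm)
  define P where "P = (\<lambda>x. (x - p) - ((x - p) \<bullet> e) *\<^sub>R e)"
  define U where "U = {x. norm (P x) < r \<and> \<bar>(x - p) \<bullet> e\<bar> < h}"
  define G where "G = (\<lambda>x. \<psi> (P x) - (x - p) \<bullet> e)"
  have eq: "x \<in> \<Omega> \<longleftrightarrow> G x > 0" if "x \<in> U" for x
    using eq0 that unfolding U_def P_def G_def Let_def by auto
  have Pe: "P x \<in> {y. y \<bullet> e = 0}" for x unfolding P_def by (simp add: inner_diff_left ee)
  have Pc: "continuous_on UNIV P" unfolding P_def by (intro continuous_intros)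
  have Gc: "continuous_on UNIV G" unfolding G_def
    by (intro continuous_intros continuous_on_compose2[OF lipschitz_on_continuous_on[OF L] Pc]) (use Pe in auto)
  have Uo: "open U" unfolding U_def by (intro open_Collect_conj open_Collect_less continuous_intros Pc)
  have Pt: "P (x - t *\<^sub>R e) = P x" for x t unfolding P_def by (simp add: algebra_simps inner_diff_left ee)
  have Gt: "G (x - t *\<^sub>R e) = G x + t" for x t unfolding G_def Pt by (simp add: inner_diff_left ee)
  \<comment> \<open>Half the size of the cylinder: a boundary point within \<open>r0\<close> of
    \<open>p\<close> can descend by \<open>h / 4\<close> and still has height below \<open>h\<close>
    in absolute value.\<close>
  define r0 where "r0 = min r h / 2"
  have r0: "r0 > 0" "r0 < r" "r0 \<le> h / 2" unfolding r0_def using r h by auto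
  have Ple: "norm (P x) \<le> norm (x - p)" for x
  proof -
    have "(norm (P x))\<^sup>2 \<le> (norm (x - p))\<^sup>2"
      unfolding power2_norm_eq_inner P_def using ee
      by (simp add: inner_diff_left inner_diff_right inner_commute power2_eq_square)
    then show ?thesis by (simp add: abs_le_square_iff[symmetric])
  qed
  have inner_le: "\<bar>(x - p) \<bullet> e\<bar> \<le> norm (x - p)" for x
    using Cauchy_Schwarz_ineq2[of "x - p" e] e by simp
  let ?\<Gamma> = "frontier \<Omega> \<inter> cball p r0"
  have inU: "x - t *\<^sub>R e \<in> U" if "x \<in> ?\<Gamma>" "0 \<le> t" "t \<le> h / 4" for x t
  proof -
    have n: "norm (x - p) \<le> r0" using that by (simp add: dist_norm norm_minus_commute)
    have "norm (P x) < r" using Ple[of x] n r0 by linarith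
    moreover have "\<bar>(x - t *\<^sub>R e - p) \<bullet> e\<bar> < h"
      using inner_le[of x] n r0 that h by (simp add: inner_diff_left ee)
    ultimately show ?thesis unfolding U_def by (simp add: Pt)
  qed
  have G0: "G x = 0" if x: "x \<in> ?\<Gamma>" for x
  proof -
    have xU: "x \<in> U" using inU[OF x, of 0] h by simp
    have "x \<notin> \<Omega>" using x op by (simp add: frontier_def interior_open)
    then have "G x \<le> 0" using eq[OF xU] by simp
    \<comment> \<open>A boundary point is a limit of points of \<Omega>, where \<open>G\<close> is
      positive as long as they lie in \<open>U\<close>; a neighbourhood with negative
      \<open>G\<close> would contain none of them.\<close>
    moreover have "\<not> G x < 0"
    proof
      assume "G x < 0"
      moreover have "open (U \<inter> {y. G y < 0})" by (intro open_Int Uo open_Collect_less Gc continuous_intros)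
      ultimately have "\<Omega> \<inter> (U \<inter> {y. G y < 0}) \<noteq> {}"
        using x xU unfolding frontier_def by (metis (mono_tags, lifting) DiffD1 IntD1 IntI closure_iff_nhds_not_empty inf_commute mem_Collect_eq order_refl)
      then show False using eq by fastforce
    qed
    ultimately show ?thesis by simp
  qed
  have L0: "L \<ge> 0" using L by (rule lipschitz_on_nonneg)
  \<comment> \<open>Depths run up to \<open>2 * d\<close>, so \<open>d = h / 8\<close> keeps them
    within \<open>h / 4\<close>. The constant \<open>1 + L\<close> adds the horizontal part of a
    chord to its vertical part, which is at most \<open>L\<close> times the horizontal one.\<close>
  show ?thesis
  proof (rule that[of e r0 "h / 8" "1 + L" G, OF e r0(1) _ _ Gc Gt G0])
    fix x y assume x: "x \<in> ?\<Gamma>" and y: "y \<in> ?\<Gamma>"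
    let ?w = "(x - y) - ((x - y) \<bullet> e) *\<^sub>R e"
    have w: "P x - P y = ?w" unfolding P_def by (simp add: algebra_simps inner_diff_left)
    have "(x - y) \<bullet> e = \<psi> (P x) - \<psi> (P y)"
      using G0[OF x] G0[OF y] unfolding G_def by (simp add: inner_diff_left)
    then have "\<bar>(x - y) \<bullet> e\<bar> \<le> L * norm ?w"
      using lipschitz_onD[OF L Pe Pe, of x y] w by (simp add: dist_norm)
    moreover have "norm (x - y) \<le> norm ?w + norm (((x - y) \<bullet> e) *\<^sub>R e)"
      using norm_triangle_ineq[of ?w "((x - y) \<bullet> e) *\<^sub>R e"] by simp
    ultimately show "norm (x - y) \<le> (1 + L) * norm ?w" using e by (simp add: distrib_right)
  next
    fix x t assume x: "x \<in> ?\<Gamma>" and t: "0 < t" "t \<le> 2 * (h / 8)"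
    then show "x - t *\<^sub>R e \<in> \<Omega>" using eq[OF inU[OF x, of t]] Gt[of x t] G0[OF x] by simp
  qed (use h L0 in auto)
qed

text \<open>The level sets are taken with a weak inequality, so that they are closed for continuous
  functions. Restricting to positive levels keeps points where the function vanishes out of
  them.\<close>

lemma layer_cake:
  assumes "sigma_finite_measure \<mu>" and [measurable]: "f \<in> borel_measurable \<mu>" and nonneg: "\<And>x. 0 \<le> f x"
  shows "(\<integral>\<^sup>+x. ennreal (f x) \<partial>\<mu>) = (\<integral>\<^sup>+s. emeasure \<mu> {x \<in> space \<mu>. s \<le> f x} * indicator {0<..} s \<partial>(lborel :: real measure))"
proof -
  interpret sigma_finite_measure \<mu> by fact
  interpret pair_sigma_finite \<mu> "lborel :: real measure" by standard
  have "(\<integral>\<^sup>+x. ennreal (f x) \<partial>\<mu>) = (\<integral>\<^sup>+x. (\<integral>\<^sup>+s. indicator {s. 0 < s \<and> s \<le> f x} s \<partial>(lborel :: real measure)) \<partial>\<mu>)"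
  proof (intro nn_integral_cong)
    fix x
    have "{s. 0 < s \<and> s \<le> f x} = {0<..f x}" by auto
    then show "ennreal (f x) = (\<integral>\<^sup>+s. indicator {s. 0 < s \<and> s \<le> f x} s \<partial>(lborel :: real measure))"
      using nonneg by simp
  qed
  also have "\<dots> = (\<integral>\<^sup>+s. (\<integral>\<^sup>+x. indicator {s. 0 < s \<and> s \<le> f x} s \<partial>\<mu>) \<partial>(lborel :: real measure))"
    by (rule Fubini'[symmetric]) measurable
  also have "\<dots> = (\<integral>\<^sup>+s. emeasure \<mu> {x \<in> space \<mu>. s \<le> f x} * indicator {0<..} s \<partial>(lborel :: real measure))"
  proof (intro nn_integral_cong)
    fix s :: real
    have "(\<integral>\<^sup>+x. indicator {s. 0 < s \<and> s \<le> f x} s \<partial>\<mu>) = (\<integral>\<^sup>+x. indicator {0<..} s * indicator {x \<in> space \<mu>. s \<le> f x} x \<partial>\<mu>)"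
      by (intro nn_integral_cong) (auto split: split_indicator)
    then show "(\<integral>\<^sup>+x. indicator {s. 0 < s \<and> s \<le> f x} s \<partial>\<mu>) = emeasure \<mu> {x \<in> space \<mu>. s \<le> f x} * indicator {0<..} s"
      by (simp add: nn_integral_cmult mult.commute)
  qed
  finally show ?thesis .
qed

text \<open>The slab estimate is available for compact sets only. Superlevel sets of a continuous
  function on a compact boundary piece are compact, so comparing level by level turns the estimate
  for sets into one for integrals.\<close>

lemma nn_integral_le_by_level_sets:
  assumes "sigma_finite_measure \<mu>" "f \<in> borel_measurable \<mu>" "\<And>x. 0 \<le> f x"
    and "sigma_finite_measure \<nu>" and [measurable]: "g \<in> borel_measurable \<nu>" and "\<And>x. 0 \<le> g x"
    and le: "\<And>s. s > 0 \<Longrightarrow> emeasure \<mu> {x \<in> space \<mu>. s \<le> f x} \<le> c * emeasure \<nu> {y \<in> space \<nu>. s \<le> g y}"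
  shows "(\<integral>\<^sup>+x. ennreal (f x) \<partial>\<mu>) \<le> c * (\<integral>\<^sup>+y. ennreal (g y) \<partial>\<nu>)"
proof -
  interpret \<nu>: sigma_finite_measure \<nu> by fact
  have [measurable]: "(\<lambda>s. emeasure \<nu> {y \<in> space \<nu>. s \<le> g y}) \<in> borel_measurable lborel"
    by measurable
  have "(\<integral>\<^sup>+x. ennreal (f x) \<partial>\<mu>) = (\<integral>\<^sup>+s. emeasure \<mu> {x \<in> space \<mu>. s \<le> f x} * indicator {0<..} s \<partial>(lborel :: real measure))"
    by (rule layer_cake) fact+
  also have "\<dots> \<le> (\<integral>\<^sup>+s. c * (emeasure \<nu> {y \<in> space \<nu>. s \<le> g y} * indicator {0<..} s) \<partial>(lborel :: real measure))"
    using le by (intro nn_integral_mono) (auto split: split_indicator)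
  also have "\<dots> = c * (\<integral>\<^sup>+y. ennreal (g y) \<partial>\<nu>)"
    by (subst layer_cake[OF assms(4-6)]) (simp add: nn_integral_cmult)
  finally show ?thesis .
qed

text \<open>Finitely many chart pieces cover the compact boundary, and each is dominated by a
  multiple of the volume of a compact slab.\<close>

lemma finite_measure_bdry:
  fixes \<Omega> :: "(real^'n) set"
  assumes \<Omega>: "lipschitz_domain \<Omega>"
  shows "finite_measure (bdry_measure \<Omega>)"
proof -
  have "compact (frontier \<Omega>)" using \<Omega> by (simp add: lipschitz_domain_def compact_frontier_bounded)
  have "\<exists>r>0. emeasure (bdry_measure \<Omega>) (frontier \<Omega> \<inter> cball p r) < \<infinity>" if p: "p \<in> frontier \<Omega>" for p
  proof -
    obtain e r d M and G :: "real^'n \<Rightarrow> real" where c: "norm e = 1" "r > 0" "d > 0" "M \<ge> 1" and "continuous_on UNIV G"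
      "\<And>x t. G (x - t *\<^sub>R e) = G x + t" "\<And>x. x \<in> frontier \<Omega> \<inter> cball p r \<Longrightarrow> G x = 0"
      and inj: "\<And>x y. x \<in> frontier \<Omega> \<inter> cball p r \<Longrightarrow> y \<in> frontier \<Omega> \<inter> cball p r \<Longrightarrow>
        norm (x - y) \<le> M * norm ((x - y) - ((x - y) \<bullet> e) *\<^sub>R e)"
      and "\<And>x t. x \<in> frontier \<Omega> \<inter> cball p r \<Longrightarrow> 0 < t \<Longrightarrow> t \<le> 2 * d \<Longrightarrow> x - t *\<^sub>R e \<in> \<Omega>"
      by (rule graph_chart[OF \<Omega> p]) blast
    let ?K = "frontier \<Omega> \<inter> cball p r"
    have K: "compact ?K" using \<open>compact (frontier \<Omega>)\<close> by (simp add: compact_Int)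
    note emeasure_bdry_le_hausdorff_outer[of \<Omega> ?K]
    also note hausdorff_outer_le_slab[OF K c(1,4,3) inj]
    also have "ennreal (2 * haus_const (CARD('n) - 1) * (2 * M) ^ (CARD('n) - 1) / (unit_ball_vol (real CARD('n)) * d))
        * emeasure lborel ((\<lambda>(x, t). x - t *\<^sub>R e) ` (?K \<times> {d..2*d})) < \<infinity>"
      using emeasure_compact_finite[OF compact_slab[OF K, of e d "2 * d"]] by (simp add: ennreal_mult_less_top)
    finally show ?thesis using c by auto
  qed
  then obtain r where r: "\<And>p. p \<in> frontier \<Omega> \<Longrightarrow> r p > 0 \<and> emeasure (bdry_measure \<Omega>) (frontier \<Omega> \<inter> cball p (r p)) < \<infinity>"
    by metis
  obtain F where F: "F \<subseteq> frontier \<Omega>" "finite F" "frontier \<Omega> \<subseteq> (\<Union>p\<in>F. ball p (r p))"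
  proof (rule compactE_image[OF \<open>compact (frontier \<Omega>)\<close>, of "frontier \<Omega>" "\<lambda>p. ball p (r p)"])
    show "frontier \<Omega> \<subseteq> (\<Union>p\<in>frontier \<Omega>. ball p (r p))" using r by force
  qed auto
  have sets: "(\<lambda>p. frontier \<Omega> \<inter> cball p (r p)) ` F \<subseteq> sets (bdry_measure \<Omega>)"
    by (auto intro!: borel_Int_frontier_in_bdry)
  have "emeasure (bdry_measure \<Omega>) (frontier \<Omega>) \<le> emeasure (bdry_measure \<Omega>) (\<Union>p\<in>F. frontier \<Omega> \<inter> cball p (r p))"
    using F sets by (intro emeasure_mono) (force, blast)
  also have "\<dots> \<le> (\<Sum>p\<in>F. emeasure (bdry_measure \<Omega>) (frontier \<Omega> \<inter> cball p (r p)))"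
    using F sets by (intro emeasure_subadditive_finite) auto
  also have "\<dots> < \<infinity>" using F r by (auto simp: ennreal_sum_less_top)
  finally show ?thesis by (intro finite_measureI) simp
qed

text \<open>\<open>C\<close> is uniform in the thickness \<open>d\<close>, while the slab
  \<open>S\<close> may depend on it. Small \<open>d\<close> makes the gradient term small, as the
  trace inequality requires. The arbitrary constant \<open>c\<close> and the compactness of
  \<open>S\<close> inside \<Omega> serve the Poincare inequality, where the last integral is
  controlled by the oscillation on \<open>S\<close>.\<close>

definition local_trace_bound :: "(real^'n) set \<Rightarrow> (real^'n) set \<Rightarrow> bool" where
  "local_trace_bound \<Omega> \<Gamma> \<longleftrightarrow> (\<exists>d0>0. \<exists>C\<ge>0. \<forall>d. 0 < d \<longrightarrow> d \<le> d0 \<longrightarrow> (\<exists>S. compact S \<and> S \<subseteq> \<Omega> \<and>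
     (\<forall>\<phi> D c. C1_with \<phi> D \<longrightarrow>
       (\<integral>\<^sup>+x\<in>\<Gamma>. ennreal ((cmod (\<phi> x - c))\<^sup>2) \<partial>bdry_measure \<Omega>)
       \<le> ennreal (C * d) * energy \<Omega> D + ennreal (C / d) * (\<integral>\<^sup>+y\<in>S. ennreal ((cmod (\<phi> y - c))\<^sup>2) \<partial>lborel))))"

lemma local_trace_boundI:
  assumes "d0 > 0" "C \<ge> 0" "\<And>d. 0 < d \<Longrightarrow> d \<le> d0 \<Longrightarrow> \<exists>S. compact S \<and> S \<subseteq> \<Omega> \<and>
     (\<forall>\<phi> D c. C1_with \<phi> D \<longrightarrow>
       (\<integral>\<^sup>+x\<in>\<Gamma>. ennreal ((cmod (\<phi> x - c))\<^sup>2) \<partial>bdry_measure \<Omega>)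
       \<le> ennreal (C * d) * energy \<Omega> D + ennreal (C / d) * (\<integral>\<^sup>+y\<in>S. ennreal ((cmod (\<phi> y - c))\<^sup>2) \<partial>lborel))"
  shows "local_trace_bound \<Omega> \<Gamma>"
  unfolding local_trace_bound_def using assms by blast

text \<open>The boundary integral is bounded by \<open>C / d\<close> times the integral over the
  slab of the boundary values carried inwards along \<open>e\<close>. Replacing
  \<open>\<phi> (\<pi> y)\<close> by \<open>\<phi> y\<close> then costs an increment along a segment
  of length at most \<open>2 * d\<close>.\<close>

lemma local_trace_bound_chart:
  fixes \<Omega> :: "(real^'n) set"
  assumes \<Omega>: "lipschitz_domain \<Omega>" and p: "p \<in> frontier \<Omega>"
  obtains r where "r > 0" "local_trace_bound \<Omega> (frontier \<Omega> \<inter> cball p r)"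
proof -
  obtain e r d0 M and G :: "real^'n \<Rightarrow> real" where c: "norm e = 1" "r > 0" "d0 > 0" "M \<ge> 1" and Gc: "continuous_on UNIV G"
    and Gt: "\<And>x t. G (x - t *\<^sub>R e) = G x + t"
    and G0: "\<And>x. x \<in> frontier \<Omega> \<inter> cball p r \<Longrightarrow> G x = 0"
    and inj: "\<And>x y. x \<in> frontier \<Omega> \<inter> cball p r \<Longrightarrow> y \<in> frontier \<Omega> \<inter> cball p r \<Longrightarrow>
        norm (x - y) \<le> M * norm ((x - y) - ((x - y) \<bullet> e) *\<^sub>R e)"
    and sub: "\<And>x t. x \<in> frontier \<Omega> \<inter> cball p r \<Longrightarrow> 0 < t \<Longrightarrow> t \<le> 2 * d0 \<Longrightarrow> x - t *\<^sub>R e \<in> \<Omega>"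
    by (rule graph_chart[OF \<Omega> p]) blast
  have op: "open \<Omega>" and cf: "compact (frontier \<Omega>)"
    using \<Omega> by (auto simp: lipschitz_domain_def compact_frontier_bounded)
  let ?\<Gamma> = "frontier \<Omega> \<inter> cball p r" and ?\<sigma> = "bdry_measure \<Omega>"
  interpret fin: finite_measure ?\<sigma> by (rule finite_measure_bdry[OF \<Omega>])
  have \<Gamma>: "compact ?\<Gamma>" using cf by (simp add: compact_Int)
  have [measurable]: "?\<Gamma> \<in> sets ?\<sigma>" by (intro borel_Int_frontier_in_bdry) auto
  have [measurable]: "G \<in> borel_measurable borel" by (intro borel_measurable_continuous_onI Gc)
  define C where "C = 2 * haus_const (CARD('n) - 1) * (2 * M) ^ (CARD('n) - 1) / unit_ball_vol (real CARD('n))"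
  have C: "C \<ge> 0" unfolding C_def using haus_const_pos[of "CARD('n) - 1"] c by simp
  \<comment> \<open>Pushes a slab point back to the boundary point it came from. Being given by the
    continuous \<open>G\<close>, it is defined and Borel measurable on the whole space.\<close>
  define \<pi> where "\<pi> = (\<lambda>y. y + G y *\<^sub>R e)"
  have \<pi>c: "continuous_on UNIV \<pi>" unfolding \<pi>_def by (intro continuous_intros Gc)
  have [measurable]: "\<pi> \<in> borel_measurable borel" by (intro borel_measurable_continuous_onI \<pi>c)
  have "\<exists>S. compact S \<and> S \<subseteq> \<Omega> \<and> (\<forall>\<phi> D k. C1_with \<phi> D \<longrightarrow>
       (\<integral>\<^sup>+x\<in>?\<Gamma>. ennreal ((cmod (\<phi> x - k))\<^sup>2) \<partial>?\<sigma>)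
       \<le> ennreal (8 * C * d) * energy \<Omega> D + ennreal (8 * C / d) * (\<integral>\<^sup>+y\<in>S. ennreal ((cmod (\<phi> y - k))\<^sup>2) \<partial>lborel))"
    if d: "0 < d" "d \<le> d0" for d
  proof -
    define slab where "slab = (\<lambda>K. (\<lambda>(x, t). x - t *\<^sub>R e) ` (K \<times> {d..2*d}))"
    define S where "S = slab ?\<Gamma>"
    have S: "compact S" unfolding S_def slab_def by (rule compact_slab[OF \<Gamma>])
    then have [measurable]: "S \<in> sets borel" by (rule borel_compact)
    have SE: "\<exists>x t. x \<in> ?\<Gamma> \<and> d \<le> t \<and> t \<le> 2 * d \<and> y = x - t *\<^sub>R e \<and> G y = t \<and> \<pi> y = x" if y: "y \<in> S" for y
    proof -
      obtain x t where xt: "x \<in> ?\<Gamma>" "t \<in> {d..2*d}" "y = x - t *\<^sub>R e"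
        using y unfolding S_def slab_def by fastforce
      have "G y = t" using Gt G0[OF xt(1)] xt by simp
      moreover have "\<pi> y = x" unfolding \<pi>_def using xt \<open>G y = t\<close> by simp
      ultimately show ?thesis using xt by auto
    qed
    have S\<Omega>: "S \<subseteq> \<Omega>"
    proof
      fix y assume "y \<in> S"
      then obtain x t where "x \<in> ?\<Gamma>" "d \<le> t" "t \<le> 2 * d" "y = x - t *\<^sub>R e" using SE by blast
      then show "y \<in> \<Omega>" using sub[of x t] d by simp
    qed
    \<comment> \<open>The slab over a superlevel set on the boundary is the superlevel set of
      \<open>f\<close> composed with \<pi>: the two sides of the level comparison correspond
      exactly.\<close>
    have slab_level: "slab {x \<in> ?\<Gamma>. s \<le> f x} = {y \<in> S. s \<le> f (\<pi> y)}" for s and f :: "real^'n \<Rightarrow> real"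
    proof
      show "slab {x \<in> ?\<Gamma>. s \<le> f x} \<subseteq> {y \<in> S. s \<le> f (\<pi> y)}"
      proof
        fix y assume "y \<in> slab {x \<in> ?\<Gamma>. s \<le> f x}"
        then obtain x t where xt: "x \<in> ?\<Gamma>" "s \<le> f x" "t \<in> {d..2*d}" "y = x - t *\<^sub>R e"
          unfolding slab_def by fastforce
        have "\<pi> y = x" unfolding \<pi>_def using xt Gt G0[OF xt(1)] by simp
        moreover have "y \<in> S" unfolding S_def slab_def using xt by (intro image_eqI[of _ _ "(x, t)"]) auto
        ultimately show "y \<in> {y \<in> S. s \<le> f (\<pi> y)}" using xt by simp
      qed
      show "{y \<in> S. s \<le> f (\<pi> y)} \<subseteq> slab {x \<in> ?\<Gamma>. s \<le> f x}"
      proof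
        fix y assume y: "y \<in> {y \<in> S. s \<le> f (\<pi> y)}"
        then obtain x t where xt: "x \<in> ?\<Gamma>" "d \<le> t" "t \<le> 2 * d" "y = x - t *\<^sub>R e" "\<pi> y = x" using SE by blast
        then show "y \<in> slab {x \<in> ?\<Gamma>. s \<le> f x}" unfolding slab_def using y
          by (intro image_eqI[of _ _ "(x, t)"]) auto
      qed
    qed
    have cont: "(\<integral>\<^sup>+x\<in>?\<Gamma>. ennreal (f x) \<partial>?\<sigma>) \<le> ennreal (C / d) * (\<integral>\<^sup>+y\<in>S. ennreal (f (\<pi> y)) \<partial>lborel)"
      if f: "continuous_on UNIV f" "\<And>x. 0 \<le> f x" for f
    proof -
      have [measurable]: "f \<in> borel_measurable borel" by (intro borel_measurable_continuous_onI f)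
      then have [measurable]: "f \<in> borel_measurable ?\<sigma>" by (rule borel_imp_bdry_measurable)
      have "(\<integral>\<^sup>+x. ennreal (f x * indicator ?\<Gamma> x) \<partial>?\<sigma>) \<le> ennreal (C / d) * (\<integral>\<^sup>+y. ennreal (f (\<pi> y) * indicator S y) \<partial>lborel)"
      proof (rule nn_integral_le_by_level_sets)
        fix s :: real assume s: "s > 0"
        let ?K = "{x \<in> ?\<Gamma>. s \<le> f x}"
        have "closed {x. s \<le> f x}" by (intro closed_Collect_le f continuous_intros)
        then have "compact (?\<Gamma> \<inter> {x. s \<le> f x})" by (rule compact_Int_closed[OF \<Gamma>])
        moreover have "?\<Gamma> \<inter> {x. s \<le> f x} = ?K" by auto
        ultimately have K: "compact ?K" by simp
        have "{x \<in> space ?\<sigma>. s \<le> f x * indicator ?\<Gamma> x} = ?K"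
          using s by (auto split: split_indicator_asm split_indicator)
        moreover have "{y \<in> space lborel. s \<le> f (\<pi> y) * indicator S y} = slab ?K"
          unfolding slab_level using s by (auto split: split_indicator_asm split_indicator)
        moreover have "emeasure ?\<sigma> ?K \<le> ennreal (C / d) * emeasure lborel (slab ?K)"
          using order_trans[OF emeasure_bdry_le_hausdorff_outer[of \<Omega> ?K] hausdorff_outer_le_slab[OF K c(1,4) d(1) inj]]
          unfolding slab_def C_def by simp
        ultimately show "emeasure ?\<sigma> {x \<in> space ?\<sigma>. s \<le> f x * indicator ?\<Gamma> x}
            \<le> ennreal (C / d) * emeasure lborel {y \<in> space lborel. s \<le> f (\<pi> y) * indicator S y}" by simp
      next
        show "sigma_finite_measure ?\<sigma>" by (rule fin.sigma_finite_measure_axioms)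
        show "sigma_finite_measure (lborel :: (real^'n) measure)" by (rule sigma_finite_lborel)
      qed (use f in \<open>auto split: split_indicator\<close>)
      then show ?thesis using f(2) by (simp add: ennreal_mult'' ennreal_indicator)
    qed
    have "(\<integral>\<^sup>+x\<in>?\<Gamma>. ennreal ((cmod (\<phi> x - k))\<^sup>2) \<partial>?\<sigma>)
       \<le> ennreal (8 * C * d) * energy \<Omega> D + ennreal (8 * C / d) * (\<integral>\<^sup>+y\<in>S. ennreal ((cmod (\<phi> y - k))\<^sup>2) \<partial>lborel)"
      if phi: "C1_with \<phi> D" for \<phi> D k
    proof -
      have [measurable]: "\<phi> \<in> borel_measurable borel" by (rule C1_with_borel_measurable[OF phi])
      let ?I = "\<integral>\<^sup>+y\<in>S. ennreal ((cmod (\<phi> y - k))\<^sup>2) \<partial>lborel"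
      have "(\<integral>\<^sup>+x\<in>?\<Gamma>. ennreal ((cmod (\<phi> x - k))\<^sup>2) \<partial>?\<sigma>) \<le> ennreal (C / d) * (\<integral>\<^sup>+y\<in>S. ennreal ((cmod (\<phi> (\<pi> y) - k))\<^sup>2) \<partial>lborel)"
        by (rule cont) (auto intro!: continuous_intros C1_with_continuous[OF phi])
      also have "(\<integral>\<^sup>+y\<in>S. ennreal ((cmod (\<phi> (\<pi> y) - k))\<^sup>2) \<partial>lborel)
        \<le> (\<integral>\<^sup>+y. 2 * (ennreal ((cmod (\<phi> (\<pi> y) - \<phi> y))\<^sup>2) * indicator S y)
            + 2 * (ennreal ((cmod (\<phi> y - k))\<^sup>2) * indicator S y) \<partial>lborel)"
      proof (rule nn_integral_mono)
        fix y show "ennreal ((cmod (\<phi> (\<pi> y) - k))\<^sup>2) * indicator S y \<le> 2 * (ennreal ((cmod (\<phi> (\<pi> y) - \<phi> y))\<^sup>2) * indicator S y)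
            + 2 * (ennreal ((cmod (\<phi> y - k))\<^sup>2) * indicator S y)"
          using cmod_diff_square_le[of "\<phi> (\<pi> y)" k "\<phi> y"] by (cases "y \<in> S") simp_all
      qed
      also have "\<dots> = 2 * (\<integral>\<^sup>+y\<in>S. ennreal ((cmod (\<phi> (y + G y *\<^sub>R e) - \<phi> y))\<^sup>2) \<partial>lborel) + 2 * ?I"
        by (subst nn_integral_add) (simp_all add: nn_integral_cmult, simp add: \<pi>_def)
      \<comment> \<open>The travelled length is \<open>G y\<close>. Before it is used up the moving
        point is still at positive depth, hence in \<Omega>; only the endpoint is on the
        boundary.\<close>
      also have "(\<integral>\<^sup>+y\<in>S. ennreal ((cmod (\<phi> (y + G y *\<^sub>R e) - \<phi> y))\<^sup>2) \<partial>lborel) \<le> ennreal ((2 * d)\<^sup>2 * (norm e)\<^sup>2) * energy \<Omega> D"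
      proof (rule translation_estimate[OF phi])
        fix y s assume y: "y \<in> S" and s: "0 \<le> s" "s < G y"
        obtain x t where xt: "x \<in> ?\<Gamma>" "d \<le> t" "t \<le> 2 * d" "y = x - t *\<^sub>R e" "G y = t" using SE[OF y] by blast
        have "y + s *\<^sub>R e = x - (t - s) *\<^sub>R e" using xt by (simp add: algebra_simps)
        then show "y + s *\<^sub>R e \<in> \<Omega>" using sub[OF xt(1), of "t - s"] xt(2,3,5) s d by simp
      next
        fix y assume "y \<in> S"
        from SE[OF this] show "0 \<le> G y \<and> G y \<le> 2 * d" using d by auto
      qed (use op d in auto)
      finally have "(\<integral>\<^sup>+x\<in>?\<Gamma>. ennreal ((cmod (\<phi> x - k))\<^sup>2) \<partial>?\<sigma>)
        \<le> ennreal (C / d) * (2 * (ennreal ((2 * d)\<^sup>2) * energy \<Omega> D) + 2 * ?I)"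
        using c(1) by (simp add: mult_left_mono add_right_mono)
      \<comment> \<open>The 8 is \<open>2 * 2\<^sup>2\<close>: a factor 2 from splitting the square,
        the rest from the length bound \<open>2 * d\<close>. The zero-order coefficient
        \<open>2 * C / d\<close> is afterwards enlarged so that a single constant serves both
        terms.\<close>
      also have "\<dots> = ennreal (8 * C * d) * energy \<Omega> D + ennreal (2 * C / d) * ?I"
      proof -
        have a: "ennreal (C / d) * (2 * ennreal ((2 * d)\<^sup>2)) = ennreal (8 * C * d)"
          using C d by (simp add: ennreal_mult'[symmetric] power2_eq_square flip: ennreal_numeral)
        have b: "ennreal (C / d) * 2 = ennreal (2 * C / d)"
          using C d by (simp add: ennreal_mult'[symmetric] mult.commute flip: ennreal_numeral)
        have "ennreal (C / d) * (2 * (ennreal ((2 * d)\<^sup>2) * energy \<Omega> D) + 2 * ?I)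
          = (ennreal (C / d) * (2 * ennreal ((2 * d)\<^sup>2))) * energy \<Omega> D + (ennreal (C / d) * 2) * ?I"
          by (simp only: distrib_left mult.assoc)
        then show ?thesis unfolding a b .
      qed
      also have "\<dots> \<le> ennreal (8 * C * d) * energy \<Omega> D + ennreal (8 * C / d) * ?I"
        using C d by (intro add_left_mono mult_right_mono ennreal_leI divide_right_mono) auto
      finally show ?thesis .
    qed
    then show ?thesis using S S\<Omega> by blast
  qed
  then have "local_trace_bound \<Omega> ?\<Gamma>"
    using c(3) C by (intro local_trace_boundI[of d0 "8 * C"]) auto
  then show ?thesis using that c(2) by blast
qed

lemma local_trace_bound_Un:
  assumes A: "local_trace_bound \<Omega> A" and B: "local_trace_bound \<Omega> B"
    and [measurable]: "A \<in> sets (bdry_measure \<Omega>)" "B \<in> sets (bdry_measure \<Omega>)"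
  shows "local_trace_bound \<Omega> (A \<union> B)"
proof -
  obtain d1 C1 where 1: "d1 > 0" "C1 \<ge> 0" "\<And>d. 0 < d \<Longrightarrow> d \<le> d1 \<Longrightarrow> \<exists>S. compact S \<and> S \<subseteq> \<Omega> \<and>
     (\<forall>\<phi> D c. C1_with \<phi> D \<longrightarrow> (\<integral>\<^sup>+x\<in>A. ennreal ((cmod (\<phi> x - c))\<^sup>2) \<partial>bdry_measure \<Omega>)
       \<le> ennreal (C1 * d) * energy \<Omega> D + ennreal (C1 / d) * (\<integral>\<^sup>+y\<in>S. ennreal ((cmod (\<phi> y - c))\<^sup>2) \<partial>lborel))"
    using A unfolding local_trace_bound_def by blast
  obtain d2 C2 where 2: "d2 > 0" "C2 \<ge> 0" "\<And>d. 0 < d \<Longrightarrow> d \<le> d2 \<Longrightarrow> \<exists>S. compact S \<and> S \<subseteq> \<Omega> \<and>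
     (\<forall>\<phi> D c. C1_with \<phi> D \<longrightarrow> (\<integral>\<^sup>+x\<in>B. ennreal ((cmod (\<phi> x - c))\<^sup>2) \<partial>bdry_measure \<Omega>)
       \<le> ennreal (C2 * d) * energy \<Omega> D + ennreal (C2 / d) * (\<integral>\<^sup>+y\<in>S. ennreal ((cmod (\<phi> y - c))\<^sup>2) \<partial>lborel))"
    using B unfolding local_trace_bound_def by blast
  show ?thesis
  proof (rule local_trace_boundI[of "min d1 d2" "C1 + C2"])
    fix d assume d: "0 < d" "d \<le> min d1 d2"
    obtain S1 where S1: "compact S1" "S1 \<subseteq> \<Omega>" "\<And>\<phi> D c. C1_with \<phi> D \<Longrightarrow> (\<integral>\<^sup>+x\<in>A. ennreal ((cmod (\<phi> x - c))\<^sup>2) \<partial>bdry_measure \<Omega>)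
       \<le> ennreal (C1 * d) * energy \<Omega> D + ennreal (C1 / d) * (\<integral>\<^sup>+y\<in>S1. ennreal ((cmod (\<phi> y - c))\<^sup>2) \<partial>lborel)"
      using 1(3)[of d] d by auto
    obtain S2 where S2: "compact S2" "S2 \<subseteq> \<Omega>" "\<And>\<phi> D c. C1_with \<phi> D \<Longrightarrow> (\<integral>\<^sup>+x\<in>B. ennreal ((cmod (\<phi> x - c))\<^sup>2) \<partial>bdry_measure \<Omega>)
       \<le> ennreal (C2 * d) * energy \<Omega> D + ennreal (C2 / d) * (\<integral>\<^sup>+y\<in>S2. ennreal ((cmod (\<phi> y - c))\<^sup>2) \<partial>lborel)"
      using 2(3)[of d] d by auto
    show "\<exists>S. compact S \<and> S \<subseteq> \<Omega> \<and> (\<forall>\<phi> D c. C1_with \<phi> D \<longrightarrow>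
       (\<integral>\<^sup>+x\<in>A \<union> B. ennreal ((cmod (\<phi> x - c))\<^sup>2) \<partial>bdry_measure \<Omega>)
       \<le> ennreal ((C1 + C2) * d) * energy \<Omega> D + ennreal ((C1 + C2) / d) * (\<integral>\<^sup>+y\<in>S. ennreal ((cmod (\<phi> y - c))\<^sup>2) \<partial>lborel))"
    proof (intro exI[of _ "S1 \<union> S2"] conjI allI impI)
      fix \<phi> c and D :: "real^'a \<Rightarrow> complex^'a" assume phi: "C1_with \<phi> D"
      have [measurable]: "\<phi> \<in> borel_measurable (bdry_measure \<Omega>)"
        by (rule borel_imp_bdry_measurable[OF C1_with_borel_measurable[OF phi]])
      let ?f = "\<lambda>x. ennreal ((cmod (\<phi> x - c))\<^sup>2)"
      let ?I = "\<integral>\<^sup>+y\<in>S1 \<union> S2. ?f y \<partial>lborel"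
      have "(\<integral>\<^sup>+x\<in>A \<union> B. ?f x \<partial>bdry_measure \<Omega>) \<le> (\<integral>\<^sup>+x. ?f x * indicator A x + ?f x * indicator B x \<partial>bdry_measure \<Omega>)"
        by (intro nn_integral_mono) (auto split: split_indicator)
      also have "\<dots> = (\<integral>\<^sup>+x\<in>A. ?f x \<partial>bdry_measure \<Omega>) + (\<integral>\<^sup>+x\<in>B. ?f x \<partial>bdry_measure \<Omega>)"
        by (intro nn_integral_add) measurable
      also have "\<dots> \<le> (ennreal (C1 * d) * energy \<Omega> D + ennreal (C1 / d) * (\<integral>\<^sup>+y\<in>S1. ?f y \<partial>lborel))
          + (ennreal (C2 * d) * energy \<Omega> D + ennreal (C2 / d) * (\<integral>\<^sup>+y\<in>S2. ?f y \<partial>lborel))"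
        by (intro add_mono S1(3) S2(3) phi)
      also have "\<dots> \<le> (ennreal (C1 * d) * energy \<Omega> D + ennreal (C1 / d) * ?I)
          + (ennreal (C2 * d) * energy \<Omega> D + ennreal (C2 / d) * ?I)"
        by (intro add_mono mult_left_mono nn_set_integral_set_mono order_refl) auto
      also have "\<dots> = ennreal ((C1 + C2) * d) * energy \<Omega> D + ennreal ((C1 + C2) / d) * ?I"
      proof -
        have "ennreal ((C1 + C2) * d) = ennreal (C1 * d) + ennreal (C2 * d)"
          "ennreal ((C1 + C2) / d) = ennreal (C1 / d) + ennreal (C2 / d)"
          using 1(2) 2(2) d by (simp_all add: distrib_right add_divide_distrib)
        note eqs = this
        show ?thesis unfolding eqs by (simp only: distrib_left distrib_right ac_simps)
      qed
      finally show "(\<integral>\<^sup>+x\<in>A \<union> B. ?f x \<partial>bdry_measure \<Omega>) \<le> ennreal ((C1 + C2) * d) * energy \<Omega> D + ennreal ((C1 + C2) / d) * ?I" .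
    qed (use S1 S2 in auto)
  qed (use 1 2 in auto)
qed

lemma local_trace_bound_frontier:
  fixes \<Omega> :: "(real^'n) set"
  assumes \<Omega>: "lipschitz_domain \<Omega>"
  shows "local_trace_bound \<Omega> (frontier \<Omega>)"
proof -
  have cf: "compact (frontier \<Omega>)" using \<Omega> by (simp add: lipschitz_domain_def compact_frontier_bounded)
  obtain r where r: "\<And>p. p \<in> frontier \<Omega> \<Longrightarrow> r p > 0 \<and> local_trace_bound \<Omega> (frontier \<Omega> \<inter> cball p (r p))"
  proof -
    have "\<exists>r. r > 0 \<and> local_trace_bound \<Omega> (frontier \<Omega> \<inter> cball p r)" if "p \<in> frontier \<Omega>" for p
      using local_trace_bound_chart[OF \<Omega> that] by blast
    then show ?thesis using that by metis
  qed
  obtain F where F: "F \<subseteq> frontier \<Omega>" "finite F" "frontier \<Omega> \<subseteq> (\<Union>p\<in>F. ball p (r p))"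
  proof (rule compactE_image[OF cf, of "frontier \<Omega>" "\<lambda>p. ball p (r p)"])
    show "frontier \<Omega> \<subseteq> (\<Union>p\<in>frontier \<Omega>. ball p (r p))" using r by force
  qed auto
  have "local_trace_bound \<Omega> (\<Union>p\<in>F. frontier \<Omega> \<inter> cball p (r p))" using F(2,1)
  proof induction
    case empty
    show ?case unfolding local_trace_bound_def by (intro exI[of _ 1] conjI exI[of _ 0]) auto
  next
    case (insert p F)
    then have "(\<Union>p\<in>F. frontier \<Omega> \<inter> cball p (r p)) \<in> sets (bdry_measure \<Omega>)"
      by (intro sets.finite_UN borel_Int_frontier_in_bdry) auto
    then show ?case using local_trace_bound_Un[of \<Omega> "frontier \<Omega> \<inter> cball p (r p)"] insert r
      by (simp add: borel_Int_frontier_in_bdry)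
  qed
  moreover have "(\<Union>p\<in>F. frontier \<Omega> \<inter> cball p (r p)) = frontier \<Omega>"
    using F(3) by (force simp: subset_eq)
  ultimately show ?thesis by simp
qed

lemma C1_trace_inequality:
  fixes \<Omega> :: "(real^'n) set"
  assumes \<Omega>: "lipschitz_domain \<Omega>" and \<epsilon>: "\<epsilon> > 0"
  obtains K where "K \<ge> 0" "\<And>\<phi> D. C1_with \<phi> D \<Longrightarrow>
    (\<integral>\<^sup>+x. ennreal ((cmod (\<phi> x))\<^sup>2) \<partial>bdry_measure \<Omega>)
      \<le> ennreal \<epsilon> * energy \<Omega> D + ennreal K * (\<integral>\<^sup>+x\<in>\<Omega>. ennreal ((cmod (\<phi> x))\<^sup>2) \<partial>lborel)"
proof -
  obtain d0 C where 1: "d0 > 0" "C \<ge> 0" "\<And>d. 0 < d \<Longrightarrow> d \<le> d0 \<Longrightarrow> \<exists>S. compact S \<and> S \<subseteq> \<Omega> \<and>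
     (\<forall>\<phi> D c. C1_with \<phi> D \<longrightarrow> (\<integral>\<^sup>+x\<in>frontier \<Omega>. ennreal ((cmod (\<phi> x - c))\<^sup>2) \<partial>bdry_measure \<Omega>)
       \<le> ennreal (C * d) * energy \<Omega> D + ennreal (C / d) * (\<integral>\<^sup>+y\<in>S. ennreal ((cmod (\<phi> y - c))\<^sup>2) \<partial>lborel))"
    using local_trace_bound_frontier[OF \<Omega>] unfolding local_trace_bound_def by blast
  \<comment> \<open>Makes the gradient coefficient \<open>C * d\<close> at most \<epsilon>; the
    denominator \<open>C + 1\<close> stays positive when \<open>C = 0\<close>.\<close>
  define d where "d = min d0 (\<epsilon> / (C + 1))"
  have d: "0 < d" "d \<le> d0" unfolding d_def using 1 \<epsilon> by auto
  have "C * d \<le> (C + 1) * (\<epsilon> / (C + 1))" unfolding d_def using 1(1,2) \<epsilon> by (intro mult_mono) auto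
  then have Cd: "C * d \<le> \<epsilon>" using 1(2) by simp
  obtain S where S: "S \<subseteq> \<Omega>" "\<And>\<phi> D c. C1_with \<phi> D \<Longrightarrow> (\<integral>\<^sup>+x\<in>frontier \<Omega>. ennreal ((cmod (\<phi> x - c))\<^sup>2) \<partial>bdry_measure \<Omega>)
       \<le> ennreal (C * d) * energy \<Omega> D + ennreal (C / d) * (\<integral>\<^sup>+y\<in>S. ennreal ((cmod (\<phi> y - c))\<^sup>2) \<partial>lborel)"
    using 1(3)[OF d] by blast
  show ?thesis
  proof (rule that[of "C / d"])
    show "C / d \<ge> 0" using 1 d by simp
    fix \<phi> and D :: "real^'n \<Rightarrow> complex^'n" assume phi: "C1_with \<phi> D"
    have "(\<integral>\<^sup>+x. ennreal ((cmod (\<phi> x))\<^sup>2) \<partial>bdry_measure \<Omega>) = (\<integral>\<^sup>+x\<in>frontier \<Omega>. ennreal ((cmod (\<phi> x - 0))\<^sup>2) \<partial>bdry_measure \<Omega>)"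
      by (intro nn_integral_cong) simp
    also note S(2)[OF phi, of 0]
    also have "ennreal (C * d) * energy \<Omega> D + ennreal (C / d) * (\<integral>\<^sup>+y\<in>S. ennreal ((cmod (\<phi> y - 0))\<^sup>2) \<partial>lborel)
      \<le> ennreal \<epsilon> * energy \<Omega> D + ennreal (C / d) * (\<integral>\<^sup>+x\<in>\<Omega>. ennreal ((cmod (\<phi> x))\<^sup>2) \<partial>lborel)"
      using Cd nn_set_integral_set_mono[OF S(1), of lborel "\<lambda>x. ennreal ((cmod (\<phi> x))\<^sup>2)"]
      by (intro add_mono mult_right_mono mult_left_mono ennreal_leI) auto
    finally show "(\<integral>\<^sup>+x. ennreal ((cmod (\<phi> x))\<^sup>2) \<partial>bdry_measure \<Omega>)
      \<le> ennreal \<epsilon> * energy \<Omega> D + ennreal (C / d) * (\<integral>\<^sup>+x\<in>\<Omega>. ennreal ((cmod (\<phi> x))\<^sup>2) \<partial>lborel)" .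
  qed
qed

text \<open>The slab estimate at the fixed thickness \<open>d0\<close>, with the reference value of
  the interior oscillation bound inserted for the constant. The slab is a compact subset of
  \<Omega>, so its integral is again a multiple of the energy.\<close>

lemma C1_boundary_poincare:
  fixes \<Omega> :: "(real^'n) set"
  assumes \<Omega>: "lipschitz_domain \<Omega>"
  obtains C where "C \<ge> 0" "\<And>\<phi> D. C1_with \<phi> D \<Longrightarrow>
    \<exists>c. (\<integral>\<^sup>+x. ennreal ((cmod (\<phi> x - c))\<^sup>2) \<partial>bdry_measure \<Omega>) \<le> ennreal C * energy \<Omega> D"
proof -
  obtain c where c: "\<And>K. compact K \<Longrightarrow> K \<subseteq> \<Omega> \<Longrightarrow> osc_bound \<Omega> c lborel K"
    using osc_bound_compact_subsets[of \<Omega>] \<Omega> unfolding lipschitz_domain_def by metis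
  obtain d0 C where 1: "d0 > 0" "C \<ge> 0" "\<And>d. 0 < d \<Longrightarrow> d \<le> d0 \<Longrightarrow> \<exists>S. compact S \<and> S \<subseteq> \<Omega> \<and>
     (\<forall>\<phi> D c. C1_with \<phi> D \<longrightarrow> (\<integral>\<^sup>+x\<in>frontier \<Omega>. ennreal ((cmod (\<phi> x - c))\<^sup>2) \<partial>bdry_measure \<Omega>)
       \<le> ennreal (C * d) * energy \<Omega> D + ennreal (C / d) * (\<integral>\<^sup>+y\<in>S. ennreal ((cmod (\<phi> y - c))\<^sup>2) \<partial>lborel))"
    using local_trace_bound_frontier[OF \<Omega>] unfolding local_trace_bound_def by blast
  obtain S where S: "compact S" "S \<subseteq> \<Omega>" "\<And>\<phi> D c. C1_with \<phi> D \<Longrightarrow> (\<integral>\<^sup>+x\<in>frontier \<Omega>. ennreal ((cmod (\<phi> x - c))\<^sup>2) \<partial>bdry_measure \<Omega>)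
       \<le> ennreal (C * d0) * energy \<Omega> D + ennreal (C / d0) * (\<integral>\<^sup>+y\<in>S. ennreal ((cmod (\<phi> y - c))\<^sup>2) \<partial>lborel)"
    using 1(3)[of d0] 1(1) by auto
  obtain K where K: "K \<ge> 0" "\<And>\<phi> D. C1_with \<phi> D \<Longrightarrow>
     (\<integral>\<^sup>+x\<in>S. ennreal ((cmod (\<phi> x - c \<phi> D))\<^sup>2) \<partial>lborel) \<le> ennreal K * energy \<Omega> D"
    using c[OF S(1,2)] unfolding osc_bound_def by auto
  show ?thesis
  proof (rule that[of "C * d0 + C / d0 * K"])
    show "0 \<le> C * d0 + C / d0 * K" using 1 K by simp
    fix \<phi> and D :: "real^'n \<Rightarrow> complex^'n" assume phi: "C1_with \<phi> D"
    have "(\<integral>\<^sup>+x. ennreal ((cmod (\<phi> x - c \<phi> D))\<^sup>2) \<partial>bdry_measure \<Omega>) = (\<integral>\<^sup>+x\<in>frontier \<Omega>. ennreal ((cmod (\<phi> x - c \<phi> D))\<^sup>2) \<partial>bdry_measure \<Omega>)"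
      by (intro nn_integral_cong) simp
    also note S(3)[OF phi]
    also have "ennreal (C * d0) * energy \<Omega> D + ennreal (C / d0) * (\<integral>\<^sup>+y\<in>S. ennreal ((cmod (\<phi> y - c \<phi> D))\<^sup>2) \<partial>lborel)
      \<le> ennreal (C * d0) * energy \<Omega> D + ennreal (C / d0) * (ennreal K * energy \<Omega> D)"
      by (intro add_left_mono mult_left_mono K(2) phi) simp
    also have "\<dots> = ennreal (C * d0 + C / d0 * K) * energy \<Omega> D"
    proof -
      have "ennreal (C * d0 + C / d0 * K) = ennreal (C * d0) + ennreal (C / d0) * ennreal K"
        using 1 K by (subst ennreal_plus) (auto simp: ennreal_mult'[symmetric])
      then show ?thesis by (simp add: distrib_right mult.assoc)
    qed
    finally show "\<exists>c. (\<integral>\<^sup>+x. ennreal ((cmod (\<phi> x - c))\<^sup>2) \<partial>bdry_measure \<Omega>) \<le> ennreal (C * d0 + C / d0 * K) * energy \<Omega> D"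
      by blast
  qed
qed

section \<open>Square integrable functions\<close>

lemma L2_measurable: "f \<in> L2 M \<Longrightarrow> f \<in> borel_measurable M"
  by (simp add: L2_def)

lemma L2_integrable_square: "f \<in> L2 M \<Longrightarrow> integrable M (\<lambda>x. (cmod (f x))\<^sup>2)"
  by (simp add: L2_def)

lemma l2norm_nonneg [simp]: "0 \<le> l2norm M f"
  by (simp add: l2norm_def)

lemma l2norm_square: "(l2norm M f)\<^sup>2 = (LINT x|M. (cmod (f x))\<^sup>2)"
  by (simp add: l2norm_def)

lemma L2_I_bounded:
  assumes "finite_measure M" "f \<in> borel_measurable M" "\<And>x. x \<in> space M \<Longrightarrow> cmod (f x) \<le> b"
  shows "f \<in> L2 M"
proof -
  interpret finite_measure M by fact
  have "AE x in M. norm ((cmod (f x))\<^sup>2) \<le> b\<^sup>2"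
    using assms(3) by (intro AE_I2) (auto intro: power_mono)
  then show ?thesis using assms(2) unfolding L2_def by (auto intro!: integrable_const_bound)
qed

lemma nn_integral_eq_l2norm:
  "f \<in> L2 M \<Longrightarrow> (\<integral>\<^sup>+x. ennreal ((cmod (f x))\<^sup>2) \<partial>M) = ennreal ((l2norm M f)\<^sup>2)"
  unfolding l2norm_square by (intro nn_integral_eq_integral) (auto simp: L2_def)

lemma L2_lincomb:
  assumes f: "f \<in> L2 M" and g: "g \<in> L2 M"
  shows "(\<lambda>x. f x + c * g x) \<in> L2 M"
proof -
  have [measurable]: "f \<in> borel_measurable M" "g \<in> borel_measurable M" using assms by (auto simp: L2_def)
  have "integrable M (\<lambda>x. 2 * (cmod (f x))\<^sup>2 + 2 * ((cmod c)\<^sup>2 * (cmod (g x))\<^sup>2))"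
    using assms by (auto simp: L2_def)
  then have "integrable M (\<lambda>x. (cmod (f x + c * g x))\<^sup>2)"
  proof (rule Bochner_Integration.integrable_bound)
    show "AE x in M. norm ((cmod (f x + c * g x))\<^sup>2) \<le> norm (2 * (cmod (f x))\<^sup>2 + 2 * ((cmod c)\<^sup>2 * (cmod (g x))\<^sup>2))"
    proof (rule AE_I2)
      fix x
      have "(cmod (f x + c * g x))\<^sup>2 \<le> (cmod (f x) + cmod c * cmod (g x))\<^sup>2"
        by (intro power_mono order_trans[OF norm_triangle_ineq]) (auto simp: norm_mult)
      also have "\<dots> \<le> 2 * (cmod (f x))\<^sup>2 + 2 * ((cmod c)\<^sup>2 * (cmod (g x))\<^sup>2)"
        using zero_le_power2[of "cmod (f x) - cmod c * cmod (g x)"] by (simp add: power2_eq_square algebra_simps)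
      finally show "norm ((cmod (f x + c * g x))\<^sup>2) \<le> norm (2 * (cmod (f x))\<^sup>2 + 2 * ((cmod c)\<^sup>2 * (cmod (g x))\<^sup>2))"
        by simp
    qed
  qed measurable
  then show ?thesis by (simp add: L2_def)
qed

lemma L2_zero: "(\<lambda>_. 0) \<in> L2 M" by (simp add: L2_def)

lemma L2_cmult: "f \<in> L2 M \<Longrightarrow> (\<lambda>x. c * f x) \<in> L2 M"
  using L2_lincomb[OF L2_zero, of f M c] by simp

lemma L2_add: "f \<in> L2 M \<Longrightarrow> g \<in> L2 M \<Longrightarrow> (\<lambda>x. f x + g x) \<in> L2 M"
  using L2_lincomb[of f M g 1] by simp

lemma L2_diff: "f \<in> L2 M \<Longrightarrow> g \<in> L2 M \<Longrightarrow> (\<lambda>x. f x - g x) \<in> L2 M"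
  using L2_lincomb[of f M g "-1"] by simp

lemma L2_uminus: "f \<in> L2 M \<Longrightarrow> (\<lambda>x. - f x) \<in> L2 M"
  using L2_cmult[of f M "-1"] by simp

lemma borel_measurable_cnj [measurable]: "cnj \<in> borel_measurable borel"
  by (intro borel_measurable_continuous_onI continuous_intros)

lemma L2_integrable_mult:
  assumes f: "f \<in> L2 M" and g: "g \<in> L2 M"
  shows "integrable M (\<lambda>x. f x * cnj (g x))" "integrable M (\<lambda>x. cmod (f x) * cmod (g x))"
proof -
  have [measurable]: "f \<in> borel_measurable M" "g \<in> borel_measurable M" using assms by (auto simp: L2_def)
  have int: "integrable M (\<lambda>x. (cmod (f x))\<^sup>2 + (cmod (g x))\<^sup>2)" using assms by (auto simp: L2_def)
  have le: "cmod (f x) * cmod (g x) \<le> (cmod (f x))\<^sup>2 + (cmod (g x))\<^sup>2" for x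
  proof -
    have "0 \<le> cmod (f x) * cmod (g x)" by simp
    then show ?thesis using sum_squares_bound[of "cmod (f x)" "cmod (g x)"] by linarith
  qed
  show "integrable M (\<lambda>x. f x * cnj (g x))"
    by (rule Bochner_Integration.integrable_bound[OF int]) (auto simp: norm_mult le intro!: AE_I2)
  show "integrable M (\<lambda>x. cmod (f x) * cmod (g x))"
    by (rule Bochner_Integration.integrable_bound[OF int]) (auto simp: norm_mult le intro!: AE_I2)
qed

text \<open>Discriminant argument: the integral of the square of
  \<open>s * cmod (f x) - cmod (g x)\<close> is a quadratic in \<open>s\<close> that is never
  negative. If its leading coefficient vanishes it is affine, so its slope must vanish too.\<close>

lemma integral_cmod_mult_le:
  assumes f: "f \<in> L2 M" and g: "g \<in> L2 M"
  shows "(LINT x|M. cmod (f x) * cmod (g x)) \<le> l2norm M f * l2norm M g"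
proof -
  define I where "I = (LINT x|M. cmod (f x) * cmod (g x))"
  define a where "a = (l2norm M f)\<^sup>2"
  define b where "b = (l2norm M g)\<^sup>2"
  have I0: "I \<ge> 0" unfolding I_def by (intro integral_nonneg_AE) auto
  have ab: "a \<ge> 0" "b \<ge> 0" unfolding a_def b_def by auto
  have quad: "0 \<le> s\<^sup>2 * a - 2 * s * I + b" for s
  proof -
    have "0 \<le> (LINT x|M. (s * cmod (f x) - cmod (g x))\<^sup>2)" by (intro integral_nonneg_AE) auto
    also have "\<dots> = (LINT x|M. s\<^sup>2 * (cmod (f x))\<^sup>2 - 2 * s * (cmod (f x) * cmod (g x)) + (cmod (g x))\<^sup>2)"
      by (intro Bochner_Integration.integral_cong) (auto simp: power2_eq_square algebra_simps)
    also have "\<dots> = s\<^sup>2 * a - 2 * s * I + b"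
      unfolding a_def b_def I_def l2norm_square
      using L2_integrable_mult(2)[OF f g] L2_integrable_square[OF f] L2_integrable_square[OF g] by simp
    finally show ?thesis .
  qed
  have "I\<^sup>2 \<le> a * b"
  proof (cases "a = 0")
    case True
    have "I = 0"
    proof (rule ccontr)
      assume "I \<noteq> 0"
      then have "I > 0" using I0 by simp
      \<comment> \<open>At this \<open>s\<close> the affine function takes the value -1.\<close>
      then show False using quad[of "(b + 1) / (2 * I)"] True by simp
    qed
    then show ?thesis using ab by simp
  next
    case False
    then have a: "a > 0" using ab by simp
    then have "0 \<le> a * ((I / a)\<^sup>2 * a - 2 * (I / a) * I + b)" using quad[of "I / a"] by simp
    also have "\<dots> = a * b - I\<^sup>2" using a by (simp add: field_simps power2_eq_square)
    finally show ?thesis by simp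
  qed
  also have "a * b = (l2norm M f * l2norm M g)\<^sup>2" by (simp add: a_def b_def power_mult_distrib)
  finally show ?thesis unfolding I_def[symmetric] by (rule power2_le_imp_le) simp
qed

lemma l2inner_Cauchy_Schwarz:
  assumes "f \<in> L2 M" "g \<in> L2 M"
  shows "cmod (l2inner M f g) \<le> l2norm M f * l2norm M g"
proof -
  have "cmod (l2inner M f g) \<le> (LINT x|M. cmod (f x) * cmod (g x))"
    unfolding l2inner_def by (rule order_trans[OF integral_norm_bound]) (simp add: norm_mult)
  then show ?thesis using integral_cmod_mult_le[OF assms] by simp
qed

lemma l2inner_self: "l2inner M f f = complex_of_real ((l2norm M f)\<^sup>2)"
proof -
  have "f x * cnj (f x) = complex_of_real ((cmod (f x))\<^sup>2)" for x using complex_norm_square[of "f x"] by simp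
  then show ?thesis unfolding l2inner_def l2norm_square by (simp only: integral_complex_of_real)
qed

lemma l2inner_lincomb_left:
  assumes "f \<in> L2 M" "g \<in> L2 M" "h \<in> L2 M"
  shows "l2inner M (\<lambda>x. f x + c * g x) h = l2inner M f h + c * l2inner M g h"
  unfolding l2inner_def using assms
  by (simp add: distrib_right mult.assoc L2_integrable_mult)

lemma l2inner_commute: "l2inner M f g = cnj (l2inner M g f)"
proof -
  have "l2inner M f g = (LINT x|M. cnj (g x * cnj (f x)))" unfolding l2inner_def by (simp add: mult.commute)
  then show ?thesis unfolding l2inner_def by (simp only: Bochner_Integration.integral_cnj)
qed

lemma l2inner_lincomb_right:
  assumes "f \<in> L2 M" "g \<in> L2 M" "h \<in> L2 M"
  shows "l2inner M h (\<lambda>x. f x + c * g x) = l2inner M h f + cnj c * l2inner M h g"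
  using l2inner_lincomb_left[OF assms, of c] l2inner_commute[of M h] by simp

lemma l2inner_cong_AE:
  assumes "AE x in M. f x = f' x" "f \<in> borel_measurable M" "f' \<in> borel_measurable M" "g \<in> borel_measurable M"
  shows "l2inner M f g = l2inner M f' g"
proof -
  note [measurable] = assms(2-4)
  show ?thesis unfolding l2inner_def using assms(1)
    by (intro integral_cong_AE) (measurable, auto)
qed

lemma l2norm_lincomb_square:
  assumes "f \<in> L2 M" "g \<in> L2 M"
  shows "(l2norm M (\<lambda>x. f x + c * g x))\<^sup>2
    = (l2norm M f)\<^sup>2 + 2 * Re (c * l2inner M g f) + (cmod c)\<^sup>2 * (l2norm M g)\<^sup>2"
proof -
  have "complex_of_real ((l2norm M (\<lambda>x. f x + c * g x))\<^sup>2)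
      = l2inner M f f + cnj c * l2inner M f g + c * (l2inner M g f + cnj c * l2inner M g g)"
    unfolding l2inner_self[symmetric]
    using assms by (simp add: l2inner_lincomb_left l2inner_lincomb_right L2_lincomb)
  moreover have "cnj c * l2inner M f g = cnj (c * l2inner M g f)"
    using l2inner_commute[of M f g] by simp
  ultimately have "(l2norm M (\<lambda>x. f x + c * g x))\<^sup>2
      = Re (l2inner M f f + cnj (c * l2inner M g f) + c * (l2inner M g f + cnj c * l2inner M g g))"
    by (metis Re_complex_of_real)
  also have "\<dots> = (l2norm M f)\<^sup>2 + 2 * Re (c * l2inner M g f) + (cmod c)\<^sup>2 * (l2norm M g)\<^sup>2"
    by (simp add: l2inner_self) (simp add: cmod_power2 distrib_right, simp add: power2_eq_square algebra_simps)
  finally show ?thesis .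
qed

lemma l2norm_triangle:
  assumes "f \<in> L2 M" "g \<in> L2 M"
  shows "l2norm M (\<lambda>x. f x + g x) \<le> l2norm M f + l2norm M g"
proof -
  have "(l2norm M (\<lambda>x. f x + g x))\<^sup>2 = (l2norm M f)\<^sup>2 + 2 * Re (l2inner M g f) + (l2norm M g)\<^sup>2"
    using l2norm_lincomb_square[OF assms, of 1] by simp
  also have "Re (l2inner M g f) \<le> l2norm M g * l2norm M f"
    using l2inner_Cauchy_Schwarz[OF assms(2,1)] complex_Re_le_cmod order_trans by blast
  finally have "(l2norm M (\<lambda>x. f x + g x))\<^sup>2 \<le> (l2norm M f + l2norm M g)\<^sup>2"
    by (simp add: power2_sum algebra_simps)
  then show ?thesis by (rule power2_le_imp_le) simp
qed

lemma l2norm_cmult: "l2norm M (\<lambda>x. c * f x) = cmod c * l2norm M f"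
  unfolding l2norm_def by (simp add: norm_mult power_mult_distrib real_sqrt_mult)

lemma l2norm_minus_commute: "l2norm M (\<lambda>x. f x - g x) = l2norm M (\<lambda>x. g x - f x)"
  unfolding l2norm_def by (simp add: norm_minus_commute)

lemma l2norm_triangle_diff:
  assumes "f \<in> L2 M" "g \<in> L2 M"
  shows "l2norm M f \<le> l2norm M g + l2norm M (\<lambda>x. f x - g x)"
  using l2norm_triangle[OF assms(2) L2_diff[OF assms]] by simp

lemma tendsto_l2norm:
  assumes "\<And>k. f k \<in> L2 M" "g \<in> L2 M" "(\<lambda>k. l2norm M (\<lambda>x. f k x - g x)) \<longlonglongrightarrow> 0"
  shows "(\<lambda>k. l2norm M (f k)) \<longlonglongrightarrow> l2norm M g"
proof (rule LIM_zero_cancel, rule Lim_null_comparison[OF _ assms(3)], rule always_eventually, rule allI)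
  fix k
  show "norm (l2norm M (f k) - l2norm M g) \<le> l2norm M (\<lambda>x. f k x - g x)"
    using l2norm_triangle_diff[OF assms(1)[of k] assms(2)] l2norm_triangle_diff[OF assms(2) assms(1)[of k]]
      l2norm_minus_commute[of M g "f k"] by simp
qed

lemma l2norm_eq_0_AE:
  assumes "f \<in> L2 M" "l2norm M f = 0" shows "AE x in M. f x = 0"
proof -
  have "(LINT x|M. (cmod (f x))\<^sup>2) = 0" using assms l2norm_square[of M f] by simp
  then have "AE x in M. (cmod (f x))\<^sup>2 = 0"
    using integral_nonneg_eq_0_iff_AE[OF L2_integrable_square[OF assms(1)]] by simp
  then show ?thesis by eventually_elim simp
qed

text \<open>Pythagoras: a function of mean zero is orthogonal to the constants, so subtracting a
  constant cannot reduce its norm.\<close>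

lemma l2norm_le_mean_zero:
  assumes fin: "finite_measure M" and g: "g \<in> L2 M" and mean: "(LINT x|M. g x) = 0"
  shows "l2norm M g \<le> l2norm M (\<lambda>x. g x - c)"
proof -
  interpret finite_measure M by fact
  have one: "(\<lambda>_. 1) \<in> L2 M" by (simp add: L2_def)
  have "l2inner M (\<lambda>_. 1) g = 0" using mean l2inner_commute[of M "\<lambda>_. 1" g] by (simp add: l2inner_def)
  then have "(l2norm M (\<lambda>x. g x + (- c) * 1))\<^sup>2 = (l2norm M g)\<^sup>2 + (cmod c)\<^sup>2 * (l2norm M (\<lambda>_. 1))\<^sup>2"
    using l2norm_lincomb_square[OF g one, of "- c"] by simp
  then have "(l2norm M g)\<^sup>2 \<le> (l2norm M (\<lambda>x. g x - c))\<^sup>2" by simp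
  then show ?thesis by (rule power2_le_imp_le) simp
qed

section \<open>Compactly supported smooth functions\<close>

lemma C1c_grad_zero_outside:
  assumes "C1c_on S \<phi> D" "x \<notin> closure {x. \<phi> x \<noteq> 0}"
  shows "D x = 0"
proof -
  have der: "(\<phi> has_derivative grad_apply (D x)) (at x)"
    using C1c_on_imp_C1_with[OF assms(1)] by (simp add: C1_with_def)
  have op: "open (- closure {x. \<phi> x \<noteq> 0})" by (simp add: open_Compl)
  have eq: "0 = \<phi> y" if "y \<in> - closure {x. \<phi> x \<noteq> 0}" for y
    using that closure_subset[of "{x. \<phi> x \<noteq> 0}"] by auto
  have "(\<phi> has_derivative (\<lambda>_. 0)) (at x)"
    by (rule has_derivative_transform_within_open[OF has_derivative_const op _ eq]) (use assms(2) in simp)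
  then have "grad_apply (D x) = (\<lambda>_. 0)" using der has_derivative_unique by blast
  then have "D x $ i = 0" for i using grad_apply_axis[of "D x" i] by simp
  then show ?thesis by (simp add: vec_eq_iff)
qed

lemma C1c_integrable:
  assumes "C1c_on S \<phi> D"
  shows "integrable lborel \<phi>" "integrable lborel (\<lambda>x. D x $ i)"
proof -
  let ?K = "closure {x. \<phi> x \<noteq> 0}"
  have K: "compact ?K" using assms by (simp add: C1c_on_def)
  have C1: "C1_with \<phi> D" by (rule C1c_on_imp_C1_with[OF assms])
  have Dc: "continuous_on UNIV D" using C1 by (simp add: C1_with_def)
  have "indicator ?K x *\<^sub>R \<phi> x = \<phi> x" for x
    using closure_subset[of "{x. \<phi> x \<noteq> 0}"] by (auto split: split_indicator)
  then show "integrable lborel \<phi>"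
    using borel_integrable_compact[OF K continuous_on_subset[OF C1_with_continuous[OF C1] subset_UNIV]] by simp
  have "indicator ?K x *\<^sub>R (D x $ i) = D x $ i" for x
    using C1c_grad_zero_outside[OF assms, of x] by (auto split: split_indicator)
  moreover have "continuous_on ?K (\<lambda>x. D x $ i)"
    by (intro continuous_intros continuous_on_subset[OF Dc]) auto
  ultimately show "integrable lborel (\<lambda>x. D x $ i)"
    using borel_integrable_compact[OF K, of "\<lambda>x. D x $ i"] by simp
qed

lemma integral_lborel_translate:
  fixes f :: "'a::euclidean_space \<Rightarrow> 'b::{banach, second_countable_topology}"
  assumes "f \<in> borel_measurable borel"
  shows "(LINT x|lborel. f (x + a)) = (LINT x|lborel. f x)"
    and "integrable lborel f \<Longrightarrow> integrable lborel (\<lambda>x. f (x + a))"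
proof -
  have "(LINT x|lborel. f x) = (LINT x|distr lborel borel ((+) a). f x)" by (simp add: lborel_distr_plus)
  also have "\<dots> = (LINT x|lborel. f (x + a))"
    using assms by (subst integral_distr) (auto simp: add.commute)
  finally show "(LINT x|lborel. f (x + a)) = (LINT x|lborel. f x)" by simp
  assume "integrable lborel f"
  then have "integrable (distr lborel borel ((+) a)) f" by (simp add: lborel_distr_plus)
  then show "integrable lborel (\<lambda>x. f (x + a))"
    using assms by (subst (asm) integrable_distr_eq) (auto simp: add.commute)
qed

text \<open>The increment of \<phi> over a unit step along the axis is the integral of the partial
  derivative over that step. Integrated over all space, the increment gives 0 by translation
  invariance, and the other side gives the integral sought. This yields the weak gradient of the
  constant function.\<close>

lemma integral_C1c_grad:
  fixes \<phi> :: "real^'n \<Rightarrow> complex"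
  assumes "C1c_on S \<phi> D"
  shows "(LINT x|lborel. D x $ i) = 0"
proof -
  have C1: "C1_with \<phi> D" by (rule C1c_on_imp_C1_with[OF assms])
  have Dc: "continuous_on UNIV D" using C1 by (simp add: C1_with_def)
  define f where "f = (\<lambda>x. D x $ i)"
  define e :: "real^'n" where "e = axis i 1"
  have fc: "continuous_on UNIV f" unfolding f_def by (intro continuous_intros Dc)
  have [measurable]: "f \<in> borel_measurable borel" by (intro borel_measurable_continuous_onI fc)
  have [measurable]: "\<phi> \<in> borel_measurable borel" by (rule C1_with_borel_measurable[OF C1])
  have fi: "integrable lborel f" unfolding f_def by (rule C1c_integrable[OF assms])
  have \<phi>i: "integrable lborel \<phi>" by (rule C1c_integrable[OF assms])
  define F where "F = (\<lambda>(s::real) x. indicator {0..1} s *\<^sub>R f (x + s *\<^sub>R e))"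
  have [measurable]: "case_prod F \<in> borel_measurable (lborel \<Otimes>\<^sub>M lborel)" unfolding F_def by measurable
  have int: "integrable (lborel \<Otimes>\<^sub>M lborel) (case_prod F)"
  proof (rule lborel_pair.Fubini_integrable)
    have "(LINT x|lborel. norm (F s x)) = indicator {0..1} s *\<^sub>R (LINT x|lborel. norm (f x))" for s
      using integral_lborel_translate(1)[of "\<lambda>x. norm (f x)" "s *\<^sub>R e"] unfolding F_def by simp
    then show "integrable lborel (\<lambda>s. LINT x|lborel. norm (case_prod F (s, x)))" by simp
    show "AE s in lborel. integrable lborel (\<lambda>x. case_prod F (s, x))"
      using integral_lborel_translate(2)[OF _ fi] unfolding F_def by simp
  qed measurable
  have inner: "(LINT s|lborel. F s x) = \<phi> (x + e) - \<phi> x" for x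
  proof -
    have "((\<lambda>s. f (x + s *\<^sub>R e)) has_integral (\<phi> (x + e) - \<phi> x)) {0..1}"
      using C1_with_FTC[OF C1, of 1 x e] by (simp add: f_def e_def grad_apply_axis)
    moreover have "continuous_on {0..1} (\<lambda>s. f (x + s *\<^sub>R e))"
      by (rule continuous_on_compose2[OF fc]) (auto intro!: continuous_intros)
    then have "integrable lborel (\<lambda>s. F s x)"
      using borel_integrable_compact[of "{0..1::real}" "\<lambda>s. f (x + s *\<^sub>R e)"] by (simp add: F_def)
    then have "((\<lambda>s. f (x + s *\<^sub>R e)) has_integral (LINT s|lborel. F s x)) {0..1}"
    proof -
      assume "integrable lborel (\<lambda>s. F s x)"
      then have "((\<lambda>s. F s x) has_integral (LINT s|lborel. F s x)) UNIV"
        by (rule has_integral_integral_lborel)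
      moreover have "(\<lambda>s. F s x) = (\<lambda>s. if s \<in> {0..1} then f (x + s *\<^sub>R e) else 0)"
        unfolding F_def by (auto split: split_indicator)
      ultimately show ?thesis by (simp only: has_integral_restrict_UNIV)
    qed
    ultimately show ?thesis using has_integral_unique by blast
  qed
  have "(LINT x|lborel. f x) = (LINT s|lborel. (LINT x|lborel. F s x))"
  proof -
    have "(LINT x|lborel. F s x) = indicator {0..1} s *\<^sub>R (LINT x|lborel. f x)" for s
      using integral_lborel_translate(1)[of f "s *\<^sub>R e"] unfolding F_def by simp
    then show ?thesis by simp
  qed
  also have "\<dots> = (LINT x|lborel. (LINT s|lborel. F s x))"
    using lborel_pair.Fubini_integral[OF int] by simp
  also have "\<dots> = (LINT x|lborel. \<phi> (x + e)) - (LINT x|lborel. \<phi> x)"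
    unfolding inner using \<phi>i integral_lborel_translate(2)[OF _ \<phi>i] by simp
  also have "\<dots> = 0" using integral_lborel_translate(1)[of \<phi> e] by simp
  finally show ?thesis unfolding f_def .
qed

text \<open>The square of the positive part is continuously differentiable also at 0; two such
  squares, nested, make up the cutoff.\<close>

lemma max_square_has_derivative:
  "((\<lambda>s::real. (max 0 s)\<^sup>2) has_real_derivative 2 * max 0 s) (at s)"
proof -
  consider "s > 0" | "s < 0" | "s = 0" by linarith
  then show ?thesis
  proof cases
    case 1
    have "((\<lambda>s::real. s\<^sup>2) has_real_derivative 2 * s) (at s)" by (auto intro!: derivative_eq_intros)
    then have "((\<lambda>s::real. (max 0 s)\<^sup>2) has_real_derivative 2 * s) (at s)"
      by (rule DERIV_cong_ev[THEN iffD1, rotated -1])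
         (use 1 in \<open>auto intro!: eventually_mono[OF eventually_nhds_in_open[of "{0<..}" s]]\<close>)
    then show ?thesis using 1 by simp
  next
    case 2
    have "((\<lambda>s::real. 0) has_real_derivative 0) (at s)" by simp
    then have "((\<lambda>s::real. (max 0 s)\<^sup>2) has_real_derivative 0) (at s)"
      by (rule DERIV_cong_ev[THEN iffD1, rotated -1])
         (use 2 in \<open>auto intro!: eventually_mono[OF eventually_nhds_in_open[of "{..<0}" s]]\<close>)
    then show ?thesis using 2 by simp
  next
    case 3
    have "(\<lambda>h::real. (max 0 h)\<^sup>2 / h) \<midarrow>0\<rightarrow> 0"
    proof (rule Lim_null_comparison)
      show "\<forall>\<^sub>F h::real in at 0. norm ((max 0 h)\<^sup>2 / h) \<le> \<bar>h\<bar>"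
        by (intro always_eventually allI) (auto simp: max_def power2_eq_square)
      show "(\<lambda>h::real. \<bar>h\<bar>) \<midarrow>0\<rightarrow> 0" by (intro tendsto_eq_intros) auto
    qed
    then show ?thesis using 3 by (simp add: DERIV_def)
  qed
qed

text \<open>With \<open>q\<close> the excess of the squared norm over \<open>r\<^sup>2\<close>, the
  cutoff is the squared positive part of one minus the squared positive part of \<open>q\<close>. It
  is 1 with zero gradient where \<open>q\<close> is at most 0, which contains the closure of
  \<Omega>, and vanishes where \<open>q\<close> is at least 1.\<close>

lemma C1c_cutoff:
  fixes \<Omega> :: "(real^'n) set"
  assumes "bounded \<Omega>"
  obtains \<phi> D where "C1c_on UNIV \<phi> D" "\<And>x. x \<in> closure \<Omega> \<Longrightarrow> \<phi> x = 1 \<and> D x = 0"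
proof -
  have "bounded (closure \<Omega>)" using assms by (simp add: bounded_closure)
  then obtain r where r: "\<And>x. x \<in> closure \<Omega> \<Longrightarrow> norm x \<le> r" by (meson bounded_iff)
  define q where "q = (\<lambda>x::real^'n. x \<bullet> x - r\<^sup>2)"
  define p where "p = (\<lambda>x. 1 - (max 0 (q x))\<^sup>2)"
  define c where "c = (\<lambda>x. 2 * max 0 (p x) * (- (2 * max 0 (q x))) * 2)"
  define \<phi> where "\<phi> = (\<lambda>x. complex_of_real ((max 0 (p x))\<^sup>2))"
  define D where "D = (\<lambda>x::real^'n. (\<chi> i. complex_of_real (c x * x $ i)))"
  have q: "(q has_derivative (\<lambda>h. 2 * (x \<bullet> h))) (at x)" for x
    unfolding q_def by (auto intro!: derivative_eq_intros simp: inner_commute)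
  have p: "(p has_derivative (\<lambda>h. - (2 * max 0 (q x) * (2 * (x \<bullet> h))))) (at x)" for x
    unfolding p_def
    using has_derivative_diff[OF has_derivative_const[of 1]
        has_derivative_compose[OF q max_square_has_derivative[of "q x", unfolded has_field_derivative_def]]]
    by simp
  have "(\<phi> has_derivative (\<lambda>h. complex_of_real (2 * max 0 (p x) * (- (2 * max 0 (q x) * (2 * (x \<bullet> h))))))) (at x)" for x
    unfolding \<phi>_def
    by (intro bounded_linear.has_derivative[OF bounded_linear_of_real]
        has_derivative_compose[OF p max_square_has_derivative[of "p x", unfolded has_field_derivative_def]])
  moreover have "(\<Sum>i\<in>UNIV. complex_of_real (h $ i) * D x $ i)
      = complex_of_real (2 * max 0 (p x) * (- (2 * max 0 (q x) * (2 * (x \<bullet> h)))))" for x h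
    unfolding D_def c_def inner_vec_def by (simp add: sum_distrib_left mult_ac sum_negf)
  ultimately have der: "(\<phi> has_derivative (\<lambda>h. \<Sum>i\<in>UNIV. complex_of_real (h $ i) * D x $ i)) (at x)" for x
    by simp
  have qc: "continuous_on UNIV q" unfolding q_def by (intro continuous_intros)
  have pc: "continuous_on UNIV p" unfolding p_def by (intro continuous_intros qc)
  have Dc: "continuous_on UNIV D" unfolding D_def c_def
    by (intro continuous_intros pc qc)
  have "{x. \<phi> x \<noteq> 0} \<subseteq> cball 0 (\<bar>r\<bar> + 1)"
  proof
    fix x assume "x \<in> {x. \<phi> x \<noteq> 0}"
    then have "p x > 0" unfolding \<phi>_def by (auto simp: max_def split: if_splits)
    then have "(max 0 (q x))\<^sup>2 < 1" unfolding p_def by simp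
    then have "max 0 (q x) < 1" by (simp add: power_less_one_iff)
    then have "(norm x)\<^sup>2 < 1 + r\<^sup>2" unfolding q_def by (simp add: dot_square_norm)
    also have "\<dots> \<le> (\<bar>r\<bar> + 1)\<^sup>2" by (simp add: power2_eq_square algebra_simps)
    finally have "norm x < \<bar>r\<bar> + 1" by (rule power_less_imp_less_base) simp
    then show "x \<in> cball 0 (\<bar>r\<bar> + 1)" by simp
  qed
  then have "compact (closure {x. \<phi> x \<noteq> 0})"
    by (metis bounded_subset bounded_cball compact_closure)
  then have "C1c_on UNIV \<phi> D" unfolding C1c_on_def using der Dc by simp
  moreover have "\<phi> x = 1 \<and> D x = 0" if "x \<in> closure \<Omega>" for x
  proof -
    have "q x \<le> 0" unfolding q_def using r[OF that] by (simp add: dot_square_norm power_mono)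
    then have "max 0 (q x) = 0" by simp
    then show ?thesis unfolding \<phi>_def D_def c_def p_def by (simp add: vec_eq_iff)
  qed
  ultimately show ?thesis using that by blast
qed

section \<open>Sobolev functions with gradient and trace\<close>

lemma borel_imp_lebesgue_on_measurable:
  "f \<in> borel_measurable borel \<Longrightarrow> f \<in> borel_measurable (lebesgue_on \<Omega>)"
  by (intro measurable_restrict_space1 measurable_completion) simp

lemma nn_integral_lebesgue_on_borel:
  fixes f :: "'a::euclidean_space \<Rightarrow> ennreal"
  assumes "f \<in> borel_measurable borel" "\<Omega> \<in> sets borel"
  shows "(\<integral>\<^sup>+x. f x \<partial>lebesgue_on \<Omega>) = (\<integral>\<^sup>+x\<in>\<Omega>. f x \<partial>lborel)"
  using assms by (subst nn_integral_restrict_space) (auto simp: nn_integral_completion)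

lemma integral_lebesgue_on_borel:
  fixes f :: "'a::euclidean_space \<Rightarrow> 'b::{banach, second_countable_topology}"
  assumes [measurable]: "f \<in> borel_measurable borel" "\<Omega> \<in> sets borel"
  shows "(LINT x|lebesgue_on \<Omega>. f x) = (LINT x|lborel. indicator \<Omega> x *\<^sub>R f x)"
proof -
  have "(LINT x|lebesgue_on \<Omega>. f x) = (LINT x|lebesgue. indicator \<Omega> x *\<^sub>R f x)"
    by (subst integral_restrict_space) auto
  also have "\<dots> = (LINT x|lborel. indicator \<Omega> x *\<^sub>R f x)"
    by (rule integral_completion) measurable
  finally show ?thesis .
qed

lemma finite_measure_lebesgue_on_bounded:
  assumes "bounded \<Omega>" "open \<Omega>" shows "finite_measure (lebesgue_on \<Omega>)"
proof (rule finite_measureI)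
  have "\<Omega> \<in> lmeasurable" using assms by (simp add: lmeasurable_open)
  then show "emeasure (lebesgue_on \<Omega>) (space (lebesgue_on \<Omega>)) \<noteq> \<infinity>"
    using fmeasurableD2[of \<Omega> lebesgue] by (simp add: emeasure_restrict_space fmeasurableD del: emeasure_completion)
qed

text \<open>The real counterpart of \<open>energy\<close>, taken over Lebesgue measure so that it
  also applies to weak gradients.\<close>

definition grad_sq :: "(real^'n) set \<Rightarrow> (real^'n \<Rightarrow> complex^'n) \<Rightarrow> real" where
  "grad_sq \<Omega> w = (\<Sum>i\<in>UNIV. (l2norm (lebesgue_on \<Omega>) (\<lambda>x. w x $ i))\<^sup>2)"

lemma grad_sq_nonneg: "0 \<le> grad_sq \<Omega> w"
  unfolding grad_sq_def by (intro sum_nonneg) auto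

section \<open>Real norm inequalities for smooth functions\<close>

context
  fixes \<Omega> :: "(real^'n) set"
  assumes lip: "lipschitz_domain \<Omega>"
begin

lemma open_domain: "open \<Omega>" and bounded_domain: "bounded \<Omega>"
  using lip by (auto simp: lipschitz_domain_def)

lemma finite_lebesgue_on_domain: "finite_measure (lebesgue_on \<Omega>)"
  by (rule finite_measure_lebesgue_on_bounded[OF bounded_domain open_domain])

lemma C1_L2:
  assumes C1: "C1_with \<phi> D"
  shows "\<phi> \<in> L2 (lebesgue_on \<Omega>)" "(\<lambda>x. D x $ i) \<in> L2 (lebesgue_on \<Omega>)" "\<phi> \<in> L2 (bdry_measure \<Omega>)"
proof -
  have c: "compact (closure \<Omega>)" using bounded_domain by (simp add: compact_closure)
  have \<phi>: "continuous_on UNIV \<phi>" by (rule C1_with_continuous[OF C1])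
  have D: "continuous_on UNIV (\<lambda>x. D x $ i)" using C1 unfolding C1_with_def by (intro continuous_intros) auto
  have "bounded (\<phi> ` closure \<Omega>)" "bounded ((\<lambda>x. D x $ i) ` closure \<Omega>)"
    by (intro compact_imp_bounded compact_continuous_image continuous_on_subset[OF \<phi>] continuous_on_subset[OF D] c; simp)+
  then obtain b1 b2 where b: "\<And>x. x \<in> closure \<Omega> \<Longrightarrow> cmod (\<phi> x) \<le> b1" "\<And>x. x \<in> closure \<Omega> \<Longrightarrow> cmod (D x $ i) \<le> b2"
    by (auto simp: bounded_iff)
  have \<Omega>c: "x \<in> closure \<Omega>" if "x \<in> \<Omega>" for x using that closure_subset by blast
  show "\<phi> \<in> L2 (lebesgue_on \<Omega>)"
    by (rule L2_I_bounded[OF finite_lebesgue_on_domain, of _ b1])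
       (use b \<Omega>c in \<open>auto intro!: borel_imp_lebesgue_on_measurable borel_measurable_continuous_onI \<phi>\<close>)
  show "(\<lambda>x. D x $ i) \<in> L2 (lebesgue_on \<Omega>)"
    by (rule L2_I_bounded[OF finite_lebesgue_on_domain, of _ b2])
       (use b \<Omega>c in \<open>auto intro!: borel_imp_lebesgue_on_measurable borel_measurable_continuous_onI D\<close>)
  show "\<phi> \<in> L2 (bdry_measure \<Omega>)"
    by (rule L2_I_bounded[OF finite_measure_bdry[OF lip], of _ b1])
       (use b in \<open>auto intro!: borel_imp_bdry_measurable borel_measurable_continuous_onI \<phi> simp: frontier_def\<close>)
qed

lemma energy_eq_grad_sq:
  assumes C1: "C1_with \<phi> D"
  shows "energy \<Omega> D = ennreal (grad_sq \<Omega> D)"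
proof -
  have [measurable]: "(\<lambda>x. D x $ i) \<in> borel_measurable borel" for i
    using C1 unfolding C1_with_def by (intro borel_measurable_continuous_onI continuous_intros) auto
  have "energy \<Omega> D = (\<integral>\<^sup>+x. ennreal ((norm (D x))\<^sup>2) \<partial>lebesgue_on \<Omega>)"
    unfolding energy_def using open_domain borel_measurable_norm_D[OF C1]
    by (intro nn_integral_lebesgue_on_borel[symmetric]) auto
  also have "\<dots> = (\<integral>\<^sup>+x. (\<Sum>i\<in>UNIV. ennreal ((cmod (D x $ i))\<^sup>2)) \<partial>lebesgue_on \<Omega>)"
    by (intro nn_integral_cong) (simp add: norm_vec_def L2_set_def sum_nonneg)
  also have "\<dots> = (\<Sum>i\<in>UNIV. \<integral>\<^sup>+x. ennreal ((cmod (D x $ i))\<^sup>2) \<partial>lebesgue_on \<Omega>)"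
    by (intro nn_integral_sum borel_imp_lebesgue_on_measurable) measurable
  also have "\<dots> = ennreal (grad_sq \<Omega> D)"
    using C1_L2(2)[OF C1] by (simp add: nn_integral_eq_l2norm grad_sq_def)
  finally show ?thesis .
qed

lemma C1_norms_trace:
  assumes \<epsilon>: "\<epsilon> > 0"
  obtains K where "K \<ge> 0" "\<And>\<phi> D. C1_with \<phi> D \<Longrightarrow>
    (l2norm (bdry_measure \<Omega>) \<phi>)\<^sup>2 \<le> \<epsilon> * grad_sq \<Omega> D + K * (l2norm (lebesgue_on \<Omega>) \<phi>)\<^sup>2"
proof -
  obtain K where K: "K \<ge> 0" "\<And>\<phi> D. C1_with \<phi> D \<Longrightarrow>
    (\<integral>\<^sup>+x. ennreal ((cmod (\<phi> x))\<^sup>2) \<partial>bdry_measure \<Omega>)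
      \<le> ennreal \<epsilon> * energy \<Omega> D + ennreal K * (\<integral>\<^sup>+x\<in>\<Omega>. ennreal ((cmod (\<phi> x))\<^sup>2) \<partial>lborel)"
    using C1_trace_inequality[OF lip \<epsilon>] by blast
  show ?thesis
  proof (rule that[OF K(1)])
    fix \<phi> and D :: "real^'n \<Rightarrow> complex^'n" assume C1: "C1_with \<phi> D"
    have [measurable]: "\<phi> \<in> borel_measurable borel" by (rule C1_with_borel_measurable[OF C1])
    have "(\<integral>\<^sup>+x\<in>\<Omega>. ennreal ((cmod (\<phi> x))\<^sup>2) \<partial>lborel) = ennreal ((l2norm (lebesgue_on \<Omega>) \<phi>)\<^sup>2)"
      using open_domain by (subst nn_integral_lebesgue_on_borel[symmetric]) (auto simp: nn_integral_eq_l2norm C1_L2[OF C1])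
    then have "ennreal ((l2norm (bdry_measure \<Omega>) \<phi>)\<^sup>2)
        \<le> ennreal \<epsilon> * ennreal (grad_sq \<Omega> D) + ennreal K * ennreal ((l2norm (lebesgue_on \<Omega>) \<phi>)\<^sup>2)"
      using K(2)[OF C1] by (simp add: nn_integral_eq_l2norm C1_L2[OF C1] energy_eq_grad_sq[OF C1])
    also have "\<dots> = ennreal (\<epsilon> * grad_sq \<Omega> D + K * (l2norm (lebesgue_on \<Omega>) \<phi>)\<^sup>2)"
      using \<epsilon> K(1) grad_sq_nonneg[of \<Omega> D] by (simp add: ennreal_mult)
    finally show "(l2norm (bdry_measure \<Omega>) \<phi>)\<^sup>2 \<le> \<epsilon> * grad_sq \<Omega> D + K * (l2norm (lebesgue_on \<Omega>) \<phi>)\<^sup>2"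
      using \<epsilon> K(1) grad_sq_nonneg[of \<Omega> D] by (subst (asm) ennreal_le_iff) auto
  qed
qed

lemma C1_norms_poincare:
  obtains C where "C \<ge> 0" "\<And>\<phi> D. C1_with \<phi> D \<Longrightarrow>
    \<exists>c. (l2norm (bdry_measure \<Omega>) (\<lambda>x. \<phi> x - c))\<^sup>2 \<le> C * grad_sq \<Omega> D"
proof -
  obtain C where C: "C \<ge> 0" "\<And>\<phi> D. C1_with \<phi> D \<Longrightarrow>
    \<exists>c. (\<integral>\<^sup>+x. ennreal ((cmod (\<phi> x - c))\<^sup>2) \<partial>bdry_measure \<Omega>) \<le> ennreal C * energy \<Omega> D"
    using C1_boundary_poincare[OF lip] by blast
  interpret finite_measure "bdry_measure \<Omega>" by (rule finite_measure_bdry[OF lip])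
  show ?thesis
  proof (rule that[OF C(1)])
    fix \<phi> and D :: "real^'n \<Rightarrow> complex^'n" assume C1: "C1_with \<phi> D"
    obtain c where c: "(\<integral>\<^sup>+x. ennreal ((cmod (\<phi> x - c))\<^sup>2) \<partial>bdry_measure \<Omega>) \<le> ennreal C * energy \<Omega> D"
      using C(2)[OF C1] by blast
    have "(\<lambda>x. \<phi> x - c) \<in> L2 (bdry_measure \<Omega>)"
      by (intro L2_diff C1_L2[OF C1]) (simp add: L2_def)
    then have "ennreal ((l2norm (bdry_measure \<Omega>) (\<lambda>x. \<phi> x - c))\<^sup>2) \<le> ennreal (C * grad_sq \<Omega> D)"
      using c C(1) grad_sq_nonneg[of \<Omega> D] by (simp add: nn_integral_eq_l2norm energy_eq_grad_sq[OF C1] ennreal_mult)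
    then show "\<exists>c. (l2norm (bdry_measure \<Omega>) (\<lambda>x. \<phi> x - c))\<^sup>2 \<le> C * grad_sq \<Omega> D"
      using C(1) grad_sq_nonneg[of \<Omega> D] by (auto simp: ennreal_le_iff)
  qed
qed

end

text \<open>\<open>trace_rel\<close> with its gradient made visible. One sequence of smooth
  functions approximates the function, this particular gradient and the trace simultaneously, so
  inequalities relating all three pass to the limit; the convergences are listed separately instead
  of as a sum of norms.\<close>

definition h1_triple :: "(real^'n) set \<Rightarrow> (real^'n \<Rightarrow> complex) \<Rightarrow> (real^'n \<Rightarrow> complex^'n) \<Rightarrow> (real^'n \<Rightarrow> complex) \<Rightarrow> bool" where
  "h1_triple \<Omega> u w g \<longleftrightarrow> weak_grad \<Omega> u w \<and> g \<in> L2 (bdry_measure \<Omega>) \<and>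
     (\<exists>\<phi>s Ds. (\<forall>k. C1c_on UNIV (\<phi>s k) (Ds k)) \<and>
        (\<lambda>k. l2norm (lebesgue_on \<Omega>) (\<lambda>x. \<phi>s k x - u x)) \<longlonglongrightarrow> 0 \<and>
        (\<forall>i. (\<lambda>k. l2norm (lebesgue_on \<Omega>) (\<lambda>x. Ds k x $ i - w x $ i)) \<longlonglongrightarrow> 0) \<and>
        (\<lambda>k. l2norm (bdry_measure \<Omega>) (\<lambda>x. \<phi>s k x - g x)) \<longlonglongrightarrow> 0)"

lemma sum_tendsto_zero_iff:
  fixes f :: "nat \<Rightarrow> real" and h :: "'i::finite \<Rightarrow> nat \<Rightarrow> real"
  assumes "\<And>k. 0 \<le> f k" "\<And>i k. 0 \<le> h i k"
  shows "(\<lambda>k. f k + (\<Sum>i\<in>UNIV. h i k)) \<longlonglongrightarrow> 0 \<longleftrightarrow> f \<longlonglongrightarrow> 0 \<and> (\<forall>i. h i \<longlonglongrightarrow> 0)"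
proof (intro iffI conjI allI)
  assume lim: "(\<lambda>k. f k + (\<Sum>i\<in>UNIV. h i k)) \<longlonglongrightarrow> 0"
  have s: "0 \<le> (\<Sum>i\<in>UNIV. h i k)" for k using assms by (simp add: sum_nonneg)
  show "f \<longlonglongrightarrow> 0"
    by (rule Lim_null_comparison[OF _ lim]) (use assms s in auto)
  fix i
  have "h i k \<le> (\<Sum>i\<in>UNIV. h i k)" for k using assms by (intro member_le_sum) auto
  then have "h i k \<le> f k + (\<Sum>i\<in>UNIV. h i k)" for k
    using assms(1)[of k] by (meson add_increasing order_trans)
  then show "h i \<longlonglongrightarrow> 0"
    by (intro Lim_null_comparison[OF _ lim]) (use assms in auto)
next
  assume "f \<longlonglongrightarrow> 0 \<and> (\<forall>i. h i \<longlonglongrightarrow> 0)"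
  then have "(\<lambda>k. f k + (\<Sum>i\<in>UNIV. h i k)) \<longlonglongrightarrow> 0 + (\<Sum>i\<in>(UNIV::'i set). 0)"
    by (intro tendsto_add tendsto_sum) auto
  then show "(\<lambda>k. f k + (\<Sum>i\<in>UNIV. h i k)) \<longlonglongrightarrow> 0" by simp
qed

lemma trace_rel_iff_h1_triple: "trace_rel \<Omega> u g \<longleftrightarrow> (\<exists>w. h1_triple \<Omega> u w g)"
  unfolding trace_rel_def h1_triple_def H1_def
  by (subst sum_tendsto_zero_iff) auto

lemma h1_tripleD:
  assumes "h1_triple \<Omega> u w g"
  shows "weak_grad \<Omega> u w" "g \<in> L2 (bdry_measure \<Omega>)" "u \<in> L2 (lebesgue_on \<Omega>)"
    "(\<lambda>x. w x $ i) \<in> L2 (lebesgue_on \<Omega>)" "trace_rel \<Omega> u g" "u \<in> H1 \<Omega>"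
  using assms unfolding trace_rel_iff_h1_triple by (auto simp: h1_triple_def weak_grad_def H1_def)

lemma h1_tripleE:
  fixes \<Omega> :: "(real^'n) set"
  assumes lip: "lipschitz_domain \<Omega>" and t: "h1_triple \<Omega> u w g"
  obtains \<phi>s Ds where "\<And>k. C1c_on UNIV (\<phi>s k) (Ds k)"
    "(\<lambda>k. l2norm (lebesgue_on \<Omega>) (\<phi>s k)) \<longlonglongrightarrow> l2norm (lebesgue_on \<Omega>) u"
    "(\<lambda>k. grad_sq \<Omega> (Ds k)) \<longlonglongrightarrow> grad_sq \<Omega> w"
    "(\<lambda>k. l2norm (bdry_measure \<Omega>) (\<lambda>x. \<phi>s k x - g x)) \<longlonglongrightarrow> 0"
    "(\<lambda>k. l2norm (bdry_measure \<Omega>) (\<phi>s k)) \<longlonglongrightarrow> l2norm (bdry_measure \<Omega>) g"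
proof -
  obtain \<phi>s Ds where a: "\<And>k. C1c_on UNIV (\<phi>s k) (Ds k)"
    "(\<lambda>k. l2norm (lebesgue_on \<Omega>) (\<lambda>x. \<phi>s k x - u x)) \<longlonglongrightarrow> 0"
    "\<And>i. (\<lambda>k. l2norm (lebesgue_on \<Omega>) (\<lambda>x. Ds k x $ i - w x $ i)) \<longlonglongrightarrow> 0"
    "(\<lambda>k. l2norm (bdry_measure \<Omega>) (\<lambda>x. \<phi>s k x - g x)) \<longlonglongrightarrow> 0"
    using t unfolding h1_triple_def by blast
  note C1 = C1c_on_imp_C1_with[OF a(1)]
  note d = h1_tripleD[OF t]
  show ?thesis
  proof (rule that[OF a(1) _ _ a(4)])
    show "(\<lambda>k. l2norm (lebesgue_on \<Omega>) (\<phi>s k)) \<longlonglongrightarrow> l2norm (lebesgue_on \<Omega>) u"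
      by (intro tendsto_l2norm C1_L2[OF lip C1] d a)
    show "(\<lambda>k. grad_sq \<Omega> (Ds k)) \<longlonglongrightarrow> grad_sq \<Omega> w"
      unfolding grad_sq_def by (intro tendsto_intros tendsto_l2norm C1_L2(2)[OF lip C1] d a)
    show "(\<lambda>k. l2norm (bdry_measure \<Omega>) (\<phi>s k)) \<longlonglongrightarrow> l2norm (bdry_measure \<Omega>) g"
      by (intro tendsto_l2norm C1_L2(3)[OF lip C1] d a)
  qed
qed

lemma h1_triple_trace_inequality:
  fixes \<Omega> :: "(real^'n) set"
  assumes lip: "lipschitz_domain \<Omega>" and \<epsilon>: "\<epsilon> > 0"
  obtains K where "K \<ge> 0" "\<And>u w g. h1_triple \<Omega> u w g \<Longrightarrow>
    (l2norm (bdry_measure \<Omega>) g)\<^sup>2 \<le> \<epsilon> * grad_sq \<Omega> w + K * (l2norm (lebesgue_on \<Omega>) u)\<^sup>2"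
proof -
  obtain K where K: "K \<ge> 0" "\<And>\<phi> D. C1_with \<phi> D \<Longrightarrow>
    (l2norm (bdry_measure \<Omega>) \<phi>)\<^sup>2 \<le> \<epsilon> * grad_sq \<Omega> D + K * (l2norm (lebesgue_on \<Omega>) \<phi>)\<^sup>2"
    using C1_norms_trace[OF lip \<epsilon>] by blast
  show ?thesis
  proof (rule that[OF K(1)])
    fix u w g assume t: "h1_triple \<Omega> u w g"
    obtain \<phi>s Ds where a: "\<And>k. C1c_on UNIV (\<phi>s k) (Ds k)"
      "(\<lambda>k. l2norm (lebesgue_on \<Omega>) (\<phi>s k)) \<longlonglongrightarrow> l2norm (lebesgue_on \<Omega>) u"
      "(\<lambda>k. grad_sq \<Omega> (Ds k)) \<longlonglongrightarrow> grad_sq \<Omega> w"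
      "(\<lambda>k. l2norm (bdry_measure \<Omega>) (\<lambda>x. \<phi>s k x - g x)) \<longlonglongrightarrow> 0"
      "(\<lambda>k. l2norm (bdry_measure \<Omega>) (\<phi>s k)) \<longlonglongrightarrow> l2norm (bdry_measure \<Omega>) g"
      by (rule h1_tripleE[OF lip t]) blast
    show "(l2norm (bdry_measure \<Omega>) g)\<^sup>2 \<le> \<epsilon> * grad_sq \<Omega> w + K * (l2norm (lebesgue_on \<Omega>) u)\<^sup>2"
    proof (rule tendsto_le[OF sequentially_bot])
      show "(\<lambda>k. \<epsilon> * grad_sq \<Omega> (Ds k) + K * (l2norm (lebesgue_on \<Omega>) (\<phi>s k))\<^sup>2)
          \<longlonglongrightarrow> \<epsilon> * grad_sq \<Omega> w + K * (l2norm (lebesgue_on \<Omega>) u)\<^sup>2"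
        by (intro tendsto_intros a)
      show "(\<lambda>k. (l2norm (bdry_measure \<Omega>) (\<phi>s k))\<^sup>2) \<longlonglongrightarrow> (l2norm (bdry_measure \<Omega>) g)\<^sup>2"
        by (intro tendsto_intros a)
    qed (use K(2)[OF C1c_on_imp_C1_with[OF a(1)]] in auto)
  qed
qed

text \<open>Only the limit \<open>g\<close> has mean zero, not its approximations. For each
  \<open>k\<close> the constant \<open>c\<close> of the smooth inequality is subtracted from
  \<open>g\<close> as well, which does not reduce the norm of \<open>g\<close>, and it cancels in
  the difference of the two. Hence the constants may vary arbitrarily with \<open>k\<close>.\<close>

lemma h1_triple_poincare:
  fixes \<Omega> :: "(real^'n) set"
  assumes lip: "lipschitz_domain \<Omega>"
  obtains C where "C \<ge> 0" "\<And>u w g. h1_triple \<Omega> u w g \<Longrightarrow> (LINT x|bdry_measure \<Omega>. g x) = 0 \<Longrightarrow>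
    (l2norm (bdry_measure \<Omega>) g)\<^sup>2 \<le> C * grad_sq \<Omega> w"
proof -
  obtain C where C: "C \<ge> 0" "\<And>\<phi> D. C1_with \<phi> D \<Longrightarrow>
    \<exists>c. (l2norm (bdry_measure \<Omega>) (\<lambda>x. \<phi> x - c))\<^sup>2 \<le> C * grad_sq \<Omega> D"
    using C1_norms_poincare[OF lip] by blast
  let ?\<sigma> = "bdry_measure \<Omega>"
  interpret finite_measure ?\<sigma> by (rule finite_measure_bdry[OF lip])
  show ?thesis
  proof (rule that[OF C(1)])
    fix u w g assume t: "h1_triple \<Omega> u w g" and mean: "(LINT x|?\<sigma>. g x) = 0"
    obtain \<phi>s Ds where a: "\<And>k. C1c_on UNIV (\<phi>s k) (Ds k)"
      "(\<lambda>k. l2norm (lebesgue_on \<Omega>) (\<phi>s k)) \<longlonglongrightarrow> l2norm (lebesgue_on \<Omega>) u"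
      "(\<lambda>k. grad_sq \<Omega> (Ds k)) \<longlonglongrightarrow> grad_sq \<Omega> w"
      "(\<lambda>k. l2norm ?\<sigma> (\<lambda>x. \<phi>s k x - g x)) \<longlonglongrightarrow> 0"
      "(\<lambda>k. l2norm ?\<sigma> (\<phi>s k)) \<longlonglongrightarrow> l2norm ?\<sigma> g"
      by (rule h1_tripleE[OF lip t]) blast
    note C1 = C1c_on_imp_C1_with[OF a(1)]
    have g: "g \<in> L2 ?\<sigma>" by (rule h1_tripleD[OF t])
    have "l2norm ?\<sigma> g \<le> sqrt (C * grad_sq \<Omega> (Ds k)) + l2norm ?\<sigma> (\<lambda>x. \<phi>s k x - g x)" for k
    proof -
      obtain c where c: "(l2norm ?\<sigma> (\<lambda>x. \<phi>s k x - c))\<^sup>2 \<le> C * grad_sq \<Omega> (Ds k)" using C(2)[OF C1] by blast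
      have one: "(\<lambda>_. c) \<in> L2 ?\<sigma>" by (simp add: L2_def)
      have "l2norm ?\<sigma> g \<le> l2norm ?\<sigma> (\<lambda>x. g x - c)"
        by (rule l2norm_le_mean_zero[OF finite_measure_bdry[OF lip] g mean])
      also have "\<dots> \<le> l2norm ?\<sigma> (\<lambda>x. \<phi>s k x - c) + l2norm ?\<sigma> (\<lambda>x. (g x - c) - (\<phi>s k x - c))"
        by (intro l2norm_triangle_diff L2_diff g one C1_L2(3)[OF lip C1])
      also have "l2norm ?\<sigma> (\<lambda>x. (g x - c) - (\<phi>s k x - c)) = l2norm ?\<sigma> (\<lambda>x. \<phi>s k x - g x)"
        using l2norm_minus_commute[of ?\<sigma> g "\<phi>s k"] by simp
      also have "l2norm ?\<sigma> (\<lambda>x. \<phi>s k x - c) \<le> sqrt (C * grad_sq \<Omega> (Ds k))"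
        using c by (rule real_le_rsqrt)
      finally show ?thesis by simp
    qed
    moreover have "(\<lambda>k. sqrt (C * grad_sq \<Omega> (Ds k)) + l2norm ?\<sigma> (\<lambda>x. \<phi>s k x - g x)) \<longlonglongrightarrow> sqrt (C * grad_sq \<Omega> w) + 0"
      by (intro tendsto_intros a)
    ultimately have "l2norm ?\<sigma> g \<le> sqrt (C * grad_sq \<Omega> w) + 0"
      by (intro tendsto_le[OF sequentially_bot _ tendsto_const]) auto
    then have "(l2norm ?\<sigma> g)\<^sup>2 \<le> (sqrt (C * grad_sq \<Omega> w))\<^sup>2" by (intro power_mono) auto
    then show "(l2norm ?\<sigma> g)\<^sup>2 \<le> C * grad_sq \<Omega> w" using C(1) grad_sq_nonneg[of \<Omega> w] by simp
  qed
qed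

section \<open>Linear combinations of triples, constants and null functions\<close>

lemma C1c_lincomb:
  assumes a: "C1c_on S \<phi> D" and b: "C1c_on S \<psi> E"
  shows "C1c_on S (\<lambda>x. \<phi> x + c * \<psi> x) (\<lambda>x. \<chi> i. D x $ i + c * E x $ i)"
proof -
  have "((\<lambda>x. \<phi> x + c * \<psi> x) has_derivative (\<lambda>h. \<Sum>i\<in>UNIV. complex_of_real (h $ i) * (\<chi> i. D x $ i + c * E x $ i) $ i)) (at x)" for x
  proof -
    have "((\<lambda>x. \<phi> x + c * \<psi> x) has_derivative (\<lambda>h. (\<Sum>i\<in>UNIV. complex_of_real (h $ i) * D x $ i)
        + c * (\<Sum>i\<in>UNIV. complex_of_real (h $ i) * E x $ i))) (at x)"
      using a b unfolding C1c_on_def by (intro has_derivative_add has_derivative_mult_right) auto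
    moreover have "(\<Sum>i\<in>UNIV. complex_of_real (h $ i) * D x $ i) + c * (\<Sum>i\<in>UNIV. complex_of_real (h $ i) * E x $ i)
        = (\<Sum>i\<in>UNIV. complex_of_real (h $ i) * (\<chi> i. D x $ i + c * E x $ i) $ i)" for h
      by (simp add: sum_distrib_left distrib_left sum.distrib mult.left_commute)
    ultimately show ?thesis by simp
  qed
  moreover have "continuous_on UNIV (\<lambda>x. \<chi> i. D x $ i + c * E x $ i)"
    using a b unfolding C1c_on_def by (intro continuous_intros) auto
  moreover have sub: "closure {x. \<phi> x + c * \<psi> x \<noteq> 0} \<subseteq> closure {x. \<phi> x \<noteq> 0} \<union> closure {x. \<psi> x \<noteq> 0}"
    unfolding closure_Un[symmetric] by (rule closure_mono) auto
  moreover have "compact (closure {x. \<phi> x \<noteq> 0} \<union> closure {x. \<psi> x \<noteq> 0})"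
    using a b unfolding C1c_on_def by (intro compact_Un) auto
  then have "compact ((closure {x. \<phi> x \<noteq> 0} \<union> closure {x. \<psi> x \<noteq> 0}) \<inter> closure {x. \<phi> x + c * \<psi> x \<noteq> 0})"
    by (intro compact_Int_closed closed_closure)
  then have "compact (closure {x. \<phi> x + c * \<psi> x \<noteq> 0})"
    using sub by (simp only: Int_absorb1)
  ultimately show ?thesis using a b unfolding C1c_on_def by blast
qed

lemma L2_cnj: "f \<in> L2 M \<Longrightarrow> (\<lambda>x. cnj (f x)) \<in> L2 M"
  unfolding L2_def by auto

lemma L2_integrable_mult':
  assumes "f \<in> L2 M" "g \<in> L2 M" shows "integrable M (\<lambda>x. f x * g x)"
  using L2_integrable_mult(1)[OF assms(1) L2_cnj[OF assms(2)]] by simp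

lemma weak_grad_lincomb:
  assumes lip: "lipschitz_domain \<Omega>" and a: "weak_grad \<Omega> u w" and b: "weak_grad \<Omega> v z"
  shows "weak_grad \<Omega> (\<lambda>x. u x + c * v x) (\<lambda>x. \<chi> i. w x $ i + c * z x $ i)"
proof -
  have L: "u \<in> L2 (lebesgue_on \<Omega>)" "v \<in> L2 (lebesgue_on \<Omega>)"
    "\<And>i. (\<lambda>x. w x $ i) \<in> L2 (lebesgue_on \<Omega>)" "\<And>i. (\<lambda>x. z x $ i) \<in> L2 (lebesgue_on \<Omega>)"
    using a b unfolding weak_grad_def by auto
  have "(LINT x|lebesgue_on \<Omega>. (u x + c * v x) * D x $ i) = - (LINT x|lebesgue_on \<Omega>. (w x $ i + c * z x $ i) * \<phi> x)"
    if phi: "C1c_on \<Omega> \<phi> D" for \<phi> D i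
  proof -
    note T = C1_L2[OF lip C1c_on_imp_C1_with[OF phi]]
    note I = L2_integrable_mult'[OF L(1) T(2)[of i]] L2_integrable_mult'[OF L(2) T(2)[of i]]
      L2_integrable_mult'[OF L(3)[of i] T(1)] L2_integrable_mult'[OF L(4)[of i] T(1)]
    have e: "(LINT x|lebesgue_on \<Omega>. u x * D x $ i) = - (LINT x|lebesgue_on \<Omega>. w x $ i * \<phi> x)"
      "(LINT x|lebesgue_on \<Omega>. v x * D x $ i) = - (LINT x|lebesgue_on \<Omega>. z x $ i * \<phi> x)"
      using a b phi unfolding weak_grad_def by auto
    show ?thesis using I e by (simp add: distrib_right mult.assoc)
  qed
  then show ?thesis unfolding weak_grad_def using L by (auto intro!: L2_lincomb)
qed

lemma tendsto_l2norm_lincomb_zero: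
  assumes "\<And>k. f k \<in> L2 M" "\<And>k. g k \<in> L2 M" "u \<in> L2 M" "v \<in> L2 M"
    and "(\<lambda>k. l2norm M (\<lambda>x. f k x - u x)) \<longlonglongrightarrow> 0" "(\<lambda>k. l2norm M (\<lambda>x. g k x - v x)) \<longlonglongrightarrow> 0"
  shows "(\<lambda>k. l2norm M (\<lambda>x. (f k x + c * g k x) - (u x + c * v x))) \<longlonglongrightarrow> 0"
proof (rule Lim_null_comparison)
  show "(\<lambda>k. l2norm M (\<lambda>x. f k x - u x) + cmod c * l2norm M (\<lambda>x. g k x - v x)) \<longlonglongrightarrow> 0"
    using tendsto_add[OF assms(5) tendsto_mult_right_zero[OF assms(6), of "cmod c"]] by simp
  have "l2norm M (\<lambda>x. (f k x + c * g k x) - (u x + c * v x))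
      \<le> l2norm M (\<lambda>x. f k x - u x) + cmod c * l2norm M (\<lambda>x. g k x - v x)" for k
    using l2norm_triangle[OF L2_diff[OF assms(1,3), of k] L2_cmult[OF L2_diff[OF assms(2,4)], of c k]]
    unfolding l2norm_cmult by (simp add: algebra_simps)
  then show "\<forall>\<^sub>F k in sequentially. norm (l2norm M (\<lambda>x. (f k x + c * g k x) - (u x + c * v x)))
      \<le> l2norm M (\<lambda>x. f k x - u x) + cmod c * l2norm M (\<lambda>x. g k x - v x)"
    by simp
qed

lemma h1_triple_lincomb:
  assumes lip: "lipschitz_domain \<Omega>" and a: "h1_triple \<Omega> u w g" and b: "h1_triple \<Omega> v z h"
  shows "h1_triple \<Omega> (\<lambda>x. u x + c * v x) (\<lambda>x. \<chi> i. w x $ i + c * z x $ i) (\<lambda>x. g x + c * h x)"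
proof -
  obtain \<phi>s Ds where p: "\<And>k. C1c_on UNIV (\<phi>s k) (Ds k)"
    "(\<lambda>k. l2norm (lebesgue_on \<Omega>) (\<lambda>x. \<phi>s k x - u x)) \<longlonglongrightarrow> 0"
    "\<And>i. (\<lambda>k. l2norm (lebesgue_on \<Omega>) (\<lambda>x. Ds k x $ i - w x $ i)) \<longlonglongrightarrow> 0"
    "(\<lambda>k. l2norm (bdry_measure \<Omega>) (\<lambda>x. \<phi>s k x - g x)) \<longlonglongrightarrow> 0"
    using a unfolding h1_triple_def by blast
  obtain \<psi>s Es where q: "\<And>k. C1c_on UNIV (\<psi>s k) (Es k)"
    "(\<lambda>k. l2norm (lebesgue_on \<Omega>) (\<lambda>x. \<psi>s k x - v x)) \<longlonglongrightarrow> 0"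
    "\<And>i. (\<lambda>k. l2norm (lebesgue_on \<Omega>) (\<lambda>x. Es k x $ i - z x $ i)) \<longlonglongrightarrow> 0"
    "(\<lambda>k. l2norm (bdry_measure \<Omega>) (\<lambda>x. \<psi>s k x - h x)) \<longlonglongrightarrow> 0"
    using b unfolding h1_triple_def by blast
  note da = h1_tripleD[OF a] and db = h1_tripleD[OF b]
  note Lp = C1_L2[OF lip C1c_on_imp_C1_with[OF p(1)]] and Lq = C1_L2[OF lip C1c_on_imp_C1_with[OF q(1)]]
  show ?thesis unfolding h1_triple_def
  proof (intro conjI exI allI)
    show "weak_grad \<Omega> (\<lambda>x. u x + c * v x) (\<lambda>x. \<chi> i. w x $ i + c * z x $ i)"
      by (rule weak_grad_lincomb[OF lip da(1) db(1)])
    show "(\<lambda>x. g x + c * h x) \<in> L2 (bdry_measure \<Omega>)" by (rule L2_lincomb[OF da(2) db(2)])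
    show "C1c_on UNIV (\<lambda>x. \<phi>s k x + c * \<psi>s k x) (\<lambda>x. \<chi> i. Ds k x $ i + c * Es k x $ i)" for k
      by (rule C1c_lincomb[OF p(1) q(1)])
    show "(\<lambda>k. l2norm (lebesgue_on \<Omega>) (\<lambda>x. (\<phi>s k x + c * \<psi>s k x) - (u x + c * v x))) \<longlonglongrightarrow> 0"
      by (rule tendsto_l2norm_lincomb_zero[OF Lp(1) Lq(1) da(3) db(3) p(2) q(2)])
    show "(\<lambda>k. l2norm (lebesgue_on \<Omega>) (\<lambda>x. (\<chi> i. Ds k x $ i + c * Es k x $ i) $ i - (\<chi> i. w x $ i + c * z x $ i) $ i)) \<longlonglongrightarrow> 0" for i
      using tendsto_l2norm_lincomb_zero[OF Lp(2) Lq(2) da(4) db(4) p(3) q(3), of i c] by simp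
    show "(\<lambda>k. l2norm (bdry_measure \<Omega>) (\<lambda>x. (\<phi>s k x + c * \<psi>s k x) - (g x + c * h x))) \<longlonglongrightarrow> 0"
      by (rule tendsto_l2norm_lincomb_zero[OF Lp(3) Lq(3) da(2) db(2) p(4) q(4)])
  qed
qed

lemma l2norm_zero_on_space: "(\<And>x. x \<in> space M \<Longrightarrow> f x = 0) \<Longrightarrow> l2norm M f = 0"
  unfolding l2norm_def by (subst Bochner_Integration.integral_cong[OF refl, of _ _ "\<lambda>_. 0"]) auto

text \<open>The approximating sequence is constant: a cutoff equal to 1 with zero gradient on the
  closure of \<Omega> has all distances equal to 0. That the weak gradient is 0 is the vanishing of
  the total integral of a partial derivative.\<close>

lemma h1_triple_one:
  fixes \<Omega> :: "(real^'n) set"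
  assumes lip: "lipschitz_domain \<Omega>"
  shows "h1_triple \<Omega> (\<lambda>_. 1) (\<lambda>_. 0) (\<lambda>_. 1)"
proof -
  have \<Omega>: "bounded \<Omega>" "open \<Omega>" using lip by (auto simp: lipschitz_domain_def)
  interpret l: finite_measure "lebesgue_on \<Omega>" by (rule finite_measure_lebesgue_on_bounded[OF \<Omega>])
  interpret s: finite_measure "bdry_measure \<Omega>" by (rule finite_measure_bdry[OF lip])
  obtain \<phi> D where \<phi>: "C1c_on UNIV \<phi> D" "\<And>x. x \<in> closure \<Omega> \<Longrightarrow> \<phi> x = 1 \<and> D x = 0"
    using C1c_cutoff[OF \<Omega>(1)] by blast
  have in_cl: "x \<in> \<Omega> \<Longrightarrow> x \<in> closure \<Omega>" "x \<in> frontier \<Omega> \<Longrightarrow> x \<in> closure \<Omega>" for x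
    using closure_subset by (auto simp: frontier_def)
  have z1: "l2norm (lebesgue_on \<Omega>) (\<lambda>x. \<phi> x - 1) = 0"
    "l2norm (lebesgue_on \<Omega>) (\<lambda>x. D x $ i - (0::complex^'n) $ i) = 0" for i
    using \<phi>(2) in_cl(1) by (auto intro!: l2norm_zero_on_space)
  have z2: "l2norm (bdry_measure \<Omega>) (\<lambda>x. \<phi> x - 1) = 0"
    using \<phi>(2) in_cl(2) by (auto intro!: l2norm_zero_on_space)
  have "(LINT x|lebesgue_on \<Omega>. 1 * E x $ i) = 0" if psi: "C1c_on \<Omega> \<psi> E" for \<psi> E i
  proof -
    have C1: "C1_with \<psi> E" by (rule C1c_on_imp_C1_with[OF psi])
    have "(LINT x|lebesgue_on \<Omega>. 1 * E x $ i) = (LINT x|lborel. indicator \<Omega> x *\<^sub>R E x $ i)"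
      using \<Omega> C1 unfolding C1_with_def
      by (simp, intro integral_lebesgue_on_borel borel_measurable_continuous_onI continuous_intros) auto
    also have "\<dots> = (LINT x|lborel. E x $ i)"
    proof (rule Bochner_Integration.integral_cong[OF refl])
      fix x
      have "E x = 0" if "x \<notin> \<Omega>"
        using C1c_grad_zero_outside[OF psi, of x] psi that unfolding C1c_on_def by blast
      then show "indicator \<Omega> x *\<^sub>R E x $ i = E x $ i" by (cases "x \<in> \<Omega>") auto
    qed
    finally show ?thesis using integral_C1c_grad[OF psi] by simp
  qed
  then have "weak_grad \<Omega> (\<lambda>_. 1) (\<lambda>_. 0)"
    unfolding weak_grad_def by (auto simp: L2_def)
  moreover have "(\<lambda>_. 1) \<in> L2 (bdry_measure \<Omega>)" by (simp add: L2_def)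
  ultimately show ?thesis unfolding h1_triple_def
    by (intro conjI exI[of _ "\<lambda>_. \<phi>"] exI[of _ "\<lambda>_. D"] allI \<phi>(1)) (simp_all only: z1 z2 tendsto_const)
qed

text \<open>Functions here are representatives, so a null function has to be shown to possess a
  trace. This contradicts the assumption that some function in \<open>H1\<close> has none, once that
  function has been shown to be null.\<close>

lemma h1_triple_null:
  assumes u: "u \<in> L2 (lebesgue_on \<Omega>)" "AE x in lebesgue_on \<Omega>. u x = 0"
  shows "h1_triple \<Omega> u (\<lambda>_. 0) (\<lambda>_. 0)"
proof -
  have "(LINT x|lebesgue_on \<Omega>. u x * D x $ i) = 0" for D :: "real^'a \<Rightarrow> complex^'a" and i
    by (rule integral_eq_zero_AE) (use u(2) in eventually_elim, simp)
  then have "weak_grad \<Omega> u (\<lambda>_. 0)" unfolding weak_grad_def using u L2_zero by auto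
  moreover have "l2norm (lebesgue_on \<Omega>) (\<lambda>x. 0 - u x) = 0"
    unfolding l2norm_def by (simp, rule integral_eq_zero_AE) (use u(2) in eventually_elim, simp)
  moreover have "C1c_on UNIV (\<lambda>_. 0) (\<lambda>_. 0)" unfolding C1c_on_def by simp
  moreover have "l2norm M (\<lambda>x. 0) = 0" for M :: "(real^'a) measure" by (simp add: l2norm_def)
  ultimately show ?thesis unfolding h1_triple_def using L2_zero
    by (auto intro!: exI[of _ "\<lambda>_ _. 0"])
qed

section \<open>Orthogonal symmetries\<close>

definition measure_preserving :: "'a measure \<Rightarrow> ('a \<Rightarrow> 'a) \<Rightarrow> bool" where
  "measure_preserving M T \<longleftrightarrow> T \<in> measurable M M \<and> distr M M T = M"

lemma measure_preserving_integral:
  fixes f :: "'a \<Rightarrow> 'b::{banach, second_countable_topology}"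
  assumes "measure_preserving M T" "f \<in> borel_measurable M"
  shows "(LINT x|M. f (T x)) = (LINT x|M. f x)"
  using assms integral_distr[of T M M f] by (simp add: measure_preserving_def)

lemma measure_preserving_L2:
  assumes T: "measure_preserving M T" and f: "f \<in> L2 M"
  shows "(\<lambda>x. f (T x)) \<in> L2 M" "l2norm M (\<lambda>x. f (T x)) = l2norm M f"
proof -
  have [measurable]: "f \<in> borel_measurable M" "T \<in> measurable M M"
    using T f by (auto simp: L2_def measure_preserving_def)
  have "integrable (distr M M T) (\<lambda>x. (cmod (f x))\<^sup>2)"
    using T L2_integrable_square[OF f] by (simp add: measure_preserving_def)
  then have "integrable M (\<lambda>x. (cmod (f (T x)))\<^sup>2)" by (subst (asm) integrable_distr_eq) auto
  then show "(\<lambda>x. f (T x)) \<in> L2 M" by (simp add: L2_def)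
  show "l2norm M (\<lambda>x. f (T x)) = l2norm M f"
    unfolding l2norm_def using measure_preserving_integral[OF T, of "\<lambda>x. (cmod (f x))\<^sup>2"] by simp
qed

lemma measure_preserving_l2inner:
  assumes "measure_preserving M T" "f \<in> L2 M" "g \<in> L2 M"
  shows "l2inner M (\<lambda>x. f (T x)) (\<lambda>x. g (T x)) = l2inner M f g"
  unfolding l2inner_def using assms
  by (intro measure_preserving_integral[where f="\<lambda>x. f x * cnj (g x)"] borel_measurable_times
      measurable_compose[OF _ borel_measurable_cnj]) (auto simp: L2_def)

lemma diameter_isometric_image:
  assumes "\<And>x y. dist (T x) (T y) = dist x y"
  shows "diameter (T ` C) = diameter C"
proof -
  have "(\<lambda>(x, y). dist x y) ` (T ` C \<times> T ` C) = (\<lambda>(x, y). dist x y) ` (C \<times> C)"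
  proof
    show "(\<lambda>(x, y). dist x y) ` (T ` C \<times> T ` C) \<subseteq> (\<lambda>(x, y). dist x y) ` (C \<times> C)"
      using assms by force
    show "(\<lambda>(x, y). dist x y) ` (C \<times> C) \<subseteq> (\<lambda>(x, y). dist x y) ` (T ` C \<times> T ` C)"
    proof
      fix r assume "r \<in> (\<lambda>(x, y). dist x y) ` (C \<times> C)"
      then obtain x y where "x \<in> C" "y \<in> C" "r = dist (T x) (T y)" using assms by auto
      then show "r \<in> (\<lambda>(x, y). dist x y) ` (T ` C \<times> T ` C)" by (intro image_eqI[of _ _ "(T x, T y)"]) auto
    qed
  qed
  then show ?thesis unfolding diameter_def by simp
qed

text \<open>Every admissible cover is carried to an admissible cover of the same weight. Applied to
  an orthogonal map and to its inverse, the inequality becomes an equality.\<close>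

lemma hausdorff_outer_isometric_image_le:
  assumes T: "\<And>x y. dist (T x) (T y) = dist x y"
  shows "hausdorff_outer s (T ` A) \<le> hausdorff_outer s A"
proof -
  have "hausdorff_pre s \<delta> (T ` A) \<le> hausdorff_pre s \<delta> A" for \<delta>
    unfolding hausdorff_pre_def
  proof (rule INF_greatest)
    fix C assume C: "C \<in> {C :: nat \<Rightarrow> _. A \<subseteq> (\<Union>i. C i) \<and> (\<forall>i. bounded (C i) \<and> diameter (C i) \<le> \<delta>)}"
    have "bounded (T ` C i)" for i
    proof -
      obtain x r where "\<forall>y\<in>C i. dist x y \<le> r" using C unfolding bounded_def by blast
      then show ?thesis unfolding bounded_def using T by (intro exI[of _ "T x"] exI[of _ r]) auto
    qed
    then have "(\<lambda>i. T ` C i) \<in> {C. T ` A \<subseteq> (\<Union>i. C i) \<and> (\<forall>i. bounded (C i) \<and> diameter (C i) \<le> \<delta>)}"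
      using C diameter_isometric_image[of T, OF T] by fastforce
    then show "(INF C \<in> {C. T ` A \<subseteq> (\<Union>i. C i) \<and> (\<forall>i. bounded (C i) \<and> diameter (C i) \<le> \<delta>)}.
          (\<Sum>i. ennreal (if C i = {} then 0 else haus_const s * (diameter (C i) / 2) ^ s)))
        \<le> (\<Sum>i. ennreal (if C i = {} then 0 else haus_const s * (diameter (C i) / 2) ^ s))"
      by (rule INF_lower2) (simp add: diameter_isometric_image[of T, OF T] cong: if_cong)
  qed
  then show ?thesis unfolding hausdorff_outer_def by (intro SUP_mono) blast
qed

declare transpose_matrix_vector [simp del]

lemma matrix_inv_orthogonal:
  assumes "orthogonal_matrix (h :: real^'n^'n)" shows "matrix_inv h = transpose h"
proof -
  have h: "transpose h ** h = mat 1" "h ** transpose h = mat 1" using assms by (auto simp: orthogonal_matrix_def)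
  then have "h ** matrix_inv h = mat 1 \<and> matrix_inv h ** h = mat 1"
    unfolding matrix_inv_def by (intro someI[of "\<lambda>A'. h ** A' = mat 1 \<and> A' ** h = mat 1"]) simp
  then have "matrix_inv h ** (h ** transpose h) = transpose h" by (simp add: matrix_mul_assoc)
  then show ?thesis by (simp add: h)
qed

section \<open>Lebesgue and boundary measure under an orthogonal map\<close>

context
  fixes h :: "real^'n^'n"
  assumes orth: "orthogonal_matrix h"
begin

lemma orth_inverse: "h *v (transpose h *v x) = x" "transpose h *v (h *v x) = x"
  using orth by (auto simp: orthogonal_matrix_def matrix_vector_mul_assoc)

lemma orth_norm: "norm (h *v x) = norm x"
proof -
  have "(h *v x) \<bullet> (h *v x) = x \<bullet> (transpose h *v (h *v x))"
    by (metis dot_lmul_matrix inner_commute transpose_matrix_vector)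
  then show ?thesis by (simp add: orth_inverse norm_eq_sqrt_inner)
qed

lemma orth_dist: "dist (h *v x) (h *v y) = dist x y"
  using orth_norm[of "x - y"] by (simp add: dist_norm matrix_vector_mult_diff_distrib)

lemma orth_borel [measurable]: "(\<lambda>x. h *v x) \<in> borel_measurable borel"
  by (intro borel_measurable_continuous_onI linear_continuous_on) (simp add: matrix_vector_mul_bounded_linear)

text \<open>Uniqueness of Haar measure up to a factor, the factor being determined by the unit ball.\<close>
lemma nn_integral_lborel_orth:
  assumes [measurable]: "f \<in> borel_measurable borel"
  shows "(\<integral>\<^sup>+x. f (h *v x) \<partial>lborel) = (\<integral>\<^sup>+x. f x \<partial>lborel)"
proof -
  define g where "g = (indicator (ball (0::real^'n) 1) :: _ \<Rightarrow> ennreal)"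
  have [measurable]: "g \<in> borel_measurable borel" unfolding g_def by (intro borel_measurable_indicator) simp
  let ?L = "\<integral>\<^sup>+y. g y \<partial>lborel"
  have L: "?L = emeasure lborel (ball (0::real^'n) 1)" unfolding g_def by simp
  have L0: "?L \<noteq> 0" unfolding L by (simp add: emeasure_lborel_ball_eq content_ball ennreal_eq_0_iff not_le)
  have L1: "?L \<noteq> top" unfolding L by (simp add: emeasure_lborel_ball_eq)
  \<comment> \<open>After translating first \<open>y\<close> and then \<open>x\<close>, the matrix
    remains only inside the indicator of the ball, which is invariant under it and under the sign
    change; hence the factor is 1.\<close>
  have g1: "g (- y) = g y" "g (h *v y) = g y" for y unfolding g_def by (auto simp: orth_norm split: split_indicator)
  have "(\<integral>\<^sup>+x. f (h *v x) \<partial>lborel) * ?L = (\<integral>\<^sup>+x. (\<integral>\<^sup>+y. f (h *v x) * g y \<partial>lborel) \<partial>lborel)"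
    by (simp add: nn_integral_cmult nn_integral_multc)
  also have "\<dots> = (\<integral>\<^sup>+x. (\<integral>\<^sup>+y. f (h *v x) * g (y + - (h *v x)) \<partial>lborel) \<partial>lborel)"
    by (intro nn_integral_cong nn_integral_lborel_translate[symmetric]) measurable
  also have "\<dots> = (\<integral>\<^sup>+y. (\<integral>\<^sup>+x. f (h *v x) * g (y + - (h *v x)) \<partial>lborel) \<partial>lborel)"
    by (rule lborel_pair.Fubini'[symmetric]) measurable
  also have "\<dots> = (\<integral>\<^sup>+y. (\<integral>\<^sup>+x. f (h *v x + y) * g x \<partial>lborel) \<partial>lborel)"
  proof (rule nn_integral_cong)
    fix y :: "real^'n"
    have "(\<integral>\<^sup>+x. f (h *v x) * g (y + - (h *v x)) \<partial>lborel)
      = (\<integral>\<^sup>+x. f (h *v (x + transpose h *v y)) * g (y + - (h *v (x + transpose h *v y))) \<partial>lborel)"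
      by (rule nn_integral_lborel_translate[symmetric, where f="\<lambda>x. f (h *v x) * g (y + - (h *v x))"]) measurable
    also have "\<dots> = (\<integral>\<^sup>+x. f (h *v x + y) * g x \<partial>lborel)"
      using g1 by (simp add: matrix_vector_right_distrib orth_inverse)
    finally show "(\<integral>\<^sup>+x. f (h *v x) * g (y + - (h *v x)) \<partial>lborel) = (\<integral>\<^sup>+x. f (h *v x + y) * g x \<partial>lborel)" .
  qed
  also have "\<dots> = (\<integral>\<^sup>+x. (\<integral>\<^sup>+y. f (h *v x + y) * g x \<partial>lborel) \<partial>lborel)"
    by (rule lborel_pair.Fubini') measurable
  also have "\<dots> = (\<integral>\<^sup>+x. (\<integral>\<^sup>+y. f y \<partial>lborel) * g x \<partial>lborel)"
  proof -
    have "(\<integral>\<^sup>+y. f (h *v x + y) \<partial>lborel) = (\<integral>\<^sup>+y. f y \<partial>lborel)" for x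
      using nn_integral_lborel_translate[of f "h *v x"] by (simp add: add.commute)
    then show ?thesis by (simp add: nn_integral_multc)
  qed
  also have "\<dots> = (\<integral>\<^sup>+y. f y \<partial>lborel) * ?L"
    by (simp add: nn_integral_cmult)
  finally have "?L * (\<integral>\<^sup>+x. f (h *v x) \<partial>lborel) = ?L * (\<integral>\<^sup>+x. f x \<partial>lborel)" by (simp add: mult.commute)
  then show ?thesis using L0 L1 by (metis ennreal_mult_cancel_left)
qed

lemma distr_lborel_orth: "distr lborel lborel (\<lambda>x. h *v x) = lborel"
proof (rule measure_eqI)
  fix A assume "A \<in> sets (distr lborel lborel (\<lambda>x. h *v x))"
  then have [measurable]: "A \<in> sets borel" by simp
  have "emeasure (distr lborel lborel (\<lambda>x. h *v x)) A = (\<integral>\<^sup>+x. indicator A (h *v x) \<partial>lborel)"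
    by (subst nn_integral_indicator[symmetric], simp, subst nn_integral_distr) auto
  then show "emeasure (distr lborel lborel (\<lambda>x. h *v x)) A = emeasure lborel A"
    by (simp add: nn_integral_lborel_orth)
qed simp

lemma measure_preserving_lebesgue_orth: "measure_preserving lebesgue (\<lambda>x. h *v x)"
proof -
  have m: "(\<lambda>x. h *v x) \<in> measurable lebesgue lborel"
    by (rule measurable_completion) simp
  have d: "distr lebesgue lborel (\<lambda>x. h *v x) = lborel"
    by (subst distr_completion) (simp_all add: distr_lborel_orth)
  have "(\<lambda>x. h *v x) \<in> measurable lebesgue lebesgue"
    by (rule completion.measurable_completion2[OF m]) (simp add: d)
  moreover have "completion (distr lebesgue lborel (\<lambda>x. h *v x)) = distr lebesgue lebesgue (\<lambda>x. h *v x)"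
    by (rule completion.completion_distr_eq[OF m]) (simp add: d)
  ultimately show ?thesis unfolding measure_preserving_def by (simp add: d)
qed

context
  fixes \<Omega> :: "(real^'n) set"
  assumes inv: "\<And>x. h *v x \<in> \<Omega> \<longleftrightarrow> x \<in> \<Omega>" and op: "open \<Omega>"
begin

lemma measure_preserving_lebesgue_on_orth: "measure_preserving (lebesgue_on \<Omega>) (\<lambda>x. h *v x)"
proof -
  have T: "(\<lambda>x. h *v x) \<in> measurable lebesgue lebesgue" and d: "distr lebesgue lebesgue (\<lambda>x. h *v x) = lebesgue"
    using measure_preserving_lebesgue_orth by (auto simp: measure_preserving_def)
  have \<Omega>: "\<Omega> \<in> sets lebesgue" using op by auto
  have T': "(\<lambda>x. h *v x) \<in> measurable (lebesgue_on \<Omega>) (lebesgue_on \<Omega>)"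
    by (intro measurable_restrict_space2 measurable_restrict_space1 T) (auto simp: inv space_restrict_space)
  have "distr (lebesgue_on \<Omega>) (lebesgue_on \<Omega>) (\<lambda>x. h *v x) = lebesgue_on \<Omega>"
  proof (rule measure_eqI)
    fix A assume "A \<in> sets (distr (lebesgue_on \<Omega>) (lebesgue_on \<Omega>) (\<lambda>x. h *v x))"
    then have A: "A \<in> sets (lebesgue_on \<Omega>)" by simp
    then have A': "A \<in> sets lebesgue" "A \<subseteq> \<Omega>" using \<Omega> by (auto simp: sets_restrict_space_iff)
    have sub: "(\<lambda>x. h *v x) -` A \<subseteq> \<Omega>" using A'(2) inv by auto
    have pre: "(\<lambda>x. h *v x) -` A \<in> sets lebesgue" using measurable_sets[OF T A'(1)] by simp
    have "emeasure (distr (lebesgue_on \<Omega>) (lebesgue_on \<Omega>) (\<lambda>x. h *v x)) A = emeasure (lebesgue_on \<Omega>) ((\<lambda>x. h *v x) -` A \<inter> \<Omega>)"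
      using A by (subst emeasure_distr[OF T']) (auto simp: space_restrict_space)
    also have "\<dots> = emeasure lebesgue ((\<lambda>x. h *v x) -` A)"
      using sub \<Omega> by (subst emeasure_restrict_space) (auto simp: Int_absorb2)
    also have "\<dots> = emeasure lebesgue A"
      using emeasure_distr[OF T A'(1)] d by simp
    also have "\<dots> = emeasure (lebesgue_on \<Omega>) A" using A' \<Omega> by (subst emeasure_restrict_space) auto
    finally show "emeasure (distr (lebesgue_on \<Omega>) (lebesgue_on \<Omega>) (\<lambda>x. h *v x)) A = emeasure (lebesgue_on \<Omega>) A" .
  qed simp
  then show ?thesis using T' by (simp add: measure_preserving_def)
qed

lemma frontier_orth: "h *v x \<in> frontier \<Omega> \<longleftrightarrow> x \<in> frontier \<Omega>"
proof -
  have inj: "inj (\<lambda>x. h *v x)" by (metis injI orth_inverse(2))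
  have img: "(\<lambda>x. h *v x) ` \<Omega> = \<Omega>"
  proof
    show "\<Omega> \<subseteq> (\<lambda>x. h *v x) ` \<Omega>"
      using inv orth_inverse(1) by (metis image_eqI subsetI)
  qed (use inv in auto)
  have "(\<lambda>x. h *v x) ` closure \<Omega> = closure \<Omega>"
    using closure_injective_linear_image[OF matrix_vector_mul_linear inj, of \<Omega>] img by simp
  then have "h *v x \<in> closure \<Omega> \<longleftrightarrow> x \<in> closure \<Omega>" using inj by (metis image_eqI imageE injD)
  then show ?thesis using inv op by (simp add: frontier_def interior_open)
qed

lemma measure_preserving_bdry_orth: "measure_preserving (bdry_measure \<Omega>) (\<lambda>x. h *v x)"
proof -
  let ?\<sigma> = "bdry_measure \<Omega>" and ?R = "restrict_space borel (frontier \<Omega>)"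
  have T: "(\<lambda>x. h *v x) \<in> measurable ?R ?R"
    by (intro measurable_restrict_space2 measurable_restrict_space1 orth_borel)
       (auto simp: frontier_orth space_restrict_space)
  then have T': "(\<lambda>x. h *v x) \<in> measurable ?\<sigma> ?\<sigma>"
    using measurable_cong_sets[OF sets_bdry_measure sets_bdry_measure] by blast
  have "distr ?\<sigma> ?\<sigma> (\<lambda>x. h *v x) = ?\<sigma>"
  proof (rule measure_eqI)
    fix A assume "A \<in> sets (distr ?\<sigma> ?\<sigma> (\<lambda>x. h *v x))"
    then have A: "A \<in> sets ?\<sigma>" by simp
    have AF: "A \<subseteq> frontier \<Omega>" using sets.sets_into_space[OF A] by simp
    let ?B = "(\<lambda>x. h *v x) -` A \<inter> frontier \<Omega>"
    have B: "?B \<in> sets ?\<sigma>" using measurable_sets[OF T' A] by simp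
    have BA: "?B = (\<lambda>x. transpose h *v x) ` A"
    proof
      show "?B \<subseteq> (\<lambda>x. transpose h *v x) ` A"
      proof
        fix x assume "x \<in> ?B"
        then show "x \<in> (\<lambda>x. transpose h *v x) ` A"
          by (intro image_eqI[of _ _ "h *v x"]) (simp_all add: orth_inverse)
      qed
      show "(\<lambda>x. transpose h *v x) ` A \<subseteq> ?B"
        using AF frontier_orth by (auto simp: orth_inverse) (metis orth_inverse(1) subsetD)
    qed
    have AB: "A = (\<lambda>x. h *v x) ` ?B" unfolding BA by (simp add: image_image orth_inverse)
    have Td: "dist (transpose h *v x) (transpose h *v y) = dist x y" for x y
      using orth_dist[of "transpose h *v x" "transpose h *v y"] by (simp add: orth_inverse)
    have "hausdorff_outer (CARD('n) - 1) ?B = hausdorff_outer (CARD('n) - 1) A"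
    proof (rule antisym)
      show "hausdorff_outer (CARD('n) - 1) ?B \<le> hausdorff_outer (CARD('n) - 1) A"
        unfolding BA by (rule hausdorff_outer_isometric_image_le[OF Td])
      show "hausdorff_outer (CARD('n) - 1) A \<le> hausdorff_outer (CARD('n) - 1) ?B"
        using hausdorff_outer_isometric_image_le[of "\<lambda>x. h *v x", OF orth_dist] AB by metis
    qed
    \<comment> \<open>Whether \<open>hausdorff_outer\<close> or 0 is returned does not depend on the
      measurable set \<open>E\<close>, so equal outer values give equal measures in either
      case.\<close>
    moreover have "emeasure ?\<sigma> E = (if measure_space (frontier \<Omega>) (sets ?R) (hausdorff_outer (CARD('n) - 1))
        then hausdorff_outer (CARD('n) - 1) E else 0)" if "E \<in> sets ?\<sigma>" for E
    proof -
      have "sets ?R \<subseteq> Pow (frontier \<Omega>)"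
        using sets.space_closed[of ?R] by (simp add: space_restrict_space)
      moreover have "sigma_sets (frontier \<Omega>) (sets ?R) = sets ?R"
        using sets.sigma_sets_eq[of ?R] by (simp add: space_restrict_space)
      ultimately show ?thesis using that unfolding sets_bdry_measure
        unfolding bdry_measure_def by (simp add: emeasure_measure_of_conv)
    qed
    ultimately show "emeasure (distr ?\<sigma> ?\<sigma> (\<lambda>x. h *v x)) A = emeasure ?\<sigma> A"
      using A B by (simp add: emeasure_distr[OF T' A])
  qed simp
  then show ?thesis using T' by (simp add: measure_preserving_def)
qed

end
end

text \<open>The gradient of \<open>u\<close> composed with \<open>h\<close> according to the chain
  rule: the transpose of \<open>h\<close> applied to \<open>w\<close> at the image point.\<close>

definition grad_pull :: "real^'n^'n \<Rightarrow> (real^'n \<Rightarrow> complex^'n) \<Rightarrow> real^'n \<Rightarrow> complex^'n" where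
  "grad_pull h w = (\<lambda>x. \<chi> i. \<Sum>j\<in>UNIV. complex_of_real (h $ j $ i) * w (h *v x) $ j)"

lemma grad_pull_nth: "grad_pull h w x $ i = (\<Sum>j\<in>UNIV. complex_of_real (h $ j $ i) * w (h *v x) $ j)"
  by (simp add: grad_pull_def)

lemma C1c_pull:
  fixes h :: "real^'n^'n"
  assumes orth: "orthogonal_matrix h" and C: "C1c_on S \<phi> D" and S: "\<And>x. h *v x \<in> S \<Longrightarrow> x \<in> S"
  shows "C1c_on S (\<lambda>x. \<phi> (h *v x)) (grad_pull h D)"
proof -
  have lin: "bounded_linear (\<lambda>x. h *v x)" by (rule matrix_vector_mul_bounded_linear)
  have "((\<lambda>x. \<phi> (h *v x)) has_derivative (\<lambda>k. \<Sum>i\<in>UNIV. complex_of_real (k $ i) * grad_pull h D x $ i)) (at x)" for x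
  proof -
    have "(\<phi> has_derivative (\<lambda>k. \<Sum>i\<in>UNIV. complex_of_real (k $ i) * D (h *v x) $ i)) (at (h *v x))"
      using C by (simp add: C1c_on_def)
    from has_derivative_compose[OF bounded_linear_imp_has_derivative[OF lin] this]
    have "((\<lambda>x. \<phi> (h *v x)) has_derivative (\<lambda>k. \<Sum>j\<in>UNIV. complex_of_real ((h *v k) $ j) * D (h *v x) $ j)) (at x)" .
    moreover have "(\<Sum>j\<in>UNIV. complex_of_real ((h *v k) $ j) * D (h *v x) $ j)
        = (\<Sum>i\<in>UNIV. complex_of_real (k $ i) * grad_pull h D x $ i)" for k
    proof -
      have "(\<Sum>j\<in>UNIV. complex_of_real ((h *v k) $ j) * D (h *v x) $ j)
          = (\<Sum>j\<in>UNIV. \<Sum>i\<in>UNIV. complex_of_real (k $ i) * (complex_of_real (h $ j $ i) * D (h *v x) $ j))"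
        by (simp add: matrix_vector_mult_def sum_distrib_right mult_ac)
      also have "\<dots> = (\<Sum>i\<in>UNIV. \<Sum>j\<in>UNIV. complex_of_real (k $ i) * (complex_of_real (h $ j $ i) * D (h *v x) $ j))"
        by (rule sum.swap)
      finally show ?thesis by (simp add: grad_pull_nth sum_distrib_left)
    qed
    ultimately show ?thesis by simp
  qed
  moreover have "continuous_on UNIV (grad_pull h D)"
  proof -
    have "continuous_on UNIV (\<lambda>x. D (h *v x))"
      using C unfolding C1c_on_def by (intro continuous_on_compose2[OF _ linear_continuous_on[OF lin]]) auto
    then show ?thesis unfolding grad_pull_def by (intro continuous_intros)
  qed
  moreover have sub: "closure {x. \<phi> (h *v x) \<noteq> 0} \<subseteq> (\<lambda>x. transpose h *v x) ` closure {x. \<phi> x \<noteq> 0}"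
    and cpt: "compact ((\<lambda>x. transpose h *v x) ` closure {x. \<phi> x \<noteq> 0})"
  proof -
    show cpt: "compact ((\<lambda>x. transpose h *v x) ` closure {x. \<phi> x \<noteq> 0})"
      using C unfolding C1c_on_def
      by (intro compact_continuous_image linear_continuous_on matrix_vector_mul_bounded_linear) auto
    have "{x. \<phi> (h *v x) \<noteq> 0} \<subseteq> (\<lambda>x. transpose h *v x) ` closure {x. \<phi> x \<noteq> 0}"
    proof
      fix x assume "x \<in> {x. \<phi> (h *v x) \<noteq> 0}"
      then have "h *v x \<in> closure {x. \<phi> x \<noteq> 0}" using closure_subset by fastforce
      then show "x \<in> (\<lambda>x. transpose h *v x) ` closure {x. \<phi> x \<noteq> 0}"
        by (intro image_eqI[of _ _ "h *v x"]) (simp_all add: orth_inverse[OF orth])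
    qed
    then show "closure {x. \<phi> (h *v x) \<noteq> 0} \<subseteq> (\<lambda>x. transpose h *v x) ` closure {x. \<phi> x \<noteq> 0}"
      using compact_imp_closed[OF cpt] by (simp add: closure_minimal)
  qed
  moreover have "compact (closure {x. \<phi> (h *v x) \<noteq> 0})"
    using compact_Int_closed[OF cpt closed_closure[of "{x. \<phi> (h *v x) \<noteq> 0}"]] sub by (simp only: Int_absorb1)
  moreover have "(\<lambda>x. transpose h *v x) ` closure {x. \<phi> x \<noteq> 0} \<subseteq> S"
  proof
    fix y assume "y \<in> (\<lambda>x. transpose h *v x) ` closure {x. \<phi> x \<noteq> 0}"
    then obtain x where "x \<in> closure {x. \<phi> x \<noteq> 0}" "y = transpose h *v x" by blast
    then have "h *v y \<in> S" using C unfolding C1c_on_def by (auto simp: orth_inverse[OF orth])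
    then show "y \<in> S" by (rule S)
  qed
  ultimately show ?thesis unfolding C1c_on_def by blast
qed

lemma l2norm_sum_le:
  assumes "finite I" "\<And>j. j \<in> I \<Longrightarrow> f j \<in> L2 M"
  shows "(\<lambda>x. \<Sum>j\<in>I. f j x) \<in> L2 M \<and> l2norm M (\<lambda>x. \<Sum>j\<in>I. f j x) \<le> (\<Sum>j\<in>I. l2norm M (f j))"
  using assms
proof (induction I)
  case empty
  show ?case using L2_zero by (simp add: l2norm_def)
next
  case (insert j I)
  have "l2norm M (\<lambda>x. f j x + (\<Sum>j\<in>I. f j x)) \<le> l2norm M (f j) + l2norm M (\<lambda>x. \<Sum>j\<in>I. f j x)"
    using insert by (intro l2norm_triangle) auto
  then show ?case using insert L2_add[of "f j" M "\<lambda>x. \<Sum>j\<in>I. f j x"] by auto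
qed

section \<open>Weak gradients and traces under an orthogonal map\<close>

context
  fixes h :: "real^'n^'n" and \<Omega> :: "(real^'n) set"
  assumes orth: "orthogonal_matrix h" and lip: "lipschitz_domain \<Omega>"
    and inv: "\<And>x. h *v x \<in> \<Omega> \<longleftrightarrow> x \<in> \<Omega>"
begin

lemma measure_preserving_domain: "measure_preserving (lebesgue_on \<Omega>) (\<lambda>x. h *v x)"
  and measure_preserving_bdry: "measure_preserving (bdry_measure \<Omega>) (\<lambda>x. h *v x)"
  using measure_preserving_lebesgue_on_orth[OF orth inv] measure_preserving_bdry_orth[OF orth inv] lip
  by (auto simp: lipschitz_domain_def)

lemma orth_sum: "(\<Sum>j\<in>UNIV. h $ j $ i * h $ j $ k) = (if i = k then 1 else 0)"
proof -
  have "(transpose h ** h) $ i $ k = mat 1 $ i $ k" using orth by (simp add: orthogonal_matrix_def)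
  then show ?thesis by (simp add: matrix_matrix_mult_def transpose_def mat_def)
qed

text \<open>Testing the composed function against \<phi> amounts, after the measure-preserving
  change of variables, to testing \<open>u\<close> against \<phi> composed with the inverse. The
  weak identity for \<open>u\<close> is applied there and carried back.\<close>

lemma weak_grad_pull:
  assumes u: "weak_grad \<Omega> u w"
  shows "weak_grad \<Omega> (\<lambda>x. u (h *v x)) (grad_pull h w)"
proof -
  let ?l = "lebesgue_on \<Omega>"
  have L: "u \<in> L2 ?l" "\<And>i. (\<lambda>x. w x $ i) \<in> L2 ?l" using u by (auto simp: weak_grad_def)
  have Lw: "(\<lambda>x. w (h *v x) $ i) \<in> L2 ?l" for i by (rule measure_preserving_L2(1)[OF measure_preserving_domain L(2)])
  have "(LINT x|?l. u (h *v x) * D x $ i) = - (LINT x|?l. grad_pull h w x $ i * \<phi> x)"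
    if phi: "C1c_on \<Omega> \<phi> D" for \<phi> D i
  proof -
    define \<psi> where "\<psi> = (\<lambda>x. \<phi> (transpose h *v x))"
    define E where "E = grad_pull (transpose h) D"
    have psi: "C1c_on \<Omega> \<psi> E" unfolding \<psi>_def E_def
    proof (rule C1c_pull[OF _ phi])
      show "orthogonal_matrix (transpose h)" using orth by simp
      show "x \<in> \<Omega>" if "transpose h *v x \<in> \<Omega>" for x
        using inv[of "transpose h *v x"] that by (simp add: orth_inverse[OF orth])
    qed
    note T = C1_L2[OF lip C1c_on_imp_C1_with[OF psi]]
    note T\<phi> = C1_L2[OF lip C1c_on_imp_C1_with[OF phi]]
    \<comment> \<open>The chain rule inverted: orthogonality of the columns of \<open>h\<close>
      expresses each partial derivative of \<phi> by those of \<psi>.\<close>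
    have DE: "D x $ i = (\<Sum>j\<in>UNIV. complex_of_real (h $ j $ i) * E (h *v x) $ j)" for x
    proof -
      have "(\<Sum>j\<in>UNIV. complex_of_real (h $ j $ i) * E (h *v x) $ j)
        = (\<Sum>j\<in>UNIV. \<Sum>k\<in>UNIV. complex_of_real (h $ j $ i * h $ j $ k) * D x $ k)"
        unfolding E_def grad_pull_nth orth_inverse[OF orth] by (simp add: transpose_def sum_distrib_left mult.assoc)
      also have "\<dots> = (\<Sum>k\<in>UNIV. \<Sum>j\<in>UNIV. complex_of_real (h $ j $ i * h $ j $ k) * D x $ k)"
        by (rule sum.swap)
      also have "\<dots> = (\<Sum>k\<in>UNIV. complex_of_real (\<Sum>j\<in>UNIV. h $ j $ i * h $ j $ k) * D x $ k)"
        by (simp add: sum_distrib_right)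
      also have "\<dots> = (\<Sum>k\<in>UNIV. if k = i then D x $ k else 0)"
        unfolding orth_sum by (intro sum.cong) auto
      finally show ?thesis by simp
    qed
    have int: "integrable ?l (\<lambda>x. u x * E x $ j)" "integrable ?l (\<lambda>x. w x $ j * \<psi> x)"
      "integrable ?l (\<lambda>x. w (h *v x) $ j * \<phi> x)" for j
      by (rule L2_integrable_mult'[OF L(1) T(2)] L2_integrable_mult'[OF L(2) T(1)] L2_integrable_mult'[OF Lw T\<phi>(1)])+
    have "(LINT x|?l. u (h *v x) * D x $ i)
        = (LINT x|?l. (\<lambda>y. \<Sum>j\<in>UNIV. complex_of_real (h $ j $ i) * (u y * E y $ j)) (h *v x))"
      unfolding DE by (simp add: sum_distrib_left mult.left_commute)
    also have "\<dots> = (LINT y|?l. (\<Sum>j\<in>UNIV. complex_of_real (h $ j $ i) * (u y * E y $ j)))"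
      by (intro measure_preserving_integral measure_preserving_domain borel_measurable_integrable
          Bochner_Integration.integrable_sum integrable_mult_right int)
    also have "\<dots> = (\<Sum>j\<in>UNIV. complex_of_real (h $ j $ i) * (LINT y|?l. u y * E y $ j))"
      using int by simp
    also have "\<dots> = (\<Sum>j\<in>UNIV. complex_of_real (h $ j $ i) * - (LINT y|?l. w y $ j * \<psi> y))"
      using u psi by (simp add: weak_grad_def)
    also have "\<dots> = (\<Sum>j\<in>UNIV. complex_of_real (h $ j $ i) * - (LINT x|?l. w (h *v x) $ j * \<phi> x))"
    proof -
      have "(LINT y|?l. w y $ j * \<psi> y) = (LINT x|?l. (\<lambda>y. w y $ j * \<psi> y) (h *v x))" for j
        by (intro measure_preserving_integral[symmetric] measure_preserving_domain borel_measurable_integrable int)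
      then show ?thesis unfolding \<psi>_def by (simp add: orth_inverse[OF orth])
    qed
    also have "\<dots> = - (\<Sum>j\<in>UNIV. (LINT x|?l. complex_of_real (h $ j $ i) * (w (h *v x) $ j * \<phi> x)))"
      by (simp add: sum_negf)
    also have "\<dots> = - (LINT x|?l. (\<Sum>j\<in>UNIV. complex_of_real (h $ j $ i) * (w (h *v x) $ j * \<phi> x)))"
      using int by (subst Bochner_Integration.integral_sum) auto
    also have "\<dots> = - (LINT x|?l. grad_pull h w x $ i * \<phi> x)"
      by (simp add: grad_pull_nth sum_distrib_right mult.assoc)
    finally show ?thesis .
  qed
  moreover have "(\<lambda>x. grad_pull h w x $ i) \<in> L2 ?l" for i
    unfolding grad_pull_nth by (rule conjunct1[OF l2norm_sum_le]) (simp, rule L2_cmult, rule Lw)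
  ultimately show ?thesis unfolding weak_grad_def
    using measure_preserving_L2(1)[OF measure_preserving_domain L(1)] by auto
qed

lemma h1_triple_pull:
  assumes t: "h1_triple \<Omega> u w g"
  shows "h1_triple \<Omega> (\<lambda>x. u (h *v x)) (grad_pull h w) (\<lambda>x. g (h *v x))"
proof -
  let ?l = "lebesgue_on \<Omega>" and ?\<sigma> = "bdry_measure \<Omega>"
  note mp = measure_preserving_domain measure_preserving_bdry
  obtain \<phi>s Ds where p: "\<And>k. C1c_on UNIV (\<phi>s k) (Ds k)"
    "(\<lambda>k. l2norm ?l (\<lambda>x. \<phi>s k x - u x)) \<longlonglongrightarrow> 0"
    "\<And>i. (\<lambda>k. l2norm ?l (\<lambda>x. Ds k x $ i - w x $ i)) \<longlonglongrightarrow> 0"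
    "(\<lambda>k. l2norm ?\<sigma> (\<lambda>x. \<phi>s k x - g x)) \<longlonglongrightarrow> 0"
    using t unfolding h1_triple_def by blast
  note d = h1_tripleD[OF t]
  note L = C1_L2[OF lip C1c_on_imp_C1_with[OF p(1)]]
  show ?thesis unfolding h1_triple_def
  proof (intro conjI exI allI)
    show "weak_grad \<Omega> (\<lambda>x. u (h *v x)) (grad_pull h w)" by (rule weak_grad_pull[OF d(1)])
    show "(\<lambda>x. g (h *v x)) \<in> L2 ?\<sigma>" by (rule measure_preserving_L2[OF mp(2) d(2)])
    show "C1c_on UNIV (\<lambda>x. \<phi>s k (h *v x)) (grad_pull h (Ds k))" for k by (rule C1c_pull[OF orth p(1)]) simp
    show "(\<lambda>k. l2norm ?l (\<lambda>x. \<phi>s k (h *v x) - u (h *v x))) \<longlonglongrightarrow> 0"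
      using p(2) measure_preserving_L2(2)[OF mp(1) L2_diff[OF L(1) d(3)]] by simp
    show "(\<lambda>k. l2norm ?\<sigma> (\<lambda>x. \<phi>s k (h *v x) - g (h *v x))) \<longlonglongrightarrow> 0"
      using p(4) measure_preserving_L2(2)[OF mp(2) L2_diff[OF L(3) d(2)]] by simp
    fix i
    show "(\<lambda>k. l2norm ?l (\<lambda>x. grad_pull h (Ds k) x $ i - grad_pull h w x $ i)) \<longlonglongrightarrow> 0"
    proof (rule Lim_null_comparison)
      show "(\<lambda>k. \<Sum>j\<in>UNIV. \<bar>h $ j $ i\<bar> * l2norm ?l (\<lambda>x. Ds k x $ j - w x $ j)) \<longlonglongrightarrow> 0"
        by (intro tendsto_null_sum tendsto_mult_right_zero p(3))
      have "l2norm ?l (\<lambda>x. grad_pull h (Ds k) x $ i - grad_pull h w x $ i)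
        \<le> (\<Sum>j\<in>UNIV. \<bar>h $ j $ i\<bar> * l2norm ?l (\<lambda>x. Ds k x $ j - w x $ j))" for k
      proof -
        let ?f = "\<lambda>j x. complex_of_real (h $ j $ i) * (Ds k (h *v x) $ j - w (h *v x) $ j)"
        note m = measure_preserving_L2[OF mp(1) L2_diff[OF L(2) d(4)]]
        have "(\<lambda>x. grad_pull h (Ds k) x $ i - grad_pull h w x $ i) = (\<lambda>x. \<Sum>j\<in>UNIV. ?f j x)"
          by (simp add: grad_pull_nth sum_subtractf right_diff_distrib)
        moreover have "l2norm ?l (\<lambda>x. \<Sum>j\<in>UNIV. ?f j x) \<le> (\<Sum>j\<in>UNIV. l2norm ?l (?f j))"
          by (rule conjunct2[OF l2norm_sum_le]) (simp, rule L2_cmult, rule m(1))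
        moreover have "l2norm ?l (?f j) = \<bar>h $ j $ i\<bar> * l2norm ?l (\<lambda>x. Ds k x $ j - w x $ j)" for j
          using m(2)[of k j j] by (simp add: l2norm_cmult)
        ultimately show ?thesis by simp
      qed
      then show "\<forall>\<^sub>F k in sequentially. norm (l2norm ?l (\<lambda>x. grad_pull h (Ds k) x $ i - grad_pull h w x $ i))
        \<le> (\<Sum>j\<in>UNIV. \<bar>h $ j $ i\<bar> * l2norm ?l (\<lambda>x. Ds k x $ j - w x $ j))" by simp
    qed
  qed
qed

end

section \<open>The form and its spectrum\<close>

lemma sum_swap_pairs:
  fixes t :: "'i \<Rightarrow> 'k \<Rightarrow> 'l \<Rightarrow> 'j \<Rightarrow> 'm::comm_monoid_add"
  shows "(\<Sum>i\<in>I. \<Sum>k\<in>K. \<Sum>j\<in>J. \<Sum>l\<in>L. t i k l j) = (\<Sum>l\<in>L. \<Sum>j\<in>J. \<Sum>i\<in>I. \<Sum>k\<in>K. t i k l j)"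
proof -
  have "(\<Sum>i\<in>I. \<Sum>k\<in>K. \<Sum>j\<in>J. \<Sum>l\<in>L. t i k l j) = (\<Sum>i\<in>I. \<Sum>j\<in>J. \<Sum>k\<in>K. \<Sum>l\<in>L. t i k l j)"
    by (rule sum.cong[OF refl], rule sum.swap)
  also have "\<dots> = (\<Sum>j\<in>J. \<Sum>i\<in>I. \<Sum>k\<in>K. \<Sum>l\<in>L. t i k l j)"
    by (rule sum.swap)
  also have "\<dots> = (\<Sum>j\<in>J. \<Sum>i\<in>I. \<Sum>l\<in>L. \<Sum>k\<in>K. t i k l j)"
    by (rule sum.cong[OF refl], rule sum.cong[OF refl], rule sum.swap)
  also have "\<dots> = (\<Sum>j\<in>J. \<Sum>l\<in>L. \<Sum>i\<in>I. \<Sum>k\<in>K. t i k l j)"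
    by (rule sum.cong[OF refl], rule sum.swap)
  also have "\<dots> = (\<Sum>l\<in>L. \<Sum>j\<in>J. \<Sum>i\<in>I. \<Sum>k\<in>K. t i k l j)"
    by (rule sum.swap)
  finally show ?thesis .
qed

definition dirichlet :: "(real^'n) set \<Rightarrow> (real^'n \<Rightarrow> real^'n^'n) \<Rightarrow> (real^'n \<Rightarrow> complex^'n) \<Rightarrow> (real^'n \<Rightarrow> complex^'n) \<Rightarrow> complex" where
  "dirichlet \<Omega> A w z = (LINT x|lebesgue_on \<Omega>. (\<Sum>i\<in>UNIV. \<Sum>j\<in>UNIV.
      complex_of_real (A x $ i $ j) * w x $ j * cnj (z x $ i)))"

text \<open>Takes gradients and traces as separate arguments instead of the functions, since a
  function determines them only up to null sets.\<close>

definition robin_form :: "(real^'n) set \<Rightarrow> (real^'n \<Rightarrow> real^'n^'n) \<Rightarrow> ((real^'n \<Rightarrow> complex) \<Rightarrow> (real^'n \<Rightarrow> complex)) \<Rightarrow>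
    (real^'n \<Rightarrow> complex^'n) \<Rightarrow> (real^'n \<Rightarrow> complex) \<Rightarrow> (real^'n \<Rightarrow> complex^'n) \<Rightarrow> (real^'n \<Rightarrow> complex) \<Rightarrow> complex" where
  "robin_form \<Omega> A B w g z k = dirichlet \<Omega> A w z + l2inner (bdry_measure \<Omega>) (B g) k"

lemma LB_rel_robin_form:
  assumes "LB_rel \<Omega> A B u f" "h1_triple \<Omega> u w g" "h1_triple \<Omega> v z k"
  shows "robin_form \<Omega> A B w g z k = l2inner (lebesgue_on \<Omega>) f v"
  using assms h1_tripleD[OF assms(2)] h1_tripleD[OF assms(3)]
  unfolding LB_rel_def robin_form_def dirichlet_def by blast

lemma L2_bounded_mult:
  assumes f: "f \<in> L2 M" and [measurable]: "a \<in> borel_measurable M" and a: "\<And>x. x \<in> space M \<Longrightarrow> \<bar>a x\<bar> \<le> b"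
  shows "(\<lambda>x. complex_of_real (a x) * f x) \<in> L2 M"
proof -
  have [measurable]: "f \<in> borel_measurable M" by (rule L2_measurable[OF f])
  have "integrable M (\<lambda>x. (cmod (complex_of_real (a x) * f x))\<^sup>2)"
  proof (rule Bochner_Integration.integrable_bound)
    show "integrable M (\<lambda>x. b\<^sup>2 * (cmod (f x))\<^sup>2)" using L2_integrable_square[OF f] by simp
    show "AE x in M. norm ((cmod (complex_of_real (a x) * f x))\<^sup>2) \<le> norm (b\<^sup>2 * (cmod (f x))\<^sup>2)"
    proof (rule AE_I2)
      fix x assume "x \<in> space M"
      then have "\<bar>a x\<bar>\<^sup>2 \<le> b\<^sup>2" by (intro power_mono a) auto
      then show "norm ((cmod (complex_of_real (a x) * f x))\<^sup>2) \<le> norm (b\<^sup>2 * (cmod (f x))\<^sup>2)"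
        by (simp add: norm_mult power_mult_distrib mult_right_mono)
    qed
  qed measurable
  then show ?thesis by (simp add: L2_def)
qed

abbreviation L2_field :: "(real^'n) set \<Rightarrow> (real^'n \<Rightarrow> complex^'n) \<Rightarrow> bool" where
  "L2_field \<Omega> w \<equiv> (\<forall>i. (\<lambda>x. w x $ i) \<in> L2 (lebesgue_on \<Omega>))"

lemma in_resolvent_imp_trace:
  assumes lip: "lipschitz_domain \<Omega>" and res: "in_resolvent (lebesgue_on \<Omega>) (negLB_rel \<Omega> A B) z" and u: "u \<in> H1 \<Omega>"
  shows "\<exists>g. trace_rel \<Omega> u g"
proof (rule ccontr)
  text \<open>Otherwise the identity defining the operator is vacuous at \<open>u\<close> and at \<open>2 u\<close>, so
    that both solve the resolvent equation with right-hand side 0.\<close>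
  assume no: "\<not> ?thesis"
  let ?l = "lebesgue_on \<Omega>"
  obtain w where w: "weak_grad \<Omega> u w" using u by (auto simp: H1_def)
  then have uL: "u \<in> L2 ?l" by (simp add: weak_grad_def)
  define v where "v = (\<lambda>x. u x + 1 * u x)"
  have vL: "v \<in> L2 ?l" unfolding v_def by (rule L2_lincomb[OF uL uL])
  have vH: "v \<in> H1 \<Omega>" unfolding v_def H1_def using weak_grad_lincomb[OF lip w w] by blast
  have nov: "\<not> trace_rel \<Omega> v g" for g
  proof
    assume "trace_rel \<Omega> v g"
    then obtain z where "h1_triple \<Omega> v z g" unfolding trace_rel_iff_h1_triple by blast
    from h1_triple_lincomb[OF lip this this, of "- (1/2)"]
    have "trace_rel \<Omega> (\<lambda>x. v x + - (1/2) * v x) (\<lambda>x. g x + - (1/2) * g x)"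
      unfolding trace_rel_iff_h1_triple by blast
    moreover have "(\<lambda>x. v x + - (1/2) * v x) = u" unfolding v_def by (auto simp: field_simps)
    ultimately show False using no by auto
  qed
  have R: "negLB_rel \<Omega> A B y (\<lambda>x. 0 + z * y x)" if "y \<in> H1 \<Omega>" "\<And>g. \<not> trace_rel \<Omega> y g" "y \<in> L2 ?l" for y
    unfolding negLB_rel_def LB_rel_def using that L2_uminus[OF L2_cmult[OF that(3), of z]] by auto
  \<comment> \<open>Uniqueness in the resolvent condition forces \<open>u = 2 u\<close> almost
    everywhere, so \<open>u\<close> is null and has trace 0 after all.\<close>
  have "AE x in ?l. u x = v x"
    using res R[OF u _ uL] R[OF vH nov vL] no uL vL L2_zero unfolding in_resolvent_def by blast
  then have "AE x in ?l. u x = 0" by eventually_elim (simp add: v_def)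
  then show False using h1_triple_null[OF uL] no unfolding trace_rel_iff_h1_triple by blast
qed

section \<open>The form under the hypotheses, and its spectral consequences\<close>

context
  fixes \<Omega> :: "(real^'n) set" and \<alpha> :: real and G :: "(real^'n^'n) set" and A B
  assumes lip: "lipschitz_domain \<Omega>" and \<alpha>: "\<alpha> > 0" and hyps: "thm_hyps \<Omega> \<alpha> G A B"
begin

lemma coeff: "coeff_ok \<Omega> \<alpha> G A" and bounded_B: "bounded_L2_op (bdry_measure \<Omega>) B"
  and selfadj_B: "self_adjoint_L2 (bdry_measure \<Omega>) B" and equivariant_B: "G_equivariant \<Omega> G B"
  and negative_B: "Re (l2inner (bdry_measure \<Omega>) (B (\<lambda>_. 1)) (\<lambda>_. 1)) < 0"
  using hyps unfolding thm_hyps_def by auto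

lemma A_mult_L2:
  assumes "f \<in> L2 (lebesgue_on \<Omega>)"
  shows "(\<lambda>x. complex_of_real (A x $ i $ j) * f x) \<in> L2 (lebesgue_on \<Omega>)"
proof -
  obtain b where "\<forall>x\<in>\<Omega>. \<forall>i j. \<bar>A x $ i $ j\<bar> \<le> b" using coeff unfolding coeff_ok_def by blast
  then show ?thesis using coeff unfolding coeff_ok_def
    by (intro L2_bounded_mult[OF assms, of _ b]) (auto simp: space_restrict_space)
qed

lemma dirichlet_integrable:
  assumes "L2_field \<Omega> w" "L2_field \<Omega> z"
  shows "integrable (lebesgue_on \<Omega>) (\<lambda>x. complex_of_real (A x $ i $ j) * w x $ j * cnj (z x $ i))"
  using L2_integrable_mult(1)[OF A_mult_L2] assms by blast

lemma dirichlet_lincomb_left: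
  assumes "L2_field \<Omega> w" "L2_field \<Omega> w'" "L2_field \<Omega> z"
  shows "dirichlet \<Omega> A (\<lambda>x. \<chi> i. w x $ i + c * w' x $ i) z = dirichlet \<Omega> A w z + c * dirichlet \<Omega> A w' z"
proof -
  have "dirichlet \<Omega> A (\<lambda>x. \<chi> i. w x $ i + c * w' x $ i) z
    = (LINT x|lebesgue_on \<Omega>. (\<Sum>i\<in>UNIV. \<Sum>j\<in>UNIV. complex_of_real (A x $ i $ j) * w x $ j * cnj (z x $ i))
        + c * (\<Sum>i\<in>UNIV. \<Sum>j\<in>UNIV. complex_of_real (A x $ i $ j) * w' x $ j * cnj (z x $ i)))"
    unfolding dirichlet_def
    by (intro Bochner_Integration.integral_cong refl)
       (simp add: sum_distrib_left sum.distrib[symmetric] algebra_simps)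
  also have "\<dots> = dirichlet \<Omega> A w z + c * dirichlet \<Omega> A w' z"
    unfolding dirichlet_def using dirichlet_integrable[OF assms(1,3)] dirichlet_integrable[OF assms(2,3)]
    by (subst Bochner_Integration.integral_add) auto
  finally show ?thesis .
qed

lemma dirichlet_hermitian: "dirichlet \<Omega> A w z = cnj (dirichlet \<Omega> A z w)"
proof -
  have sym: "A x $ i $ j = A x $ j $ i" if "x \<in> \<Omega>" for x i j
  proof -
    have "transpose (A x) = A x" using coeff that unfolding coeff_ok_def by blast
    then have "transpose (A x) $ i $ j = A x $ i $ j" by simp
    then show ?thesis by (simp add: transpose_def)
  qed
  have "cnj (dirichlet \<Omega> A z w) = (LINT x|lebesgue_on \<Omega>. cnj (\<Sum>i\<in>UNIV. \<Sum>j\<in>UNIV.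
      complex_of_real (A x $ i $ j) * z x $ j * cnj (w x $ i)))"
    unfolding dirichlet_def by (simp only: Bochner_Integration.integral_cnj)
  also have "\<dots> = dirichlet \<Omega> A w z"
    unfolding dirichlet_def
  proof (intro Bochner_Integration.integral_cong refl)
    fix x assume "x \<in> space (lebesgue_on \<Omega>)"
    then have x: "x \<in> \<Omega>" by simp
    have "cnj (\<Sum>i\<in>UNIV. \<Sum>j\<in>UNIV. complex_of_real (A x $ i $ j) * z x $ j * cnj (w x $ i))
      = (\<Sum>i\<in>UNIV. \<Sum>j\<in>UNIV. complex_of_real (A x $ j $ i) * w x $ i * cnj (z x $ j))"
      by (simp add: sym[OF x] mult_ac)
    also have "\<dots> = (\<Sum>j\<in>UNIV. \<Sum>i\<in>UNIV. complex_of_real (A x $ j $ i) * w x $ i * cnj (z x $ j))"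
      by (rule sum.swap)
    finally show "cnj (\<Sum>i\<in>UNIV. \<Sum>j\<in>UNIV. complex_of_real (A x $ i $ j) * z x $ j * cnj (w x $ i))
      = (\<Sum>i\<in>UNIV. \<Sum>j\<in>UNIV. complex_of_real (A x $ i $ j) * w x $ j * cnj (z x $ i))" .
  qed
  finally show ?thesis by simp
qed

lemma dirichlet_coercive:
  assumes w: "L2_field \<Omega> w"
  shows "\<alpha> * grad_sq \<Omega> w \<le> Re (dirichlet \<Omega> A w w)"
proof -
  let ?F = "\<lambda>x. \<Sum>i\<in>UNIV. \<Sum>j\<in>UNIV. complex_of_real (A x $ i $ j) * w x $ j * cnj (w x $ i)"
  have F: "integrable (lebesgue_on \<Omega>) ?F"
    by (intro Bochner_Integration.integrable_sum dirichlet_integrable w)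
  have sq: "integrable (lebesgue_on \<Omega>) (\<lambda>x. (cmod (w x $ i))\<^sup>2)" for i
    using w by (intro L2_integrable_square) auto
  have "\<alpha> * grad_sq \<Omega> w = (LINT x|lebesgue_on \<Omega>. \<alpha> * (\<Sum>i\<in>UNIV. (cmod (w x $ i))\<^sup>2))"
    unfolding grad_sq_def l2norm_square using sq by simp
  also have "\<dots> \<le> (LINT x|lebesgue_on \<Omega>. Re (?F x))"
  proof (rule integral_mono)
    show "integrable (lebesgue_on \<Omega>) (\<lambda>x. \<alpha> * (\<Sum>i\<in>UNIV. (cmod (w x $ i))\<^sup>2))" using sq by auto
    show "integrable (lebesgue_on \<Omega>) (\<lambda>x. Re (?F x))" using F by (rule integrable_Re)
    fix x assume "x \<in> space (lebesgue_on \<Omega>)"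
    then have "\<alpha> * (norm (w x))\<^sup>2 \<le> Re (\<Sum>i\<in>UNIV. \<Sum>j\<in>UNIV. cnj (w x $ i) * complex_of_real (A x $ i $ j) * w x $ j)"
      using coeff unfolding coeff_ok_def by auto
    also have "(\<Sum>i\<in>UNIV. \<Sum>j\<in>UNIV. cnj (w x $ i) * complex_of_real (A x $ i $ j) * w x $ j) = ?F x"
      by (simp add: mult_ac)
    finally show "\<alpha> * (\<Sum>i\<in>UNIV. (cmod (w x $ i))\<^sup>2) \<le> Re (?F x)"
      by (simp add: norm_vec_def L2_set_def sum_nonneg)
  qed
  also have "\<dots> = Re (dirichlet \<Omega> A w w)" unfolding dirichlet_def by (rule integral_Re[OF F])
  finally show ?thesis .
qed

lemma B_L2: "g \<in> L2 (bdry_measure \<Omega>) \<Longrightarrow> B g \<in> L2 (bdry_measure \<Omega>)"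
  using bounded_B unfolding bounded_L2_op_def by blast

lemma B_lincomb:
  assumes "g \<in> L2 (bdry_measure \<Omega>)" "g' \<in> L2 (bdry_measure \<Omega>)" "k \<in> L2 (bdry_measure \<Omega>)"
  shows "l2inner (bdry_measure \<Omega>) (B (\<lambda>x. g x + c * g' x)) k
    = l2inner (bdry_measure \<Omega>) (B g) k + c * l2inner (bdry_measure \<Omega>) (B g') k"
proof -
  have "AE x in bdry_measure \<Omega>. B (\<lambda>y. c * g' y + g y) x = c * B g' x + B g x"
    using bounded_B assms unfolding bounded_L2_op_def by blast
  then have "AE x in bdry_measure \<Omega>. B (\<lambda>y. g y + c * g' y) x = B g x + c * B g' x"
    by (simp add: add.commute)
  then have "l2inner (bdry_measure \<Omega>) (B (\<lambda>x. g x + c * g' x)) k = l2inner (bdry_measure \<Omega>) (\<lambda>x. B g x + c * B g' x) k"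
    by (rule l2inner_cong_AE) (intro L2_measurable B_L2 L2_lincomb assms)+
  then show ?thesis using l2inner_lincomb_left[OF B_L2[OF assms(1)] B_L2[OF assms(2)] assms(3)] by simp
qed

lemma robin_form_hermitian:
  assumes "h1_triple \<Omega> u w g" "h1_triple \<Omega> v z k"
  shows "robin_form \<Omega> A B w g z k = cnj (robin_form \<Omega> A B z k w g)"
proof -
  have "l2inner (bdry_measure \<Omega>) (B g) k = l2inner (bdry_measure \<Omega>) g (B k)"
    using selfadj_B h1_tripleD(2)[OF assms(1)] h1_tripleD(2)[OF assms(2)] unfolding self_adjoint_L2_def by blast
  also have "\<dots> = cnj (l2inner (bdry_measure \<Omega>) (B k) g)" by (rule l2inner_commute)
  finally show ?thesis unfolding robin_form_def using dirichlet_hermitian[of w z] by simp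
qed

lemma robin_form_lincomb_left:
  assumes "h1_triple \<Omega> u w g" "h1_triple \<Omega> u' w' g'" "h1_triple \<Omega> v z k"
  shows "robin_form \<Omega> A B (\<lambda>x. \<chi> i. w x $ i + c * w' x $ i) (\<lambda>x. g x + c * g' x) z k
    = robin_form \<Omega> A B w g z k + c * robin_form \<Omega> A B w' g' z k"
  unfolding robin_form_def
  using dirichlet_lincomb_left[of w w' z c] B_lincomb[of g g' k c]
    h1_tripleD[OF assms(1)] h1_tripleD[OF assms(2)] h1_tripleD[OF assms(3)]
  by (simp add: distrib_left)

text \<open>For real \<open>c\<close> the value on the combination is a real quadratic polynomial in
  \<open>c\<close>: hermitian symmetry merges the two cross terms. It is used once with a small step
  towards a resolvent image and once with \<open>c = -1\<close> for a difference.\<close>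

lemma robin_form_expand:
  fixes c :: real
  assumes t: "h1_triple \<Omega> u w g" and t': "h1_triple \<Omega> u' w' g'"
  defines "z \<equiv> (\<lambda>x. \<chi> i. w x $ i + complex_of_real c * w' x $ i)" and "k \<equiv> (\<lambda>x. g x + complex_of_real c * g' x)"
  shows "Re (robin_form \<Omega> A B z k z k) = Re (robin_form \<Omega> A B w g w g)
    + 2 * c * Re (robin_form \<Omega> A B w' g' w g) + c\<^sup>2 * Re (robin_form \<Omega> A B w' g' w' g')"
proof -
  have tz: "h1_triple \<Omega> (\<lambda>x. u x + complex_of_real c * u' x) z k"
    unfolding z_def k_def by (rule h1_triple_lincomb[OF lip t t'])
  note l = robin_form_lincomb_left[OF t t', of _ _ _ "complex_of_real c", folded z_def k_def]
  have s: "Re (robin_form \<Omega> A B w' g' w g) = Re (robin_form \<Omega> A B w g w' g')"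
    using robin_form_hermitian[OF t t'] by simp
  have "Re (robin_form \<Omega> A B z k z k) = Re (robin_form \<Omega> A B w g z k) + c * Re (robin_form \<Omega> A B w' g' z k)"
    using l[OF tz] by simp
  also have "Re (robin_form \<Omega> A B w g z k) = Re (robin_form \<Omega> A B z k w g)"
    using robin_form_hermitian[OF t tz] by simp
  also have "\<dots> = Re (robin_form \<Omega> A B w g w g) + c * Re (robin_form \<Omega> A B w' g' w g)" using l[OF t] by simp
  also have "Re (robin_form \<Omega> A B w' g' z k) = Re (robin_form \<Omega> A B z k w' g')"
    using robin_form_hermitian[OF t' tz] by simp
  also have "\<dots> = Re (robin_form \<Omega> A B w g w' g') + c * Re (robin_form \<Omega> A B w' g' w' g')" using l[OF t'] by simp
  finally show ?thesis using s by (simp add: algebra_simps power2_eq_square)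
qed

text \<open>The bound \<open>K\<close> is required at this one trace \<open>g\<close> only. It is
  supplied by the operator norm in general, and by the restricted norm when the trace has mean
  zero.\<close>

lemma robin_form_ge:
  assumes t: "h1_triple \<Omega> u w g" and "l2norm (bdry_measure \<Omega>) (B g) \<le> K * l2norm (bdry_measure \<Omega>) g"
  shows "\<alpha> * grad_sq \<Omega> w - K * (l2norm (bdry_measure \<Omega>) g)\<^sup>2 \<le> Re (robin_form \<Omega> A B w g w g)"
proof -
  let ?\<sigma> = "bdry_measure \<Omega>"
  have g: "g \<in> L2 ?\<sigma>" by (rule h1_tripleD[OF t])
  have "- Re (l2inner ?\<sigma> (B g) g) \<le> cmod (l2inner ?\<sigma> (B g) g)"
    using abs_Re_le_cmod[of "l2inner ?\<sigma> (B g) g"] by linarith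
  also have "\<dots> \<le> l2norm ?\<sigma> (B g) * l2norm ?\<sigma> g" by (rule l2inner_Cauchy_Schwarz[OF B_L2[OF g] g])
  also have "\<dots> \<le> K * l2norm ?\<sigma> g * l2norm ?\<sigma> g" by (intro mult_right_mono assms(2)) simp
  finally have "- Re (l2inner ?\<sigma> (B g) g) \<le> K * (l2norm ?\<sigma> g)\<^sup>2" by (simp add: power2_eq_square mult.assoc)
  moreover have "\<alpha> * grad_sq \<Omega> w \<le> Re (dirichlet \<Omega> A w w)"
    by (rule dirichlet_coercive) (use h1_tripleD(4)[OF t] in auto)
  ultimately show ?thesis unfolding robin_form_def by simp
qed

abbreviation (input) "vol \<equiv> lebesgue_on \<Omega>"
abbreviation (input) "bdry \<equiv> bdry_measure \<Omega>"
abbreviation (input) "aform \<equiv> robin_form \<Omega> A B"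

text \<open>The trace inequality is taken with \<epsilon>\<open>=\<close>\<alpha>\<open>/ K\<close>,
  so that the boundary term, which carries the factor \<open>K\<close>, uses up exactly the elliptic
  term; what is left is a multiple of the norm of \<open>u\<close>.\<close>

lemma robin_form_bounded_below:
  "\<exists>l\<ge>0. \<forall>u w g. h1_triple \<Omega> u w g \<longrightarrow> 0 \<le> Re (aform w g w g) + l * (l2norm vol u)\<^sup>2"
proof -
  obtain K0 where K0: "\<forall>f\<in>L2 bdry. l2norm bdry (B f) \<le> K0 * l2norm bdry f"
    using bounded_B unfolding bounded_L2_op_def by blast
  define K where "K = \<bar>K0\<bar> + 1"
  have K: "l2norm bdry (B f) \<le> K * l2norm bdry f" if "f \<in> L2 bdry" for f
  proof -
    have "K0 * l2norm bdry f \<le> K * l2norm bdry f" unfolding K_def by (intro mult_right_mono) auto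
    then show "l2norm bdry (B f) \<le> K * l2norm bdry f" using K0 that by force
  qed
  have K_pos: "K > 0" by (simp add: K_def)
  obtain C where C: "C \<ge> 0" "\<And>u w g. h1_triple \<Omega> u w g \<Longrightarrow>
    (l2norm bdry g)\<^sup>2 \<le> \<alpha> / K * grad_sq \<Omega> w + C * (l2norm vol u)\<^sup>2"
    using h1_triple_trace_inequality[OF lip, of "\<alpha> / K"] \<alpha> K_pos by (metis divide_pos_pos)
  show ?thesis
  proof (intro exI[of _ "K * C"] conjI allI impI)
    show "0 \<le> K * C" using K_pos C by simp
    fix u w g assume t: "h1_triple \<Omega> u w g"
    have "K * (l2norm bdry g)\<^sup>2 \<le> K * (\<alpha> / K * grad_sq \<Omega> w + C * (l2norm vol u)\<^sup>2)"
      using C(2)[OF t] K_pos by (intro mult_left_mono) auto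
    also have "\<dots> = \<alpha> * grad_sq \<Omega> w + K * C * (l2norm vol u)\<^sup>2" using K_pos by (simp add: algebra_simps)
    finally show "0 \<le> Re (aform w g w g) + K * C * (l2norm vol u)\<^sup>2"
      using robin_form_ge[OF t K[OF h1_tripleD(2)[OF t]]] by simp
  qed
qed

text \<open>If every positive number were in the resolvent set, then the least \<open>m \<ge> 0\<close> for which the form
  shifted by \<open>m\<close> is nonnegative could be lowered: testing with \<open>u - v / K\<close>, where
  \<open>v = (L\<^sub>B + m)\<^sup>-\<^sup>1 u\<close> and \<open>K\<close> bounds the resolvent, gains \<open>1 / K\<close>.\<close>
lemma spectral_bound_pos: "spectral_bound vol (negLB_rel \<Omega> A B) > 0"
proof (rule ccontr)
  assume "\<not> ?thesis"
  then have sb: "spectral_bound vol (negLB_rel \<Omega> A B) \<le> 0" by simp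
  have res: "in_resolvent vol (negLB_rel \<Omega> A B) (complex_of_real r)" if "r > 0" for r
  proof (rule ccontr)
    assume "\<not> ?thesis"
    then have "complex_of_real r \<in> op_spectrum vol (negLB_rel \<Omega> A B)" by (simp add: op_spectrum_def)
    then have "ereal (Re (complex_of_real r)) \<le> spectral_bound vol (negLB_rel \<Omega> A B)"
      unfolding spectral_bound_def by (rule SUP_upper)
    also note sb
    finally show False using that by simp
  qed
  define nonneg where "nonneg = (\<lambda>l. \<forall>u w g. h1_triple \<Omega> u w g \<longrightarrow> 0 \<le> Re (aform w g w g) + l * (l2norm vol u)\<^sup>2)"
  define S where "S = {l. l \<ge> 0 \<and> nonneg l}"
  define m where "m = Inf S"
  have S: "S \<noteq> {}" using robin_form_bounded_below unfolding S_def nonneg_def by auto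
  have bdd: "bdd_below S" unfolding S_def by (intro bdd_belowI[of _ 0]) auto
  have m0: "m \<ge> 0" unfolding m_def using S by (intro cInf_greatest) (auto simp: S_def)
  \<comment> \<open>The infimum is attained: each triple restricts the shift to a closed half-line,
    or puts no restriction on it when \<open>u\<close> is null. In the latter case any element of
    \<open>S\<close> shows that the form value itself is nonnegative.\<close>
  have m: "nonneg m" unfolding nonneg_def
  proof (intro allI impI)
    fix u w g assume t: "h1_triple \<Omega> u w g"
    define n where "n = (l2norm vol u)\<^sup>2"
    define q where "q = Re (aform w g w g)"
    have ql: "0 \<le> q + l * n" if "l \<in> S" for l
      using that t unfolding S_def nonneg_def q_def n_def by auto
    have "0 \<le> q + m * n"
    proof (cases "n = 0")
      case True
      then show ?thesis using ql S by auto
    next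
      case False
      then have n: "n > 0" unfolding n_def by simp
      have "- q / n \<le> m" unfolding m_def
      proof (rule cInf_greatest[OF S])
        fix l assume "l \<in> S"
        from ql[OF this] show "- q / n \<le> l" using n by (simp add: field_simps)
      qed
      then show ?thesis using n by (simp add: field_simps)
    qed
    then show "0 \<le> Re (aform w g w g) + m * (l2norm vol u)\<^sup>2" unfolding q_def n_def .
  qed
  have "m \<noteq> 0"
  proof
    assume "m = 0"
    then have "0 \<le> Re (aform (\<lambda>_. 0) (\<lambda>_. 1) (\<lambda>_. 0) (\<lambda>_. 1))"
      using m h1_triple_one[OF lip] unfolding nonneg_def by force
    then show False using negative_B by (simp add: robin_form_def dirichlet_def)
  qed
  then have m_pos: "m > 0" using m0 by simp
  note rm = res[OF m_pos]
  obtain K0 where K0: "\<And>f u. f \<in> L2 vol \<Longrightarrow> u \<in> L2 vol \<Longrightarrow> negLB_rel \<Omega> A B u (\<lambda>x. f x + complex_of_real m * u x)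
      \<Longrightarrow> l2norm vol u \<le> K0 * l2norm vol f"
    using rm unfolding in_resolvent_def by blast
  define K where "K = \<bar>K0\<bar> + 1"
  have K: "K > 0" by (simp add: K_def)
  have "nonneg (m - 1 / K)" unfolding nonneg_def
  proof (intro allI impI)
    fix u w g assume t: "h1_triple \<Omega> u w g"
    note d = h1_tripleD[OF t]
    \<comment> \<open>The resolvent equation is written for the negative operator, so the right-hand
      side \<open>- u\<close> corresponds to applying the inverse of the operator plus
      \<open>m\<close> to \<open>u\<close>.\<close>
    have fL: "(\<lambda>x. - u x) \<in> L2 vol" by (rule L2_uminus[OF d(3)])
    obtain v where v: "v \<in> L2 vol" "negLB_rel \<Omega> A B v (\<lambda>x. - u x + complex_of_real m * v x)"
    proof -
      have "\<forall>f\<in>L2 vol. \<exists>v\<in>L2 vol. negLB_rel \<Omega> A B v (\<lambda>x. f x + complex_of_real m * v x)"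
        using rm unfolding in_resolvent_def by blast
      from this[rule_format, OF fL] show ?thesis using that by blast
    qed
    have LB: "LB_rel \<Omega> A B v (\<lambda>x. u x + (- complex_of_real m) * v x)"
      using v(2) unfolding negLB_rel_def by (simp add: algebra_simps)
    have "v \<in> H1 \<Omega>" using LB unfolding LB_rel_def by blast
    from in_resolvent_imp_trace[OF lip rm this] obtain wv gv where tv: "h1_triple \<Omega> v wv gv"
      unfolding trace_rel_iff_h1_triple by blast
    have "l2norm vol v \<le> K0 * l2norm vol (\<lambda>x. - u x)" by (rule K0[OF fL v])
    also have "l2norm vol (\<lambda>x. - u x) = l2norm vol u" by (simp add: l2norm_def)
    also have "K0 * l2norm vol u \<le> K * l2norm vol u" unfolding K_def by (intro mult_right_mono) auto
    finally have vK: "l2norm vol v \<le> K * l2norm vol u" .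
    define n where "n = (l2norm vol u)\<^sup>2"
    define q where "q = Re (aform w g w g)"
    \<comment> \<open>With a step \<open>t\<close> against \<open>v\<close> the shifted form changes
      by at most \<open>(K * t\<^sup>2 - 2 * t) * n\<close>, which is least at
      \<open>t = 1 / K\<close>.\<close>
    define c where "c = - (1 / K)"
    have a1: "Re (aform wv gv w g) = n - m * Re (l2inner vol v u)"
      using LB_rel_robin_form[OF LB tv t] l2inner_lincomb_left[OF d(3) v(1) d(3), of "- complex_of_real m"]
      by (simp add: n_def l2inner_self)
    have a2: "Re (aform wv gv wv gv) = Re (l2inner vol u v) - m * (l2norm vol v)\<^sup>2"
      using LB_rel_robin_form[OF LB tv tv] l2inner_lincomb_left[OF d(3) v(1) v(1), of "- complex_of_real m"]
      by (simp add: l2inner_self)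
    have "0 \<le> (q + 2 * c * Re (aform wv gv w g) + c\<^sup>2 * Re (aform wv gv wv gv))
        + m * (l2norm vol (\<lambda>x. u x + complex_of_real c * v x))\<^sup>2"
      using m h1_triple_lincomb[OF lip t tv, of "complex_of_real c"]
      unfolding nonneg_def q_def robin_form_expand[OF t tv, symmetric] by blast
    also have "\<dots> = q + m * n + 2 * c * n + c\<^sup>2 * Re (l2inner vol u v)"
      unfolding a1 a2 l2norm_lincomb_square[OF d(3) v(1)] n_def by (simp add: algebra_simps)
    finally have ineq: "0 \<le> q + m * n + 2 * c * n + c\<^sup>2 * Re (l2inner vol u v)" .
    have "Re (l2inner vol u v) \<le> l2norm vol u * l2norm vol v"
      using l2inner_Cauchy_Schwarz[OF d(3) v(1)] complex_Re_le_cmod order_trans by blast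
    also have "\<dots> \<le> l2norm vol u * (K * l2norm vol u)" by (intro mult_left_mono vK) simp
    also have "\<dots> = K * n" by (simp add: n_def power2_eq_square)
    finally have "c\<^sup>2 * Re (l2inner vol u v) \<le> c\<^sup>2 * (K * n)" by (intro mult_left_mono) auto
    also have "\<dots> = 1 / K * n" unfolding c_def using K by (simp add: power2_eq_square field_simps)
    finally have "0 \<le> q + m * n + 2 * c * n + 1 / K * n" using ineq by simp
    then show "0 \<le> Re (aform w g w g) + (m - 1 / K) * (l2norm vol u)\<^sup>2"
      unfolding q_def n_def c_def by (simp add: algebra_simps)
  qed
  \<comment> \<open>The maximum keeps the lowered shift in \<open>S\<close>, whose elements are
    nonnegative by definition. As \<open>m\<close> is positive, this is still strictly below
    \<open>m\<close>.\<close>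
  then have "nonneg (max 0 (m - 1 / K))"
    unfolding nonneg_def
    by (meson add_left_mono mult_right_mono max.cobounded2 order_trans zero_le_power2)
  then have "max 0 (m - 1 / K) \<in> S" unfolding S_def by simp
  then have "m \<le> max 0 (m - 1 / K)" unfolding m_def by (rule cInf_lower[OF _ bdd])
  then show False using m_pos K by (auto simp: max_def split: if_splits)
qed

text \<open>Each group element maps \<Omega> into itself; applying this to an element and to its
  inverse gives the equivalence needed to transport integrals and supports.\<close>

lemma group_orthogonal:
  assumes "g \<in> G"
  shows "orthogonal_matrix (matrix_inv g)" "matrix_inv g \<in> G" "matrix_inv g *v x \<in> \<Omega> \<longleftrightarrow> x \<in> \<Omega>"
proof -
  have G: "closed_orth_subgroup G" "\<And>g x. g \<in> G \<Longrightarrow> x \<in> \<Omega> \<Longrightarrow> g *v x \<in> \<Omega>"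
    using hyps unfolding thm_hyps_def by auto
  have og: "orthogonal_matrix g" using G assms unfolding closed_orth_subgroup_def by blast
  show inG: "matrix_inv g \<in> G" using G assms unfolding closed_orth_subgroup_def by blast
  then show "orthogonal_matrix (matrix_inv g)" using G unfolding closed_orth_subgroup_def by blast
  show "matrix_inv g *v x \<in> \<Omega> \<longleftrightarrow> x \<in> \<Omega>"
    using G(2)[OF inG, of x] G(2)[OF assms, of "matrix_inv g *v x"]
    by (auto simp: matrix_inv_orthogonal[OF og] orth_inverse[OF og])
qed

text \<open>Since \<open>A x\<close> commutes with the orthogonal matrix \<open>h\<close>,
  conjugation by \<open>h\<close> fixes it, and \<open>A\<close> has the same value at
  \<open>h *v x\<close>. So the integrand of the composed gradient at \<open>x\<close> is the
  original integrand at \<open>h *v x\<close>, and the change of variables preserves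
  measure.\<close>

lemma dirichlet_pull:
  assumes g: "g \<in> G" and w: "L2_field \<Omega> w"
  defines "h \<equiv> matrix_inv g"
  shows "dirichlet \<Omega> A (grad_pull h w) (grad_pull h w) = dirichlet \<Omega> A w w"
proof -
  have orth: "orthogonal_matrix h" and hG: "h \<in> G" and inv: "\<And>x. h *v x \<in> \<Omega> \<longleftrightarrow> x \<in> \<Omega>"
    using group_orthogonal[OF g] unfolding h_def by auto
  define F where "F = (\<lambda>y. \<Sum>i\<in>UNIV. \<Sum>j\<in>UNIV. complex_of_real (A y $ i $ j) * w y $ j * cnj (w y $ i))"
  have F: "F \<in> borel_measurable vol" unfolding F_def
    by (intro borel_measurable_integrable Bochner_Integration.integrable_sum dirichlet_integrable w)
  have pt: "(\<Sum>i\<in>UNIV. \<Sum>k\<in>UNIV. complex_of_real (A x $ i $ k) * grad_pull h w x $ k * cnj (grad_pull h w x $ i)) = F (h *v x)"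
    if x: "x \<in> \<Omega>" for x
  proof -
    have c: "h ** A x = A x ** h" "A (h *v x) = A x" using coeff x hG unfolding coeff_ok_def by blast+
    have hAh: "(\<Sum>i\<in>UNIV. \<Sum>k\<in>UNIV. h $ l $ i * A x $ i $ k * h $ j $ k) = A x $ l $ j" for l j
    proof -
      have "h ** A x ** transpose h = A x"
        unfolding c(1) using orth by (simp add: matrix_mul_assoc[symmetric] orthogonal_matrix_def)
      then have "(h ** A x ** transpose h) $ l $ j = A x $ l $ j" by simp
      moreover have "(h ** A x ** transpose h) $ l $ j = (\<Sum>k\<in>UNIV. \<Sum>i\<in>UNIV. h $ l $ i * A x $ i $ k * h $ j $ k)"
        by (simp add: matrix_matrix_mult_def transpose_def sum_distrib_right)
      ultimately show ?thesis using sum.swap[of "\<lambda>i k. h $ l $ i * A x $ i $ k * h $ j $ k" UNIV UNIV] by simp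
    qed
    define W where "W = w (h *v x)"
    let ?t = "\<lambda>i k l j. complex_of_real (h $ l $ i * A x $ i $ k * h $ j $ k) * (W $ j * cnj (W $ l))"
    have "(\<Sum>i\<in>UNIV. \<Sum>k\<in>UNIV. complex_of_real (A x $ i $ k) * grad_pull h w x $ k * cnj (grad_pull h w x $ i))
      = (\<Sum>i\<in>UNIV. \<Sum>k\<in>UNIV. \<Sum>j\<in>UNIV. \<Sum>l\<in>UNIV. ?t i k l j)"
      unfolding grad_pull_nth W_def[symmetric]
      by (simp add: sum_product sum_distrib_left sum_distrib_right mult_ac)
    also have "\<dots> = (\<Sum>l\<in>UNIV. \<Sum>j\<in>UNIV. \<Sum>i\<in>UNIV. \<Sum>k\<in>UNIV. ?t i k l j)"
      by (rule sum_swap_pairs)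
    also have "\<dots> = (\<Sum>l\<in>UNIV. \<Sum>j\<in>UNIV. complex_of_real (\<Sum>i\<in>UNIV. \<Sum>k\<in>UNIV. h $ l $ i * A x $ i $ k * h $ j $ k) * (W $ j * cnj (W $ l)))"
      by (simp only: of_real_sum sum_distrib_right)
    also have "\<dots> = (\<Sum>l\<in>UNIV. \<Sum>j\<in>UNIV. complex_of_real (A x $ l $ j) * (W $ j * cnj (W $ l)))"
      unfolding hAh by (rule refl)
    finally show ?thesis unfolding F_def c(2) W_def by (simp add: mult.assoc)
  qed
  have "dirichlet \<Omega> A (grad_pull h w) (grad_pull h w) = (LINT x|vol. F (h *v x))"
    unfolding dirichlet_def by (intro Bochner_Integration.integral_cong refl pt) simp
  also have "\<dots> = (LINT x|vol. F x)"
    by (rule measure_preserving_integral[OF measure_preserving_domain[OF orth lip inv] F])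
  finally show ?thesis unfolding F_def dirichlet_def .
qed

text \<open>For the boundary part, equivariance moves the symmetry out of \<open>B\<close> almost
  everywhere, and the boundary measure is invariant under it.\<close>

lemma robin_form_pull:
  assumes g: "g \<in> G" and t: "h1_triple \<Omega> u w b"
  defines "h \<equiv> matrix_inv g"
  shows "aform (grad_pull h w) (\<lambda>x. b (h *v x)) (grad_pull h w) (\<lambda>x. b (h *v x)) = aform w b w b"
proof -
  have orth: "orthogonal_matrix h" and inv: "\<And>x. h *v x \<in> \<Omega> \<longleftrightarrow> x \<in> \<Omega>"
    using group_orthogonal[OF g] unfolding h_def by auto
  note mp = measure_preserving_bdry[OF orth lip inv]
  have b: "b \<in> L2 bdry" by (rule h1_tripleD[OF t])
  have Bb: "B b \<in> L2 bdry" by (rule B_L2[OF b])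
  note L = measure_preserving_L2(1)[OF mp b] measure_preserving_L2(1)[OF mp Bb]
  have "AE x in bdry. B (T_act g b) x = T_act g (B b) x"
    using equivariant_B g b unfolding G_equivariant_def by blast
  then have "AE x in bdry. B (\<lambda>x. b (h *v x)) x = B b (h *v x)" by (simp add: T_act_def h_def)
  then have "l2inner bdry (B (\<lambda>x. b (h *v x))) (\<lambda>x. b (h *v x)) = l2inner bdry (\<lambda>x. B b (h *v x)) (\<lambda>x. b (h *v x))"
    by (rule l2inner_cong_AE) (intro L2_measurable B_L2 L)+
  also have "\<dots> = l2inner bdry (B b) b" by (rule measure_preserving_l2inner[OF mp Bb b])
  finally show ?thesis unfolding robin_form_def
    using dirichlet_pull[OF g, of w] h1_tripleD(4)[OF t] unfolding h_def by simp
qed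

text \<open>The difference \<open>v = T\<^sub>g u - u\<close> satisfies \<open>a[v, v] = - s |v|\<^sup>2\<close>, and its trace has mean zero.\<close>
lemma eigenfunction_invariant:
  assumes C: "C \<ge> 0" "\<And>u w g. h1_triple \<Omega> u w g \<Longrightarrow> (LINT x|bdry. g x) = 0 \<Longrightarrow> (l2norm bdry g)\<^sup>2 \<le> C * grad_sq \<Omega> w"
    and \<beta>: "\<beta> \<ge> 0" "\<beta> * C \<le> \<alpha>" and small: "restr_norm_le bdry B \<beta>"
    and s: "spectral_bound vol (negLB_rel \<Omega> A B) = ereal s"
    and ef: "is_eigenfunction vol (negLB_rel \<Omega> A B) (complex_of_real s) u"
  shows "G_invariant \<Omega> G u"
  unfolding G_invariant_def
proof
  fix g assume g: "g \<in> G"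
  have s_pos: "s > 0" using spectral_bound_pos s by simp
  \<comment> \<open>A finite spectral bound leaves room above it, for instance at
    \<open>s + 1\<close>. One such point suffices to give the eigenfunction a trace.\<close>
  have "\<exists>z. in_resolvent vol (negLB_rel \<Omega> A B) z"
  proof (rule ccontr)
    assume "\<not> ?thesis"
    then have "complex_of_real (s + 1) \<in> op_spectrum vol (negLB_rel \<Omega> A B)" by (simp add: op_spectrum_def)
    then have "ereal (Re (complex_of_real (s + 1))) \<le> spectral_bound vol (negLB_rel \<Omega> A B)"
      unfolding spectral_bound_def by (rule SUP_upper)
    then show False using s by simp
  qed
  then obtain z0 where z0: "in_resolvent vol (negLB_rel \<Omega> A B) z0" ..
  have LB: "LB_rel \<Omega> A B u (\<lambda>x. 0 + (- complex_of_real s) * u x)" and uL: "u \<in> L2 vol"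
    using ef unfolding is_eigenfunction_def negLB_rel_def by auto
  have "u \<in> H1 \<Omega>" using LB unfolding LB_rel_def by blast
  from in_resolvent_imp_trace[OF lip z0 this] obtain w b where t: "h1_triple \<Omega> u w b"
    unfolding trace_rel_iff_h1_triple by blast
  define h where "h = matrix_inv g"
  have orth: "orthogonal_matrix h" and inv: "\<And>x. h *v x \<in> \<Omega> \<longleftrightarrow> x \<in> \<Omega>"
    using group_orthogonal[OF g] unfolding h_def by auto
  note mp = measure_preserving_domain[OF orth lip inv] measure_preserving_bdry[OF orth lip inv]
  define Tu where "Tu = (\<lambda>x. u (h *v x))"
  define Tw where "Tw = grad_pull h w"
  define Tb where "Tb = (\<lambda>x. b (h *v x))"
  have tT: "h1_triple \<Omega> Tu Tw Tb"
    unfolding Tu_def Tw_def Tb_def by (rule h1_triple_pull[OF orth lip inv t])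
  have TuL: "Tu \<in> L2 vol" by (rule h1_tripleD[OF tT])
  have nT: "l2norm vol Tu = l2norm vol u" unfolding Tu_def by (rule measure_preserving_L2[OF mp(1) uL])
  define v where "v = (\<lambda>x. Tu x + complex_of_real (-1) * u x)"
  define wv where "wv = (\<lambda>x. \<chi> i. Tw x $ i + complex_of_real (-1) * w x $ i)"
  define bv where "bv = (\<lambda>x. Tb x + complex_of_real (-1) * b x)"
  have tv: "h1_triple \<Omega> v wv bv" unfolding v_def wv_def bv_def by (rule h1_triple_lincomb[OF lip tT t])
  \<comment> \<open>The eigenvalue equation tested with an arbitrary triple.\<close>
  have a: "Re (aform w b z k) = - s * Re (l2inner vol u y)" if "h1_triple \<Omega> y z k" for y z k
    using LB_rel_robin_form[OF LB t that] l2inner_lincomb_left[OF L2_zero uL h1_tripleD(3)[OF that], of "- complex_of_real s"]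
    by (simp add: l2inner_def)
  \<comment> \<open>The form at the transformed function equals the form at \<open>u\<close>, so all
    remaining terms have \<open>u\<close> in the first slot and are known from \<open>a\<close>. The
    same expansion of the norm, with equal norms of \<open>Tu\<close> and \<open>u\<close>, matches
    them up.\<close>
  have "Re (aform wv bv wv bv) = Re (aform Tw Tb Tw Tb) - 2 * Re (aform w b Tw Tb) + Re (aform w b w b)"
    using robin_form_expand[OF tT t, of "-1"] unfolding wv_def bv_def by simp
  also have "aform Tw Tb Tw Tb = aform w b w b"
    unfolding Tw_def Tb_def h_def by (rule robin_form_pull[OF g t])
  finally have form_v: "Re (aform wv bv wv bv) = - s * (l2norm vol v)\<^sup>2"
  proof -
    assume e: "Re (aform wv bv wv bv) = Re (aform w b w b) - 2 * Re (aform w b Tw Tb) + Re (aform w b w b)"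
    have nv: "(l2norm vol v)\<^sup>2 = 2 * (l2norm vol u)\<^sup>2 - 2 * Re (l2inner vol u Tu)"
      using l2norm_lincomb_square[OF TuL uL, of "-1"] nT unfolding v_def by simp
    show ?thesis unfolding e nv a[OF t] a[OF tT] by (simp add: l2inner_self algebra_simps)
  qed
  interpret fin: finite_measure bdry by (rule finite_measure_bdry[OF lip])
  have bL: "b \<in> L2 bdry" "Tb \<in> L2 bdry" using h1_tripleD(2)[OF t] h1_tripleD(2)[OF tT] by auto
  have one: "(\<lambda>_. 1) \<in> L2 bdry" by (simp add: L2_def)
  have int: "integrable bdry b" "integrable bdry Tb"
    using L2_integrable_mult'[OF bL(1) one] L2_integrable_mult'[OF bL(2) one] by auto
  have "(LINT x|bdry. Tb x) = (LINT x|bdry. b x)"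
    unfolding Tb_def by (rule measure_preserving_integral[OF mp(2) L2_measurable[OF bL(1)]])
  then have mean: "(LINT x|bdry. bv x) = 0" unfolding bv_def using int by simp
  have "l2norm bdry (B bv) \<le> \<beta> * l2norm bdry bv"
    using small mean h1_tripleD(2)[OF tv] unfolding restr_norm_le_def by blast
  from robin_form_ge[OF tv this]
  have "\<alpha> * grad_sq \<Omega> wv - \<beta> * (l2norm bdry bv)\<^sup>2 \<le> - s * (l2norm vol v)\<^sup>2" unfolding form_v .
  \<comment> \<open>Poincare applies because the trace of the difference has mean zero; with
    \<beta>\<open>* C\<close> at most \<alpha> the gradient terms leave a nonnegative remainder, so
    \<open>s\<close> times the squared norm is at most 0.\<close>
  moreover have "\<beta> * (l2norm bdry bv)\<^sup>2 \<le> \<beta> * (C * grad_sq \<Omega> wv)"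
    by (intro mult_left_mono C(2)[OF tv mean] \<beta>)
  moreover have "\<beta> * (C * grad_sq \<Omega> wv) \<le> \<alpha> * grad_sq \<Omega> wv"
    using \<beta>(2) grad_sq_nonneg[of \<Omega> wv] by (simp add: mult.assoc[symmetric] mult_right_mono)
  ultimately have "s * (l2norm vol v)\<^sup>2 \<le> 0" by linarith
  then have "l2norm vol v = 0" using s_pos by (simp add: mult_le_0_iff)
  then have "AE x in vol. v x = 0" by (rule l2norm_eq_0_AE[OF h1_tripleD(3)[OF tv]])
  then show "AE x in vol. T_act g u x = u x"
    by eventually_elim (simp add: v_def Tu_def T_act_def h_def)
qed

end

theorem theorem5p4:
  fixes \<Omega> :: "(real^'n) set" and \<alpha> :: real
  assumes "lipschitz_domain \<Omega>" and "\<alpha> > 0"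
  shows "(\<forall>G A B. thm_hyps \<Omega> \<alpha> G A B \<longrightarrow>
            spectral_bound (lebesgue_on \<Omega>) (negLB_rel \<Omega> A B) > 0)
       \<and> (\<exists>\<beta>>0. \<forall>G A B. thm_hyps \<Omega> \<alpha> G A B \<longrightarrow> restr_norm_le (bdry_measure \<Omega>) B \<beta> \<longrightarrow>
            (\<forall>s u. spectral_bound (lebesgue_on \<Omega>) (negLB_rel \<Omega> A B) = ereal s \<longrightarrow>
               is_eigenfunction (lebesgue_on \<Omega>) (negLB_rel \<Omega> A B) (complex_of_real s) u \<longrightarrow>
               G_invariant \<Omega> G u))"
proof -
  obtain C where C: "C \<ge> 0" "\<And>u w g. h1_triple \<Omega> u w g \<Longrightarrow> (LINT x|bdry_measure \<Omega>. g x) = 0 \<Longrightarrow>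
    (l2norm (bdry_measure \<Omega>) g)\<^sup>2 \<le> C * grad_sq \<Omega> w"
    using h1_triple_poincare[OF assms(1)] by blast
  \<comment> \<open>\<open>C\<close> was obtained from \<Omega> alone, before \<open>G\<close>,
    \<open>A\<close> and \<open>B\<close> are introduced. Adding 1 keeps the quotient defined when
    \<open>C = 0\<close> and still gives \<beta>\<open>* C\<close> at most \<alpha>.\<close>
  define \<beta> where "\<beta> = \<alpha> / (C + 1)"
  have \<beta>: "\<beta> > 0" "\<beta> * C \<le> \<alpha>" unfolding \<beta>_def using assms(2) C(1) by (auto simp: field_simps)
  show ?thesis
  proof (intro conjI allI impI exI[of _ \<beta>])
    show "spectral_bound (lebesgue_on \<Omega>) (negLB_rel \<Omega> A B) > 0" if "thm_hyps \<Omega> \<alpha> G A B" for G A B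
      by (rule spectral_bound_pos[OF assms that])
    show "G_invariant \<Omega> G u"
      if "thm_hyps \<Omega> \<alpha> G A B" "restr_norm_le (bdry_measure \<Omega>) B \<beta>"
        "spectral_bound (lebesgue_on \<Omega>) (negLB_rel \<Omega> A B) = ereal s"
        "is_eigenfunction (lebesgue_on \<Omega>) (negLB_rel \<Omega> A B) (complex_of_real s) u" for G A B s u
      by (rule eigenfunction_invariant[OF assms that(1) C less_imp_le[OF \<beta>(1)] \<beta>(2) that(2-4)])
  qed (rule \<beta>(1))
qed

end
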